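(* Let $\varphi:M^2\to N^n$ be a CMC biconservative surface in a Riemannian manifold and assume that $M$ is compact. If the Gaussian curvature of $M$ satisfies $K\ge0$, then $\nabla A_H=0$ and $M$ is flat or pseudoumbilical.
   Context: All manifolds, metrics and maps are smooth; all manifolds are connected and oriented. A surface $\varphi:M^2\to N^n$ is a Riemannian (isometric) immersion of a 2-dimensional Riemannian manifold into a Riemannian manifold. $B$ is the second fundamental form, $H=\frac12\operatorname{trace}B$ the mean curvature vector field, and $A_H$ the shape operator in the direction of $H$, with $\langle A_H(X),Y\rangle=\langle B(X,Y),H\rangle$. CMC means that $|H|$ is constant. The stress-bienergy tensor of a surface is $S_2=-2|H|^2I+4A_H$ ($I$ the identity), and $M$ is biconservative if $\operatorname{div}S_2=0$, where $\operatorname{div}T=\sum_i(\nabla_{X_i}T)(X_i)$ for a local orthonormal frame $\{X_i\}$. $M$ is pseudoumbilical if $A_H=|H|^2I$ on $M$; flat means $K=0$ on $M$. *)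

theory Defs
  imports "HOL-Analysis.Analysis"
begin

section \<open>Smooth functions on open subsets of Euclidean space\<close>

text \<open>On an open set, a function is \<open>C\<^sup>k\<^sup>+\<^sup>1\<close> iff it is differentiable there and all its directional
  derivatives are \<open>C\<^sup>k\<close>. The predicates are only used for open \<open>S\<close>.\<close>

primrec Ck_on :: "nat \<Rightarrow> ('a::euclidean_space \<Rightarrow> 'b::real_normed_vector) \<Rightarrow> 'a set \<Rightarrow> bool" where
  "Ck_on 0 f S \<longleftrightarrow> continuous_on S f"
| "Ck_on (Suc k) f S \<longleftrightarrow>
     (\<forall>x\<in>S. f differentiable (at x)) \<and> (\<forall>v. Ck_on k (\<lambda>x. frechet_derivative f (at x) v) S)"

definition smooth_on :: "('a::euclidean_space \<Rightarrow> 'b::real_normed_vector) \<Rightarrow> 'a set \<Rightarrow> bool" where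
  "smooth_on f S \<longleftrightarrow> (\<forall>k. Ck_on k f S)"

section \<open>Oriented Riemannian manifolds\<close>

type_synonym ('a, 'm) chart = "'a set \<times> ('a \<Rightarrow> real ^ 'm)"

text \<open>\<open>gram M c x\<close> is the matrix of the metric in the chart \<open>c\<close>, at the point with coordinates \<open>x\<close>. The
  atlas need not be maximal: it determines the smooth structure and the orientation.\<close>

record ('a, 'm) riemannian =
  points :: "'a topology"
  atlas :: "('a, 'm::finite) chart set"
  gram :: "('a, 'm) chart \<Rightarrow> real ^ 'm \<Rightarrow> real ^ 'm ^ 'm"

definition chart_inv :: "('a, 'm::finite) chart \<Rightarrow> real ^ 'm \<Rightarrow> 'a" where
  "chart_inv c = inv_into (fst c) (snd c)"

definition coord_dom :: "('a, 'm::finite) chart \<Rightarrow> (real ^ 'm) set" where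
  "coord_dom c = snd c ` fst c"

definition transition :: "('a, 'm::finite) chart \<Rightarrow> ('a, 'm) chart \<Rightarrow> real ^ 'm \<Rightarrow> real ^ 'm" where
  "transition c d = snd d \<circ> chart_inv c"

definition overlap_dom :: "('a, 'm::finite) chart \<Rightarrow> ('a, 'm) chart \<Rightarrow> (real ^ 'm) set" where
  "overlap_dom c d = snd c ` (fst c \<inter> fst d)"

definition is_chart :: "'a topology \<Rightarrow> ('a, 'm::finite) chart \<Rightarrow> bool" where
  "is_chart X c \<longleftrightarrow> openin X (fst c) \<and> open (coord_dom c) \<and>
     homeomorphic_map (subtopology X (fst c)) (top_of_set (coord_dom c)) (snd c)"

definition oriented_smooth_atlas :: "'a topology \<Rightarrow> ('a, 'm::finite) chart set \<Rightarrow> bool" where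
  "oriented_smooth_atlas X A \<longleftrightarrow>
     (\<forall>c\<in>A. is_chart X c) \<and> (\<Union>c\<in>A. fst c) = topspace X \<and>
     (\<forall>c\<in>A. \<forall>d\<in>A. smooth_on (transition c d) (overlap_dom c d) \<and>
        (\<forall>x\<in>overlap_dom c d. det (jacobian (transition c d) (at x)) > 0))"

definition metric_ip :: "real ^ 'm ^ 'm \<Rightarrow> real ^ 'm \<Rightarrow> real ^ 'm \<Rightarrow> real" where
  "metric_ip G u v = u \<bullet> (G *v v)"

text \<open>A smooth symmetric positive definite \<open>(0,2)\<close>-tensor field, given by its components in each chart,
  related by the tensor transformation law on overlaps.\<close>

definition riemannian_metric ::
  "('a, 'm::finite) chart set \<Rightarrow> (('a, 'm) chart \<Rightarrow> real ^ 'm \<Rightarrow> real ^ 'm ^ 'm) \<Rightarrow> bool" where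
  "riemannian_metric A g \<longleftrightarrow>
     (\<forall>c\<in>A. smooth_on (g c) (coord_dom c) \<and>
        (\<forall>x\<in>coord_dom c. transpose (g c x) = g c x \<and> (\<forall>u. u \<noteq> 0 \<longrightarrow> metric_ip (g c x) u u > 0))) \<and>
     (\<forall>c\<in>A. \<forall>d\<in>A. \<forall>x\<in>overlap_dom c d. \<forall>u v.
        metric_ip (g c x) u v =
        metric_ip (g d (transition c d x))
          (frechet_derivative (transition c d) (at x) u)
          (frechet_derivative (transition c d) (at x) v))"

definition riemannian_manifold :: "('a, 'm::finite) riemannian \<Rightarrow> bool" where
  "riemannian_manifold M \<longleftrightarrow>
     Hausdorff_space (points M) \<and> second_countable (points M) \<and> connected_space (points M) \<and>
     oriented_smooth_atlas (points M) (atlas M) \<and> riemannian_metric (atlas M) (gram M)"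

section \<open>Riemannian geometry in a chart\<close>

text \<open>Throughout this section \<open>g\<close> is the Gram matrix of the metric as a function of the coordinates.\<close>

definition christoffel ::
  "(real ^ 'm \<Rightarrow> real ^ 'm ^ 'm) \<Rightarrow> real ^ 'm \<Rightarrow> 'm \<Rightarrow> 'm \<Rightarrow> 'm::finite \<Rightarrow> real" where
  "christoffel g x k i j = (1/2) * (\<Sum>l\<in>UNIV. matrix_inv (g x) $ k $ l *
     (frechet_derivative g (at x) (axis i 1) $ j $ l +
      frechet_derivative g (at x) (axis j 1) $ i $ l -
      frechet_derivative g (at x) (axis l 1) $ i $ j))"

definition Gam ::
  "(real ^ 'm \<Rightarrow> real ^ 'm ^ 'm) \<Rightarrow> real ^ 'm \<Rightarrow> real ^ 'm \<Rightarrow> real ^ 'm::finite \<Rightarrow> real ^ 'm" where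
  "Gam g x u v = (\<chi> k. \<Sum>i\<in>UNIV. \<Sum>j\<in>UNIV. christoffel g x k i j * u $ i * v $ j)"

text \<open>The Levi-Civita derivative \<open>\<nabla>\<^sub>u Y\<close> at \<open>x\<close>, for a tangent vector \<open>u\<close> and a vector field \<open>Y\<close>.\<close>

definition levi_civita ::
  "(real ^ 'm \<Rightarrow> real ^ 'm ^ 'm) \<Rightarrow> (real ^ 'm \<Rightarrow> real ^ 'm::finite) \<Rightarrow> real ^ 'm \<Rightarrow> real ^ 'm \<Rightarrow> real ^ 'm"
  where "levi_civita g Y x u = frechet_derivative Y (at x) u + Gam g x u (Y x)"

text \<open>The tensors \<open>(\<nabla>\<^sub>u T)(v) = \<nabla>\<^sub>u (T v) - T (\<nabla>\<^sub>u v)\<close> and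
  \<open>R(u,v)w = \<nabla>\<^sub>u \<nabla>\<^sub>v w - \<nabla>\<^sub>v \<nabla>\<^sub>u w - \<nabla>\<^bsub>[u,v]\<^esub> w\<close> are evaluated on the extensions of \<open>u\<close>, \<open>v\<close>, \<open>w\<close>
  with constant coordinates; then \<open>[u,v] = 0\<close>.\<close>

definition nabla_endo ::
  "(real ^ 'm \<Rightarrow> real ^ 'm ^ 'm) \<Rightarrow> (real ^ 'm \<Rightarrow> real ^ 'm \<Rightarrow> real ^ 'm::finite) \<Rightarrow>
   real ^ 'm \<Rightarrow> real ^ 'm \<Rightarrow> real ^ 'm \<Rightarrow> real ^ 'm" where
  "nabla_endo g T x u v = levi_civita g (\<lambda>y. T y v) x u - T x (levi_civita g (\<lambda>_. v) x u)"

definition riemann_curv ::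
  "(real ^ 'm \<Rightarrow> real ^ 'm ^ 'm) \<Rightarrow> real ^ 'm \<Rightarrow> real ^ 'm \<Rightarrow> real ^ 'm \<Rightarrow> real ^ 'm::finite \<Rightarrow> real ^ 'm"
  where "riemann_curv g x u v w =
     levi_civita g (\<lambda>y. levi_civita g (\<lambda>_. w) y v) x u -
     levi_civita g (\<lambda>y. levi_civita g (\<lambda>_. w) y u) x v"

definition gauss_curv :: "(real ^ 2 \<Rightarrow> real ^ 2 ^ 2) \<Rightarrow> real ^ 2 \<Rightarrow> real" where
  "gauss_curv g x = (let e = axis 1 1; f = axis 2 1 in
     metric_ip (g x) (riemann_curv g x e f f) e /
     (metric_ip (g x) e e * metric_ip (g x) f f - (metric_ip (g x) e f)\<^sup>2))"

text \<open>\<open>g\<^sup>i\<^sup>j b(\<partial>\<^sub>i, \<partial>\<^sub>j)\<close>; the lemma below identifies it with the sum over an orthonormal basis.\<close>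

definition metric_trace ::
  "real ^ 'm ^ 'm \<Rightarrow> (real ^ 'm \<Rightarrow> real ^ 'm::finite \<Rightarrow> 'b::real_vector) \<Rightarrow> 'b" where
  "metric_trace G b = (\<Sum>i\<in>UNIV. \<Sum>j\<in>UNIV. matrix_inv G $ i $ j *\<^sub>R b (axis i 1) (axis j 1))"

definition divergence ::
  "(real ^ 'm \<Rightarrow> real ^ 'm ^ 'm) \<Rightarrow> (real ^ 'm \<Rightarrow> real ^ 'm \<Rightarrow> real ^ 'm::finite) \<Rightarrow>
   real ^ 'm \<Rightarrow> real ^ 'm" where
  "divergence g T x = metric_trace (g x) (nabla_endo g T x)"

section \<open>The second fundamental form in charts\<close>

text \<open>In this section \<open>F\<close> is the coordinate expression of the immersion, \<open>g\<close> and \<open>h\<close> are the Gram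
  matrices of the domain and of the target. The first definition is the pullback connection:
  \<open>\<nabla>\<^sub>u V\<close> for a vector field \<open>V\<close> along \<open>F\<close>. The second is \<open>B(u,v) = \<nabla>\<^sub>u (dF v) - dF (\<nabla>\<^sub>u v)\<close>.\<close>

definition nabla_along ::
  "(real ^ 'n \<Rightarrow> real ^ 'n ^ 'n) \<Rightarrow> (real ^ 'm::finite \<Rightarrow> real ^ 'n::finite) \<Rightarrow>
   (real ^ 'm \<Rightarrow> real ^ 'n) \<Rightarrow> real ^ 'm \<Rightarrow> real ^ 'm \<Rightarrow> real ^ 'n" where
  "nabla_along h F V x u =
     frechet_derivative V (at x) u + Gam h (F x) (frechet_derivative F (at x) u) (V x)"

definition second_ff ::
  "(real ^ 'm \<Rightarrow> real ^ 'm ^ 'm) \<Rightarrow> (real ^ 'n \<Rightarrow> real ^ 'n ^ 'n) \<Rightarrow>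
   (real ^ 'm::finite \<Rightarrow> real ^ 'n::finite) \<Rightarrow>
   real ^ 'm \<Rightarrow> real ^ 'm \<Rightarrow> real ^ 'm \<Rightarrow> real ^ 'n" where
  "second_ff g h F x u v =
     nabla_along h F (\<lambda>y. frechet_derivative F (at y) v) x u -
     frechet_derivative F (at x) (levi_civita g (\<lambda>_. v) x u)"

definition mean_curv ::
  "(real ^ 2 \<Rightarrow> real ^ 2 ^ 2) \<Rightarrow> (real ^ 'n \<Rightarrow> real ^ 'n ^ 'n) \<Rightarrow> (real ^ 2 \<Rightarrow> real ^ 'n::finite) \<Rightarrow>
   real ^ 2 \<Rightarrow> real ^ 'n" where
  "mean_curv g h F x = (1/2) *\<^sub>R metric_trace (g x) (second_ff g h F x)"

definition mean_curv_norm ::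
  "(real ^ 2 \<Rightarrow> real ^ 2 ^ 2) \<Rightarrow> (real ^ 'n \<Rightarrow> real ^ 'n ^ 'n) \<Rightarrow> (real ^ 2 \<Rightarrow> real ^ 'n::finite) \<Rightarrow>
   real ^ 2 \<Rightarrow> real" where
  "mean_curv_norm g h F x = sqrt (metric_ip (h (F x)) (mean_curv g h F x) (mean_curv g h F x))"

text \<open>The shape operator \<open>A\<^sub>H\<close>.\<close>

definition shape_H ::
  "(real ^ 2 \<Rightarrow> real ^ 2 ^ 2) \<Rightarrow> (real ^ 'n \<Rightarrow> real ^ 'n ^ 'n) \<Rightarrow> (real ^ 2 \<Rightarrow> real ^ 'n::finite) \<Rightarrow>
   real ^ 2 \<Rightarrow> real ^ 2 \<Rightarrow> real ^ 2" where
  "shape_H g h F x u = (THE w. \<forall>v.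
     metric_ip (g x) w v = metric_ip (h (F x)) (second_ff g h F x u v) (mean_curv g h F x))"

definition stress_bienergy ::
  "(real ^ 2 \<Rightarrow> real ^ 2 ^ 2) \<Rightarrow> (real ^ 'n \<Rightarrow> real ^ 'n ^ 'n) \<Rightarrow> (real ^ 2 \<Rightarrow> real ^ 'n::finite) \<Rightarrow>
   real ^ 2 \<Rightarrow> real ^ 2 \<Rightarrow> real ^ 2" where
  "stress_bienergy g h F x u =
     (- 2 * (mean_curv_norm g h F x)\<^sup>2) *\<^sub>R u + 4 *\<^sub>R shape_H g h F x u"

section \<open>Immersed surfaces\<close>

definition local_rep ::
  "('a \<Rightarrow> 'b) \<Rightarrow> ('a, 'm::finite) chart \<Rightarrow> ('b, 'n::finite) chart \<Rightarrow> real ^ 'm \<Rightarrow> real ^ 'n" where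
  "local_rep \<phi> c d = snd d \<circ> \<phi> \<circ> chart_inv c"

definition local_dom ::
  "('a \<Rightarrow> 'b) \<Rightarrow> ('a, 'm::finite) chart \<Rightarrow> ('b, 'n::finite) chart \<Rightarrow> (real ^ 'm) set" where
  "local_dom \<phi> c d = snd c ` {p \<in> fst c. \<phi> p \<in> fst d}"

definition smooth_map ::
  "('a, 'm::finite) riemannian \<Rightarrow> ('b, 'n::finite) riemannian \<Rightarrow> ('a \<Rightarrow> 'b) \<Rightarrow> bool" where
  "smooth_map M N \<phi> \<longleftrightarrow> continuous_map (points M) (points N) \<phi> \<and>
     (\<forall>c\<in>atlas M. \<forall>d\<in>atlas N. smooth_on (local_rep \<phi> c d) (local_dom \<phi> c d))"

definition isometric_immersion ::
  "('a, 'm::finite) riemannian \<Rightarrow> ('b, 'n::finite) riemannian \<Rightarrow> ('a \<Rightarrow> 'b) \<Rightarrow> bool" where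
  "isometric_immersion M N \<phi> \<longleftrightarrow> smooth_map M N \<phi> \<and>
     (\<forall>c\<in>atlas M. \<forall>d\<in>atlas N. \<forall>x\<in>local_dom \<phi> c d.
        let D = frechet_derivative (local_rep \<phi> c d) (at x) in
        inj D \<and>
        (\<forall>u v. metric_ip (gram M c x) u v =
               metric_ip (gram N d (local_rep \<phi> c d x)) (D u) (D v)))"

definition surface ::
  "('a, 2) riemannian \<Rightarrow> ('b, 'n::finite) riemannian \<Rightarrow> ('a \<Rightarrow> 'b) \<Rightarrow> bool" where
  "surface M N \<phi> \<longleftrightarrow>
     riemannian_manifold M \<and> riemannian_manifold N \<and> isometric_immersion M N \<phi>"

definition CMC :: "('a, 2) riemannian \<Rightarrow> ('b, 'n::finite) riemannian \<Rightarrow> ('a \<Rightarrow> 'b) \<Rightarrow> bool" where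
  "CMC M N \<phi> \<longleftrightarrow> (\<exists>r. \<forall>c\<in>atlas M. \<forall>d\<in>atlas N. \<forall>x\<in>local_dom \<phi> c d.
     mean_curv_norm (gram M c) (gram N d) (local_rep \<phi> c d) x = r)"

definition biconservative ::
  "('a, 2) riemannian \<Rightarrow> ('b, 'n::finite) riemannian \<Rightarrow> ('a \<Rightarrow> 'b) \<Rightarrow> bool" where
  "biconservative M N \<phi> \<longleftrightarrow> (\<forall>c\<in>atlas M. \<forall>d\<in>atlas N. \<forall>x\<in>local_dom \<phi> c d.
     divergence (gram M c) (stress_bienergy (gram M c) (gram N d) (local_rep \<phi> c d)) x = 0)"

definition parallel_shape_H ::
  "('a, 2) riemannian \<Rightarrow> ('b, 'n::finite) riemannian \<Rightarrow> ('a \<Rightarrow> 'b) \<Rightarrow> bool" where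
  "parallel_shape_H M N \<phi> \<longleftrightarrow> (\<forall>c\<in>atlas M. \<forall>d\<in>atlas N. \<forall>x\<in>local_dom \<phi> c d. \<forall>u v.
     nabla_endo (gram M c) (shape_H (gram M c) (gram N d) (local_rep \<phi> c d)) x u v = 0)"

definition pseudoumbilical ::
  "('a, 2) riemannian \<Rightarrow> ('b, 'n::finite) riemannian \<Rightarrow> ('a \<Rightarrow> 'b) \<Rightarrow> bool" where
  "pseudoumbilical M N \<phi> \<longleftrightarrow> (\<forall>c\<in>atlas M. \<forall>d\<in>atlas N. \<forall>x\<in>local_dom \<phi> c d. \<forall>u.
     shape_H (gram M c) (gram N d) (local_rep \<phi> c d) x u =
     (mean_curv_norm (gram M c) (gram N d) (local_rep \<phi> c d) x)\<^sup>2 *\<^sub>R u)"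

definition nonneg_gauss_curv :: "('a, 2) riemannian \<Rightarrow> bool" where
  "nonneg_gauss_curv M \<longleftrightarrow> (\<forall>c\<in>atlas M. \<forall>x\<in>coord_dom c. gauss_curv (gram M c) x \<ge> 0)"

definition flat :: "('a, 2) riemannian \<Rightarrow> bool" where
  "flat M \<longleftrightarrow> (\<forall>c\<in>atlas M. \<forall>x\<in>coord_dom c. gauss_curv (gram M c) x = 0)"

section \<open>Consistency of the definitions\<close>

lemma matrix_inv_mult:
  fixes A :: "real ^ 'm ^ 'm::finite"
  assumes "invertible A"
  shows "A ** matrix_inv A = mat 1" and "matrix_inv A ** A = mat 1"
  using someI_ex[OF assms[unfolded invertible_def]] unfolding matrix_inv_def by auto

lemma metric_trace_orthonormal:
  fixes b :: "real ^ 'm \<Rightarrow> real ^ 'm \<Rightarrow> 'b::real_vector" and e :: "'m::finite \<Rightarrow> real ^ 'm"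
  assumes b1: "\<And>v. linear (\<lambda>u. b u v)" and b2: "\<And>u. linear (b u)"
    and e: "\<And>i j. metric_ip G (e i) (e j) = (if i = j then 1 else 0)"
  shows "metric_trace G b = (\<Sum>i\<in>UNIV. b (e i) (e i))"
proof -
  define P where "P = (\<chi> i. e i)"
  have "(P ** (G ** transpose P)) $ i $ j = mat 1 $ i $ j" for i j
    using e[of i j] unfolding metric_ip_def P_def
    by (simp add: matrix_matrix_mult_def matrix_vector_mult_def transpose_def inner_vec_def mat_def)
  then have 1: "P ** (G ** transpose P) = mat 1"
    by (simp add: vec_eq_iff)
  then have "(G ** transpose P) ** P = mat 1"
    by (simp add: matrix_left_right_inverse)
  then have 2: "G ** (transpose P ** P) = mat 1"
    by (simp add: matrix_mul_assoc)
  then have 3: "(transpose P ** P) ** G = mat 1"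
    by (simp add: matrix_left_right_inverse)
  have "matrix_inv G = matrix_inv G ** (G ** (transpose P ** P))"
    by (simp only: 2 matrix_mul_rid)
  also have "\<dots> = (matrix_inv G ** G) ** (transpose P ** P)"
    by (simp only: matrix_mul_assoc)
  also have "\<dots> = transpose P ** P"
    using 2 3 by (subst matrix_inv_mult(2)) (auto simp: invertible_def)
  finally have "matrix_inv G = transpose P ** P" .
  then have inv: "matrix_inv G $ i $ j = (\<Sum>k\<in>UNIV. e k $ i * e k $ j)" for i j
    by (simp add: matrix_matrix_mult_def transpose_def P_def)
  have ex: "v = (\<Sum>i\<in>UNIV. v $ i *\<^sub>R axis i 1)" for v :: "real ^ 'm"
    using basis_expansion[of v] by (simp add: scalar_mult_eq_scaleR)
  have "b (e k) (e k) = (\<Sum>i\<in>UNIV. \<Sum>j\<in>UNIV. (e k $ i * e k $ j) *\<^sub>R b (axis i 1) (axis j 1))" for k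
  proof -
    have "b (e k) (e k) = (\<Sum>i\<in>UNIV. e k $ i *\<^sub>R b (axis i 1) (e k))"
      by (subst (1) ex[of "e k"]) (simp add: linear_sum[OF b1] linear_scale[OF b1])
    also have "\<dots> = (\<Sum>i\<in>UNIV. e k $ i *\<^sub>R (\<Sum>j\<in>UNIV. e k $ j *\<^sub>R b (axis i 1) (axis j 1)))"
      by (subst (2) ex[of "e k"]) (simp add: linear_sum[OF b2] linear_scale[OF b2])
    finally show ?thesis by (simp add: scaleR_sum_right)
  qed
  then have "(\<Sum>k\<in>UNIV. b (e k) (e k)) =
      (\<Sum>i\<in>UNIV. \<Sum>j\<in>UNIV. \<Sum>k\<in>UNIV. (e k $ i * e k $ j) *\<^sub>R b (axis i 1) (axis j 1))"
    by (simp only:) (subst sum.swap, rule sum.cong[OF refl], rule sum.swap)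
  then show ?thesis
    unfolding metric_trace_def by (simp add: inv scaleR_sum_left)
qed


text \<open>The connection defined by the Christoffel symbols is torsion-free and metric.\<close>

lemma frechet_derivative_gram_sym:
  fixes g :: "real ^ 'm \<Rightarrow> real ^ 'm ^ 'm::finite"
  assumes d: "g differentiable (at x)" and S: "open S" "x \<in> S" and s: "\<And>y. y \<in> S \<Longrightarrow> transpose (g y) = g y"
  shows "frechet_derivative g (at x) u $ i $ j = frechet_derivative g (at x) u $ j $ i"
proof -
  have D: "(g has_derivative frechet_derivative g (at x)) (at x)"
    using d by (simp add: frechet_derivative_works)
  have c: "((\<lambda>y. g y $ a $ b) has_derivative (\<lambda>u. frechet_derivative g (at x) u $ a $ b)) (at x)" for a b
    by (intro bounded_linear.has_derivative[OF bounded_linear_vec_nth] D)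
  have eq: "g y $ i $ j = g y $ j $ i" if "y \<in> S" for y
    using arg_cong[OF s[OF that], of "\<lambda>m. m $ j $ i"] by (simp add: transpose_def)
  have "((\<lambda>y. g y $ j $ i) has_derivative (\<lambda>u. frechet_derivative g (at x) u $ i $ j)) (at x)"
    by (rule has_derivative_transform_within_open[OF c[of i j] S]) (simp add: eq)
  from has_derivative_unique[OF this c[of j i]] show ?thesis by (metis)
qed

lemma levi_civita_torsion_free:
  fixes g :: "real ^ 'm \<Rightarrow> real ^ 'm ^ 'm::finite"
  assumes "g differentiable (at x)" "open S" "x \<in> S" "\<And>y. y \<in> S \<Longrightarrow> transpose (g y) = g y"
  shows "levi_civita g (\<lambda>_. v) x u = levi_civita g (\<lambda>_. u) x v"
proof -
  have "christoffel g x k i j = christoffel g x k j i" for k i j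
    unfolding christoffel_def
    by (simp add: frechet_derivative_gram_sym[OF assms, of _ i j] algebra_simps)
  then have "Gam g x u v = Gam g x v u"
    unfolding Gam_def vec_eq_iff
    by (subst sum.swap) (simp add: mult_ac)
  then show ?thesis by (simp add: levi_civita_def)
qed

lemma levi_civita_metric:
  fixes g :: "real ^ 'm \<Rightarrow> real ^ 'm ^ 'm::finite"
  assumes d: "g differentiable (at x)" and S: "open S" "x \<in> S" and s: "\<And>y. y \<in> S \<Longrightarrow> transpose (g y) = g y"
    and inv: "invertible (g x)"
  shows "frechet_derivative (\<lambda>y. metric_ip (g y) v w) (at x) u =
    metric_ip (g x) (levi_civita g (\<lambda>_. v) x u) w + metric_ip (g x) v (levi_civita g (\<lambda>_. w) x u)"
proof -
  define D where "D = frechet_derivative g (at x)"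
  have D: "(g has_derivative D) (at x)"
    using d by (simp add: frechet_derivative_works D_def)
  then have lin: "linear D" by (rule has_derivative_linear)
  have sym: "D u $ i $ j = D u $ j $ i" for u i j
    unfolding D_def by (rule frechet_derivative_gram_sym[OF d S s])
  have gs: "g x $ i $ j = g x $ j $ i" for i j
    using arg_cong[OF s[OF S(2)], of "\<lambda>m. m $ j $ i"] by (simp add: transpose_def)
  have ip: "metric_ip G a b = (\<Sum>i\<in>UNIV. \<Sum>j\<in>UNIV. G $ i $ j * a $ i * b $ j)" for G :: "real^'m^'m" and a b
    by (simp add: metric_ip_def inner_vec_def matrix_vector_mult_def sum_distrib_left mult_ac)
  define C where "C i j l = (1/2) * (D (axis i 1) $ j $ l + D (axis j 1) $ i $ l - D (axis l 1) $ i $ j)" for i j l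
  have chr: "christoffel g x k i j = (\<Sum>l\<in>UNIV. matrix_inv (g x) $ k $ l * C i j l)" for k i j
    by (simp add: christoffel_def C_def D_def sum_distrib_left mult_ac)
  have gg: "(\<Sum>k\<in>UNIV. g x $ m $ k * matrix_inv (g x) $ k $ l) = (if m = l then 1 else 0)" for m l
    using arg_cong[OF matrix_inv_mult(1)[OF inv], of "\<lambda>M. M $ m $ l"]
    by (simp add: matrix_matrix_mult_def mat_def)
  have low: "(\<Sum>k\<in>UNIV. g x $ m $ k * christoffel g x k i j) = C i j m" for m i j
  proof -
    have "(\<Sum>k\<in>UNIV. g x $ m $ k * christoffel g x k i j)
        = (\<Sum>l\<in>UNIV. \<Sum>k\<in>UNIV. g x $ m $ k * matrix_inv (g x) $ k $ l * C i j l)"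
      unfolding chr sum_distrib_left by (subst sum.swap) (simp add: mult_ac)
    also have "\<dots> = (\<Sum>l\<in>UNIV. (if m = l then C i j l else 0))"
      by (simp add: gg if_distrib[of "\<lambda>t. t * _"] cong: if_cong flip: sum_distrib_right)
    finally show ?thesis by simp
  qed
  have lc: "levi_civita g (\<lambda>_. a) x u = Gam g x u a" for a
    by (simp add: levi_civita_def)
  have G1: "metric_ip (g x) b (Gam g x u a) =
      (\<Sum>m\<in>UNIV. \<Sum>i\<in>UNIV. \<Sum>j\<in>UNIV. C i j m * u $ i * a $ j * b $ m)" for a b
  proof -
    have "(g x *v Gam g x u a) $ m = (\<Sum>i\<in>UNIV. \<Sum>j\<in>UNIV. C i j m * u $ i * a $ j)" for m
    proof -
      have "(g x *v Gam g x u a) $ m =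
         (\<Sum>k\<in>UNIV. \<Sum>i\<in>UNIV. \<Sum>j\<in>UNIV. g x $ m $ k * christoffel g x k i j * u $ i * a $ j)"
        by (simp add: matrix_vector_mult_def Gam_def sum_distrib_left mult_ac)
      also have "\<dots> = (\<Sum>i\<in>UNIV. \<Sum>j\<in>UNIV. \<Sum>k\<in>UNIV. g x $ m $ k * christoffel g x k i j * u $ i * a $ j)"
        by (subst sum.swap, rule sum.cong[OF refl], rule sum.swap)
      also have "\<dots> = (\<Sum>i\<in>UNIV. \<Sum>j\<in>UNIV. C i j m * u $ i * a $ j)"
        by (simp add: low flip: sum_distrib_right)
      finally show ?thesis .
    qed
    then show ?thesis
      by (simp add: metric_ip_def inner_vec_def sum_distrib_left mult_ac)
  qed
  have "metric_ip (g x) a b = metric_ip (g x) b a" for a b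
    unfolding ip by (subst sum.swap) (simp add: gs mult_ac)
  then have "metric_ip (g x) (Gam g x u v) w = metric_ip (g x) w (Gam g x u v)" .
  also have "\<dots> = (\<Sum>i\<in>UNIV. \<Sum>j\<in>UNIV. \<Sum>m\<in>UNIV. C i j m * u $ i * v $ j * w $ m)"
    unfolding G1 by (subst sum.swap, rule sum.cong[OF refl], rule sum.swap)
  finally have G2: "metric_ip (g x) (Gam g x u v) w = \<dots>" .
  have G3: "metric_ip (g x) v (Gam g x u w) = (\<Sum>i\<in>UNIV. \<Sum>j\<in>UNIV. \<Sum>m\<in>UNIV. C i m j * u $ i * v $ j * w $ m)"
    unfolding G1 by (subst sum.swap) (simp add: mult_ac)
  have CC: "C i j m + C i m j = D (axis i 1) $ j $ m" for i j m
    unfolding C_def using sym[of "axis i 1" j m] sym[of "axis j 1" i m] sym[of "axis m 1" i j] by (simp add: field_simps)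
  have rhs: "metric_ip (g x) (Gam g x u v) w + metric_ip (g x) v (Gam g x u w) =
     (\<Sum>i\<in>UNIV. \<Sum>j\<in>UNIV. \<Sum>m\<in>UNIV. D (axis i 1) $ j $ m * u $ i * v $ j * w $ m)"
    unfolding G2 G3 by (simp add: distrib_right flip: sum.distrib CC)
  have "D u = (\<Sum>i\<in>UNIV. u $ i *\<^sub>R D (axis i 1))"
  proof -
    have "u = (\<Sum>i\<in>UNIV. u $ i *\<^sub>R axis i 1)"
      using basis_expansion[of u] by (simp add: scalar_mult_eq_scaleR)
    then have "D u = D (\<Sum>i\<in>UNIV. u $ i *\<^sub>R axis i 1)" by simp
    then show ?thesis by (simp add: linear_sum[OF lin] linear_scale[OF lin])
  qed
  then have Du: "D u $ j $ m = (\<Sum>i\<in>UNIV. u $ i * D (axis i 1) $ j $ m)" for j m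
    by (simp add: sum_component)
  have c: "((\<lambda>y. g y $ a $ b) has_derivative (\<lambda>u. D u $ a $ b)) (at x)" for a b
    by (intro bounded_linear.has_derivative[OF bounded_linear_vec_nth] D)
  have "((\<lambda>y. metric_ip (g y) v w) has_derivative (\<lambda>u. metric_ip (D u) v w)) (at x)"
    unfolding ip by (intro has_derivative_sum has_derivative_mult_left c)
  then have "frechet_derivative (\<lambda>y. metric_ip (g y) v w) (at x) u = metric_ip (D u) v w"
    using frechet_derivative_at by metis
  also have "\<dots> = (\<Sum>j\<in>UNIV. \<Sum>m\<in>UNIV. \<Sum>i\<in>UNIV. D (axis i 1) $ j $ m * u $ i * v $ j * w $ m)"
    unfolding ip Du by (simp add: sum_distrib_left sum_distrib_right mult_ac)
  also have "\<dots> = (\<Sum>j\<in>UNIV. \<Sum>i\<in>UNIV. \<Sum>m\<in>UNIV. D (axis i 1) $ j $ m * u $ i * v $ j * w $ m)"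
    by (rule sum.cong[OF refl], rule sum.swap)
  also have "\<dots> = (\<Sum>i\<in>UNIV. \<Sum>j\<in>UNIV. \<Sum>m\<in>UNIV. D (axis i 1) $ j $ m * u $ i * v $ j * w $ m)"
    by (rule sum.swap)
  finally show ?thesis unfolding lc rhs .
qed

text \<open>The definite description in \<open>shape_H\<close> is well-defined.\<close>

lemma metric_ip_shape_H:
  fixes F :: "real ^ 2 \<Rightarrow> real ^ 'n::finite"
  assumes inv: "invertible (g x)" and sym: "transpose (g x) = g x"
    and lin: "linear (second_ff g h F x u)"
  shows "metric_ip (g x) (shape_H g h F x u) v =
    metric_ip (h (F x)) (second_ff g h F x u v) (mean_curv g h F x)"
proof -
  define L where "L = (\<lambda>v. metric_ip (h (F x)) (second_ff g h F x u v) (mean_curv g h F x))"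
  have "linear L"
    unfolding L_def metric_ip_def
    by (rule linearI) (simp_all add: linear_add[OF lin] linear_scale[OF lin] inner_add_left)
  define a where "a = adjoint L 1"
  have a: "L v = a \<bullet> v" for v
    using adjoint_works[OF \<open>linear L\<close>, of v 1] by (simp add: a_def inner_commute)
  define w where "w = matrix_inv (g x) *v a"
  have ip: "metric_ip (g x) z v = (g x *v z) \<bullet> v" for z v
    by (metis metric_ip_def dot_lmul_matrix sym transpose_matrix_vector)
  have "\<exists>!z. \<forall>v. metric_ip (g x) z v = L v"
  proof (rule ex1I[of _ w])
    show "\<forall>v. metric_ip (g x) w v = L v"
      by (simp add: ip a w_def matrix_vector_mul_assoc matrix_inv_mult(1)[OF inv])
  next
    fix z assume "\<forall>v. metric_ip (g x) z v = L v"
    then have "g x *v z = a"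
      unfolding ip a by (metis vector_eq_rdot)
    then have "w = (matrix_inv (g x) ** g x) *v z"
      by (simp add: w_def matrix_vector_mul_assoc flip: \<open>g x *v z = a\<close>)
    then show "z = w" by (simp add: matrix_inv_mult(2)[OF inv])
  qed
  from theI'[OF this] show ?thesis
    unfolding shape_H_def L_def by blast
qed

end

theory Submission
  imports Defs
begin

text \<open>Since \<open>|H|\<close> is constant, \<open>div A\<^sub>H = 0\<close>; in dimension two the traceless part of \<open>A\<^sub>H\<close> is then a
  Codazzi tensor, the real part of a holomorphic quadratic differential \<open>\<psi> \<theta>\<^sup>2\<close>. In coordinates with
  metric \<open>E dx\<^sup>2 + 2F dx dy + G dy\<^sup>2 = E |\<theta>|\<^sup>2\<close>, \<open>\<theta> = dx + \<tau> dy\<close>, holomorphy reads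
  \<open>\<psi>\<^sub>y = \<tau> \<psi>\<^sub>x + 2 \<tau>\<^sub>x \<psi>\<close>, and where \<open>\<psi> \<noteq> 0\<close> it yields \<open>\<Delta> log |\<psi>|\<^sub>g = 2 K \<ge> 0\<close>. By Hopf's maximum
  principle and compactness the norm of the traceless part is constant. If it is zero, the surface is
  pseudoumbilical; otherwise \<open>K = 0\<close>, and a traceless Codazzi tensor of constant nonzero norm is parallel.\<close>

section \<open>Calculus of smooth functions\<close>

text \<open>The charts of M are arbitrary, so holomorphy has to be expressed without a complex
  coordinate z. If dz = \<lambda> \<theta>, closedness of dz reads \<lambda>_y = (\<tau>
  \<lambda>)_x, and \<psi> \<theta>^2 = f dz^2 with f holomorphic means \<psi> = f \<lambda>^2 and
  f_y = \<tau> f_x; eliminating f and \<lambda> leaves the equation for \<psi> alone. The factor 2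
  of the curvature arises because |\<psi>|_g = |\<psi>| / E, where in an isothermal chart log
  |\<psi>| is harmonic and \<Delta> log E = - 2 K. The logarithm exists only off the zeros of
  \<psi>, so the maximum principle is applied only around points where the norm takes a positive
  maximum. The norm is computed from a chart of M and a chart of N; before a maximum over M makes
  sense it must be shown not to depend on them, and this is the purpose of the composition rule for
  second fundamental forms.\<close>

lemma Ck_on_cong:
  assumes "open S" "\<And>x. x \<in> S \<Longrightarrow> f x = g x"
  shows "Ck_on k f S \<longleftrightarrow> Ck_on k g S"
  using assms(2)
proof (induction k arbitrary: f g)
  case 0
  then show ?case by (auto cong: continuous_on_cong)
next
  case (Suc k)
  have diff: "f differentiable (at x) \<longleftrightarrow> g differentiable (at x)" if "x \<in> S" for x
  proof
    assume "f differentiable (at x)"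
    then show "g differentiable (at x)"
      using has_derivative_transform_within_open[OF _ assms(1) that, of f _ UNIV g] Suc.prems
      unfolding differentiable_def by blast
  next
    assume "g differentiable (at x)"
    then show "f differentiable (at x)"
      using has_derivative_transform_within_open[OF _ assms(1) that, of g _ UNIV f] Suc.prems
      unfolding differentiable_def by metis
  qed
  have "Ck_on k (\<lambda>x. frechet_derivative f (at x) v) S = Ck_on k (\<lambda>x. frechet_derivative g (at x) v) S"
    if d: "\<forall>x\<in>S. f differentiable (at x)" for v
    by (rule Suc.IH) (metis frechet_derivative_transform_within_open[OF _ assms(1)] d Suc.prems)
  then show ?case using diff by auto
qed

lemma Ck_on_subset: "Ck_on k f T \<Longrightarrow> S \<subseteq> T \<Longrightarrow> Ck_on k f S"
  by (induction k arbitrary: f) (auto intro: continuous_on_subset)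

lemma Ck_on_Suc_imp: "Ck_on (Suc k) f S \<Longrightarrow> Ck_on k f S"
proof (induction k arbitrary: f)
  case 0
  then show ?case
    by (auto intro!: continuous_at_imp_continuous_on differentiable_imp_continuous_within)
next
  case (Suc k)
  then show ?case by auto
qed

text \<open>Allows the derivative to be supplied as a formula, to which an induction hypothesis can
  be applied.\<close>

lemma Ck_on_SucI:
  assumes "open S" "\<And>x. x \<in> S \<Longrightarrow> (f has_derivative f' x) (at x)" "\<And>v. Ck_on k (\<lambda>x. f' x v) S"
  shows "Ck_on (Suc k) f S"
proof -
  have "Ck_on k (\<lambda>x. frechet_derivative f (at x) v) S = Ck_on k (\<lambda>x. f' x v) S" for v
    by (rule Ck_on_cong[OF assms(1)]) (use assms(2) frechet_derivative_at in metis)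
  then show ?thesis using assms by (auto simp: differentiable_def)
qed

lemma Ck_on_SucD:
  assumes "Ck_on (Suc k) f S" "x \<in> S"
  shows "(f has_derivative frechet_derivative f (at x)) (at x)"
  using assms by (simp add: frechet_derivative_works)

lemma Ck_on_const: "open S \<Longrightarrow> Ck_on k (\<lambda>_. c) S"
  by (induction k arbitrary: c) auto

lemma Ck_on_bounded_linear:
  assumes "bounded_linear L" "open S"
  shows "Ck_on k f S \<Longrightarrow> Ck_on k (\<lambda>x. L (f x)) S"
proof (induction k arbitrary: f)
  case 0
  then show ?case using bounded_linear.continuous_on[OF assms(1)] by simp
next
  case (Suc k)
  show ?case
    by (rule Ck_on_SucI[OF assms(2) bounded_linear.has_derivative[OF assms(1) Ck_on_SucD[OF Suc.prems]]])
       (use Suc in auto)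
qed

lemma Ck_on_add:
  assumes "open S"
  shows "Ck_on k f S \<Longrightarrow> Ck_on k g S \<Longrightarrow> Ck_on k (\<lambda>x. f x + g x) S"
proof (induction k arbitrary: f g)
  case 0
  then show ?case by (simp add: continuous_on_add)
next
  case (Suc k)
  show ?case
    by (rule Ck_on_SucI[OF assms has_derivative_add[OF Ck_on_SucD[OF Suc.prems(1)] Ck_on_SucD[OF Suc.prems(2)]]])
       (use Suc in auto)
qed

text \<open>The product rule leaves one factor undifferentiated in each term; that factor is lowered
  by one order to match the induction hypothesis. A general bilinear \<open>B\<close> covers real
  products and scalar multiples at once.\<close>

lemma Ck_on_bilinear:
  assumes B: "bounded_bilinear B" and S: "open S"
  shows "Ck_on k f S \<Longrightarrow> Ck_on k g S \<Longrightarrow> Ck_on k (\<lambda>x. B (f x) (g x)) S"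
proof (induction k arbitrary: f g)
  case 0
  then show ?case by (simp add: bounded_bilinear.continuous_on[OF B])
next
  case (Suc k)
  show ?case
    by (rule Ck_on_SucI[OF S bounded_bilinear.FDERIV[OF B Ck_on_SucD[OF Suc.prems(1)] Ck_on_SucD[OF Suc.prems(2)]]])
       (use Suc Ck_on_Suc_imp[OF Suc.prems(1)] Ck_on_Suc_imp[OF Suc.prems(2)] in
         \<open>auto intro!: Ck_on_add[OF S]\<close>)
qed

lemma linear_basis_expansion:
  fixes L :: "'a::euclidean_space \<Rightarrow> 'b::real_vector"
  assumes "linear L"
  shows "L v = (\<Sum>b\<in>Basis. (v \<bullet> b) *\<^sub>R L b)"
proof -
  have "L v = L (\<Sum>b\<in>Basis. (v \<bullet> b) *\<^sub>R b)" by (simp add: euclidean_representation)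
  then show ?thesis by (simp add: linear_sum[OF assms] linear_scale[OF assms])
qed

lemma Ck_on_sum:
  assumes "open S"
  shows "(\<And>i. i \<in> I \<Longrightarrow> Ck_on k (f i) S) \<Longrightarrow> Ck_on k (\<lambda>x. \<Sum>i\<in>I. f i x) S"
  by (induction I rule: infinite_finite_induct) (auto intro: Ck_on_const Ck_on_add assms)

lemma Ck_on_compose:
  fixes f :: "'a::euclidean_space \<Rightarrow> 'b::euclidean_space" and g :: "'b \<Rightarrow> 'c::real_normed_vector"
  assumes "open S" "open T" "f ` S \<subseteq> T"
  shows "Ck_on k g T \<Longrightarrow> Ck_on k f S \<Longrightarrow> Ck_on k (\<lambda>x. g (f x)) S"
proof (induction k arbitrary: g)
  case 0
  then show ?case using assms continuous_on_compose2 by auto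
next
  case (Suc k)
  have g: "(g has_derivative frechet_derivative g (at (f x))) (at (f x))" if "x \<in> S" for x
    using Ck_on_SucD[OF Suc.prems(1)] assms that by blast
  have f: "(f has_derivative frechet_derivative f (at x)) (at x)" if "x \<in> S" for x
    using Ck_on_SucD[OF Suc.prems(2)] that by blast
  \<comment> \<open>In g'(f(x)) (f'(x) v) the direction fed to g' varies with x, while
    \<open>Ck_on\<close> speaks of fixed directions only. Expanding it in the basis leaves fixed
    directions \<open>b\<close> with variable coefficients.\<close>
  have D: "((\<lambda>x. g (f x)) has_derivative
       (\<lambda>v. \<Sum>b\<in>Basis. (frechet_derivative f (at x) v \<bullet> b) *\<^sub>R frechet_derivative g (at (f x)) b)) (at x)"
    if "x \<in> S" for x
    using has_derivative_compose[OF f[OF that] g[OF that]]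
    by (subst (asm) linear_basis_expansion[OF has_derivative_linear[OF g[OF that]]])
  show ?case
  proof (rule Ck_on_SucI[OF assms(1) D])
    fix v
    show "Ck_on k (\<lambda>x. \<Sum>b\<in>Basis. (frechet_derivative f (at x) v \<bullet> b) *\<^sub>R frechet_derivative g (at (f x)) b) S"
      using Suc Ck_on_Suc_imp[OF Suc.prems(2)]
      by (intro Ck_on_sum[OF assms(1)] Ck_on_bilinear[OF bounded_bilinear_scaleR assms(1)]
            Ck_on_bounded_linear[OF bounded_linear_inner_left assms(1)]) auto
  qed
qed

lemma smooth_on_cong: "open S \<Longrightarrow> (\<And>x. x \<in> S \<Longrightarrow> f x = g x) \<Longrightarrow> smooth_on f S \<longleftrightarrow> smooth_on g S"
  using Ck_on_cong unfolding smooth_on_def by blast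

lemma smooth_on_subset: "smooth_on f T \<Longrightarrow> S \<subseteq> T \<Longrightarrow> smooth_on f S"
  using Ck_on_subset unfolding smooth_on_def by blast

lemma smooth_on_imp_continuous_on: "smooth_on f S \<Longrightarrow> continuous_on S f"
  unfolding smooth_on_def by (metis Ck_on.simps(1))

lemma smooth_on_has_derivative:
  "smooth_on f S \<Longrightarrow> x \<in> S \<Longrightarrow> (f has_derivative frechet_derivative f (at x)) (at x)"
  unfolding smooth_on_def using Ck_on_SucD by blast

lemma smooth_on_differentiable: "smooth_on f S \<Longrightarrow> x \<in> S \<Longrightarrow> f differentiable (at x)"
  using smooth_on_has_derivative differentiable_def by blast

lemma smooth_on_frechet_derivative: "smooth_on f S \<Longrightarrow> smooth_on (\<lambda>x. frechet_derivative f (at x) v) S"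
  unfolding smooth_on_def by (metis Ck_on.simps(2))

lemma smooth_on_const: "open S \<Longrightarrow> smooth_on (\<lambda>_. c) S"
  by (simp add: smooth_on_def Ck_on_const)

lemma smooth_on_bounded_linear: "bounded_linear L \<Longrightarrow> open S \<Longrightarrow> smooth_on f S \<Longrightarrow> smooth_on (\<lambda>x. L (f x)) S"
  by (simp add: smooth_on_def Ck_on_bounded_linear)

lemma smooth_on_ident: "open S \<Longrightarrow> smooth_on (\<lambda>x. x) S"
  unfolding smooth_on_def
proof
  fix k assume S: "open S"
  show "Ck_on k (\<lambda>x. x) S"
    by (cases k) (auto intro: Ck_on_const S Ck_on_SucI[OF S has_derivative_ident])
qed

lemma smooth_on_add: "open S \<Longrightarrow> smooth_on f S \<Longrightarrow> smooth_on g S \<Longrightarrow> smooth_on (\<lambda>x. f x + g x) S"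
  by (simp add: smooth_on_def Ck_on_add)

lemma smooth_on_minus: "open S \<Longrightarrow> smooth_on f S \<Longrightarrow> smooth_on (\<lambda>x. - f x) S"
  by (rule smooth_on_bounded_linear[OF bounded_linear_minus[OF bounded_linear_ident]])

lemma smooth_on_diff: "open S \<Longrightarrow> smooth_on f S \<Longrightarrow> smooth_on g S \<Longrightarrow> smooth_on (\<lambda>x. f x - g x) S"
  using smooth_on_add[OF _ _ smooth_on_minus, of S f g] by simp

lemma smooth_on_mult:
  fixes f g :: "'a::euclidean_space \<Rightarrow> real"
  shows "open S \<Longrightarrow> smooth_on f S \<Longrightarrow> smooth_on g S \<Longrightarrow> smooth_on (\<lambda>x. f x * g x) S"
  by (simp add: smooth_on_def Ck_on_bilinear[OF bounded_bilinear_mult])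

lemma smooth_on_scaleR:
  "open S \<Longrightarrow> smooth_on f S \<Longrightarrow> smooth_on g S \<Longrightarrow> smooth_on (\<lambda>x. f x *\<^sub>R g x) S"
  by (simp add: smooth_on_def Ck_on_bilinear[OF bounded_bilinear_scaleR])

lemma smooth_on_sum:
  "open S \<Longrightarrow> (\<And>i. i \<in> I \<Longrightarrow> smooth_on (f i) S) \<Longrightarrow> smooth_on (\<lambda>x. \<Sum>i\<in>I. f i x) S"
  by (simp add: smooth_on_def Ck_on_sum)

lemma smooth_on_prod:
  fixes f :: "'i \<Rightarrow> 'a::euclidean_space \<Rightarrow> real"
  assumes "open S"
  shows "(\<And>i. i \<in> I \<Longrightarrow> smooth_on (f i) S) \<Longrightarrow> smooth_on (\<lambda>x. \<Prod>i\<in>I. f i x) S"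
  by (induction I rule: infinite_finite_induct) (auto intro: smooth_on_const smooth_on_mult assms)

lemma smooth_on_compose:
  fixes f :: "'a::euclidean_space \<Rightarrow> 'b::euclidean_space" and g :: "'b \<Rightarrow> 'c::real_normed_vector"
  assumes "open S" "open T" "f ` S \<subseteq> T" "smooth_on g T" "smooth_on f S"
  shows "smooth_on (\<lambda>x. g (f x)) S"
  using assms Ck_on_compose unfolding smooth_on_def by blast

text \<open>Bootstrapping: the derivative is an expression in the function itself
  (\<open>exp\<close>, \<open>inverse\<close>) or already known to be smooth (for
  \<open>ln\<close>), so each order of regularity gives the next.\<close>

lemma smooth_on_realI:
  fixes f :: "real \<Rightarrow> real"
  assumes S: "open S" and d: "\<And>x. x \<in> S \<Longrightarrow> (f has_real_derivative f' x) (at x)"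
    and step: "\<And>k. Ck_on k f S \<Longrightarrow> Ck_on k f' S"
  shows "smooth_on f S"
  unfolding smooth_on_def
proof
  fix k show "Ck_on k f S"
  proof (induction k)
    case 0
    show ?case
      using d by (auto simp: continuous_on_eq_continuous_at[OF S] intro: DERIV_isCont)
  next
    case (Suc k)
    then have "Ck_on k (\<lambda>x. f' x * v) S" for v
      using Ck_on_bounded_linear[OF bounded_linear_mult_left S step] by blast
    then show ?case
      using d by (intro Ck_on_SucI[OF S, where f' = "\<lambda>x v. f' x * v"]) (auto simp: has_field_derivative_def)
  qed
qed

lemma smooth_on_inverse:
  fixes f :: "'a::euclidean_space \<Rightarrow> real"
  assumes "open S" "smooth_on f S" "\<And>x. x \<in> S \<Longrightarrow> f x \<noteq> 0"
  shows "smooth_on (\<lambda>x. inverse (f x)) S"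
proof (rule smooth_on_compose[where T = "-{0}" and g = inverse and f = f])
  have o: "open (-{0::real})" by auto
  show "smooth_on inverse (-{0::real})"
  proof (rule smooth_on_realI[OF o])
    show "(inverse has_real_derivative - (inverse x * inverse x)) (at x)" if "x \<in> - {0}" for x :: real
      using DERIV_inverse[of x UNIV] that by (simp add: power2_eq_square)
    show "Ck_on k inverse (-{0::real}) \<Longrightarrow> Ck_on k (\<lambda>x. - (inverse x * inverse x)) (-{0::real})" for k
      by (intro Ck_on_bounded_linear[OF bounded_linear_minus[OF bounded_linear_ident] o]
            Ck_on_bilinear[OF bounded_bilinear_mult o])
  qed
qed (use assms in auto)

lemma smooth_on_divide:
  fixes f :: "'a::euclidean_space \<Rightarrow> real"
  assumes "open S" "smooth_on f S" "smooth_on g S" "\<And>x. x \<in> S \<Longrightarrow> g x \<noteq> 0"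
  shows "smooth_on (\<lambda>x. f x / g x) S"
  unfolding divide_inverse using assms by (intro smooth_on_mult smooth_on_inverse)

lemma smooth_on_exp:
  fixes f :: "'a::euclidean_space \<Rightarrow> real"
  assumes "open S" "smooth_on f S"
  shows "smooth_on (\<lambda>x. exp (f x)) S"
proof (rule smooth_on_compose[where T = UNIV and g = exp and f = f])
  show "smooth_on exp (UNIV :: real set)"
    by (rule smooth_on_realI[where f' = exp]) (auto intro: DERIV_exp)
qed (use assms in auto)

lemma smooth_on_ln:
  fixes f :: "'a::euclidean_space \<Rightarrow> real"
  assumes "open S" "smooth_on f S" "\<And>x. x \<in> S \<Longrightarrow> f x > 0"
  shows "smooth_on (\<lambda>x. ln (f x)) S"
proof (rule smooth_on_compose[where T = "{0<..}" and g = ln and f = f])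
  have "smooth_on inverse {0::real<..}"
    by (rule smooth_on_inverse) (auto intro: smooth_on_ident)
  then show "smooth_on ln {0::real<..}"
    by (intro smooth_on_realI[where f' = inverse]) (auto simp: smooth_on_def divide_inverse intro!: derivative_eq_intros)
qed (use assms in auto)

lemma smooth_on_sqrt:
  fixes f :: "'a::euclidean_space \<Rightarrow> real"
  assumes "open S" "smooth_on f S" "\<And>x. x \<in> S \<Longrightarrow> f x > 0"
  shows "smooth_on (\<lambda>x. sqrt (f x)) S"
proof (rule smooth_on_cong[THEN iffD1, OF assms(1)])
  show "smooth_on (\<lambda>x. exp (ln (f x) * (1/2))) S"
    using assms by (intro smooth_on_exp smooth_on_mult smooth_on_ln smooth_on_const)
  show "exp (ln (f x) * (1/2)) = sqrt (f x)" if "x \<in> S" for x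
    using assms(3)[OF that] by (simp add: powr_def flip: powr_half_sqrt)
qed

lemma smooth_on_vec_nth: "open S \<Longrightarrow> smooth_on f S \<Longrightarrow> smooth_on (\<lambda>x. f x $ i) S"
  by (rule smooth_on_bounded_linear[OF bounded_linear_vec_nth])

lemma smooth_on_vecI:
  fixes f :: "'a::euclidean_space \<Rightarrow> 'b::real_normed_vector ^ 'n::finite"
  assumes "open S" "\<And>i. smooth_on (\<lambda>x. f x $ i) S"
  shows "smooth_on f S"
proof -
  have [simp]: "bounded_linear (axis i :: 'b \<Rightarrow> 'b ^ 'n)" for i
    by (rule bounded_linear_intro[where K = 1])
       (auto simp: axis_def vec_eq_iff norm_vec_def L2_set_def if_distrib[of norm] if_distrib[of "\<lambda>x. x\<^sup>2"] cong: if_cong)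
  have "f x = (\<Sum>i\<in>UNIV. axis i (f x $ i))" for x
    by (simp add: vec_eq_iff axis_def if_distrib cong: if_cong)
  moreover have "smooth_on (\<lambda>x. \<Sum>i\<in>UNIV. axis i (f x $ i)) S"
    using assms by (intro smooth_on_sum smooth_on_bounded_linear[of "axis _"]) auto
  ultimately show ?thesis by simp
qed

section \<open>Symmetry of second derivatives\<close>

lemma has_real_derivative_along_line:
  fixes f :: "'a::real_normed_vector \<Rightarrow> real"
  assumes "(f has_derivative f') (at (x + s *\<^sub>R u))"
  shows "((\<lambda>s. f (x + s *\<^sub>R u)) has_real_derivative f' u) (at s)"
proof -
  have "((\<lambda>s. x + s *\<^sub>R u) has_derivative (\<lambda>s. s *\<^sub>R u)) (at s)"
    by (auto intro!: derivative_eq_intros)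
  from has_derivative_compose[OF this assms] show ?thesis
    using linear_scale[OF has_derivative_linear[OF assms]]
    by (simp add: has_field_derivative_def mult.commute[of _ "f' u"])
qed

text \<open>The second difference over the parallelogram spanned by \<open>h *\<^sub>R u\<close> and
  \<open>h *\<^sub>R v\<close> is an increment, in direction \<open>u\<close>, of the
  \<open>v\<close>-difference of \<open>f\<close>. The mean value theorem is applied to this first,
  and then in direction \<open>v\<close> to the derivative along \<open>u\<close>.\<close>

lemma iterated_MVT:
  fixes f :: "'a::euclidean_space \<Rightarrow> real"
  assumes f: "smooth_on f S" and h: "h > 0"
    and S: "\<And>s t. 0 \<le> s \<Longrightarrow> s \<le> h \<Longrightarrow> 0 \<le> t \<Longrightarrow> t \<le> h \<Longrightarrow> x + s *\<^sub>R u + t *\<^sub>R v \<in> S"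
  shows "\<exists>s t. 0 < s \<and> s < h \<and> 0 < t \<and> t < h \<and>
    f (x + h *\<^sub>R u + h *\<^sub>R v) - f (x + h *\<^sub>R u) - f (x + h *\<^sub>R v) + f x =
    h * h * frechet_derivative (\<lambda>y. frechet_derivative f (at y) u) (at (x + s *\<^sub>R u + t *\<^sub>R v)) v"
proof -
  define D where "D = (\<lambda>y. frechet_derivative f (at y) u)"
  have D: "smooth_on D S" unfolding D_def by (rule smooth_on_frechet_derivative[OF f])
  define g where "g = (\<lambda>s. f (x + h *\<^sub>R v + s *\<^sub>R u) - f (x + s *\<^sub>R u))"
  have "\<exists>s>0. s < h \<and> g h - g 0 = (h - 0) * (D (x + h *\<^sub>R v + s *\<^sub>R u) - D (x + s *\<^sub>R u))"
  proof (rule MVT2[OF h])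
    fix s assume s: "0 \<le> s" "s \<le> h"
    have "x + h *\<^sub>R v + s *\<^sub>R u \<in> S" "x + s *\<^sub>R u \<in> S"
      using S[of s h] S[of s 0] s h by (auto simp: algebra_simps)
    then show "(g has_real_derivative (D (x + h *\<^sub>R v + s *\<^sub>R u) - D (x + s *\<^sub>R u))) (at s)"
      unfolding g_def D_def
      by (intro DERIV_diff has_real_derivative_along_line smooth_on_has_derivative[OF f])
  qed
  then obtain s where s: "0 < s" "s < h" "g h - g 0 = h * (D (x + h *\<^sub>R v + s *\<^sub>R u) - D (x + s *\<^sub>R u))"
    by auto
  have "\<exists>t>0. t < h \<and> D (x + s *\<^sub>R u + h *\<^sub>R v) - D (x + s *\<^sub>R u + 0 *\<^sub>R v) =
      (h - 0) * frechet_derivative D (at (x + s *\<^sub>R u + t *\<^sub>R v)) v"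
    using s S by (intro MVT2[OF h] has_real_derivative_along_line smooth_on_has_derivative[OF D]) auto
  then obtain t where t: "0 < t" "t < h" "D (x + s *\<^sub>R u + h *\<^sub>R v) - D (x + s *\<^sub>R u) =
      h * frechet_derivative D (at (x + s *\<^sub>R u + t *\<^sub>R v)) v"
    by auto
  have c: "x + h *\<^sub>R v + s *\<^sub>R u = x + s *\<^sub>R u + h *\<^sub>R v" "x + h *\<^sub>R v + h *\<^sub>R u = x + h *\<^sub>R u + h *\<^sub>R v"
    by (simp_all add: algebra_simps)
  have "g h - g 0 = h * h * frechet_derivative D (at (x + s *\<^sub>R u + t *\<^sub>R v)) v"
    unfolding s(3) c(1) t(3) by simp
  then show ?thesis
    using s t unfolding g_def D_def c(2) by (intro exI[of _ s] exI[of _ t]) simp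
qed

text \<open>The second difference is symmetric in \<open>u\<close> and \<open>v\<close>. If some
  \<open>c\<close> separated the two mixed derivatives at \<open>x\<close>, continuity would keep
  them separated near \<open>x\<close>, and the two mean values of the same second difference would
  lie on opposite sides of \<open>c\<close>.\<close>

lemma second_derivative_le_swap:
  fixes f :: "'a::euclidean_space \<Rightarrow> real"
  assumes f: "smooth_on f S" and S: "open S" "x \<in> S"
  shows "frechet_derivative (\<lambda>y. frechet_derivative f (at y) u) (at x) v \<le>
    frechet_derivative (\<lambda>y. frechet_derivative f (at y) v) (at x) u"
proof (rule ccontr)
  define P where "P = (\<lambda>u v x. frechet_derivative (\<lambda>y. frechet_derivative f (at y) u) (at x) v)"
  have cont: "isCont (P u v) x" for u v
    using smooth_on_imp_continuous_on[OF smooth_on_frechet_derivative[OF smooth_on_frechet_derivative[OF f]]]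
      S unfolding P_def by (simp add: continuous_on_eq_continuous_at)
  assume "\<not> ?thesis"
  then have "P v u x < P u v x" by (simp add: P_def)
  then obtain c where c: "P v u x < c" "c < P u v x" using dense by blast
  have "\<forall>\<^sub>F y in nhds x. y \<in> S \<and> P v u y < c \<and> c < P u v y"
    using c cont S
    by (intro eventually_conj eventually_nhds_in_open order_tendstoD) (auto simp: continuous_at tendsto_at_iff_tendsto_nhds)
  then obtain e where e: "e > 0" "\<And>y. dist y x < e \<Longrightarrow> y \<in> S \<and> P v u y < c \<and> c < P u v y"
    unfolding eventually_nhds_metric by blast
  define h where "h = e / (2 * (norm u + norm v + 1))"
  have pos: "norm u + norm v + 1 > 0" by (simp add: add_nonneg_pos)
  have h: "h > 0" using e pos by (simp add: h_def)
  have hb: "h * (norm u + norm v) < e"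
  proof -
    have "e * (norm u + norm v) < e * (2 * (norm u + norm v + 1))"
      using e by (intro mult_strict_left_mono) (use pos in auto)
    then show ?thesis unfolding h_def using pos by (simp add: field_simps)
  qed
  have near: "dist (x + s *\<^sub>R a + t *\<^sub>R b) x < e"
    if "0 \<le> s" "s \<le> h" "0 \<le> t" "t \<le> h" "a = u \<and> b = v \<or> a = v \<and> b = u" for s t a b
  proof -
    have "dist (x + s *\<^sub>R a + t *\<^sub>R b) x \<le> s * norm a + t * norm b"
      using that norm_triangle_ineq[of "s *\<^sub>R a" "t *\<^sub>R b"] by (simp add: dist_norm add.assoc)
    also have "\<dots> \<le> h * norm a + h * norm b"
      using that by (intro add_mono mult_right_mono) auto
    also have "\<dots> = h * (norm u + norm v)" using that by (auto simp: algebra_simps)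
    finally show ?thesis using hb by simp
  qed
  obtain s t where 1: "0 < s" "s < h" "0 < t" "t < h"
    "f (x + h *\<^sub>R u + h *\<^sub>R v) - f (x + h *\<^sub>R u) - f (x + h *\<^sub>R v) + f x = h * h * P u v (x + s *\<^sub>R u + t *\<^sub>R v)"
    using iterated_MVT[OF f h, of x u v] near e(2) unfolding P_def by blast
  obtain s' t' where 2: "0 < s'" "s' < h" "0 < t'" "t' < h"
    "f (x + h *\<^sub>R v + h *\<^sub>R u) - f (x + h *\<^sub>R v) - f (x + h *\<^sub>R u) + f x = h * h * P v u (x + s' *\<^sub>R v + t' *\<^sub>R u)"
    using iterated_MVT[OF f h, of x v u] near e(2) unfolding P_def by blast
  have c': "x + h *\<^sub>R v + h *\<^sub>R u = x + h *\<^sub>R u + h *\<^sub>R v" by (simp add: algebra_simps)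
  then have "h * h * P u v (x + s *\<^sub>R u + t *\<^sub>R v) = h * h * P v u (x + s' *\<^sub>R v + t' *\<^sub>R u)"
    using 1(5) 2(5)[unfolded c'] by linarith
  then have "P u v (x + s *\<^sub>R u + t *\<^sub>R v) = P v u (x + s' *\<^sub>R v + t' *\<^sub>R u)" using h by simp
  moreover have "c < P u v (x + s *\<^sub>R u + t *\<^sub>R v)" using e(2) near 1 by simp
  moreover have "P v u (x + s' *\<^sub>R v + t' *\<^sub>R u) < c" using e(2) near 2 by simp
  ultimately show False by simp
qed

lemma second_derivative_symmetric:
  fixes f :: "'a::euclidean_space \<Rightarrow> real"
  assumes "smooth_on f S" "open S" "x \<in> S"
  shows "frechet_derivative (\<lambda>y. frechet_derivative f (at y) u) (at x) v =
    frechet_derivative (\<lambda>y. frechet_derivative f (at y) v) (at x) u"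
  using second_derivative_le_swap[OF assms] by (simp add: order_antisym)

lemma frechet_derivative_bounded_linear:
  assumes "bounded_linear L" "f differentiable (at x)"
  shows "frechet_derivative (\<lambda>y. L (f y)) (at x) v = L (frechet_derivative f (at x) v)"
  using bounded_linear.has_derivative[OF assms(1)] assms(2)
  by (metis frechet_derivative_at frechet_derivative_works)

lemma second_derivative_symmetric_vec:
  fixes f :: "'a::euclidean_space \<Rightarrow> real ^ 'n::finite"
  assumes f: "smooth_on f S" and S: "open S" "x \<in> S"
  shows "frechet_derivative (\<lambda>y. frechet_derivative f (at y) u) (at x) v =
    frechet_derivative (\<lambda>y. frechet_derivative f (at y) v) (at x) u"
proof -
  have "frechet_derivative (\<lambda>y. frechet_derivative f (at y) a) (at x) b $ i =
      frechet_derivative (\<lambda>y. frechet_derivative (\<lambda>z. f z $ i) (at y) a) (at x) b" for a b i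
  proof -
    have d: "(\<lambda>y. frechet_derivative f (at y) a) differentiable (at x)"
      using smooth_on_differentiable[OF smooth_on_frechet_derivative[OF f]] S by blast
    have "frechet_derivative (\<lambda>y. frechet_derivative f (at y) a) (at x) b $ i =
        frechet_derivative (\<lambda>y. frechet_derivative f (at y) a $ i) (at x) b"
      by (rule frechet_derivative_bounded_linear[OF bounded_linear_vec_nth d, symmetric])
    also have "\<dots> = frechet_derivative (\<lambda>y. frechet_derivative (\<lambda>z. f z $ i) (at y) a) (at x) b"
    proof (rule fun_cong[OF frechet_derivative_transform_within_open[OF _ S]])
      show "(\<lambda>y. frechet_derivative f (at y) a $ i) differentiable at x"
        using d bounded_linear.has_derivative[OF bounded_linear_vec_nth] unfolding differentiable_def by blast
      show "frechet_derivative f (at y) a $ i = frechet_derivative (\<lambda>z. f z $ i) (at y) a" if "y \<in> S" for y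
        by (rule frechet_derivative_bounded_linear[OF bounded_linear_vec_nth smooth_on_differentiable[OF f that], symmetric])
    qed
    finally show ?thesis .
  qed
  then show ?thesis
    using second_derivative_symmetric[OF smooth_on_vec_nth[OF S(1) f] S] by (simp add: vec_eq_iff)
qed

section \<open>Partial derivatives\<close>

definition pd :: "'m::finite \<Rightarrow> (real ^ 'm \<Rightarrow> 'b::real_normed_vector) \<Rightarrow> real ^ 'm \<Rightarrow> 'b" where
  "pd i f x = frechet_derivative f (at x) (axis i 1)"

lemma pd_eqI: "(f has_derivative f') (at x) \<Longrightarrow> pd i f x = f' (axis i 1)"
  using frechet_derivative_at[of f f' x] by (simp add: pd_def)

lemma smooth_on_pd: "smooth_on f S \<Longrightarrow> smooth_on (pd i f) S"
  unfolding pd_def by (rule smooth_on_frechet_derivative)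

lemma pd_cong:
  assumes "f differentiable (at x)" "open S" "x \<in> S" "\<And>y. y \<in> S \<Longrightarrow> f y = g y"
  shows "pd i f x = pd i g x"
  unfolding pd_def using frechet_derivative_transform_within_open[OF assms] by simp

lemma pd_commute:
  fixes f :: "real ^ 'm::finite \<Rightarrow> real"
  assumes "smooth_on f S" "open S" "x \<in> S"
  shows "pd i (pd j f) x = pd j (pd i f) x"
  using second_derivative_symmetric[OF assms, of "axis j 1" "axis i 1"] by (simp add: pd_def[abs_def])

lemma frechet_derivative_eq_sum_pd:
  assumes "f differentiable (at x)"
  shows "frechet_derivative f (at x) v = (\<Sum>i\<in>UNIV. v $ i *\<^sub>R pd i f x)"
proof -
  have lin: "linear (frechet_derivative f (at x))"
    using assms linear_frechet_derivative by blast
  have v: "v = (\<Sum>i\<in>UNIV. v $ i *\<^sub>R axis i 1)"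
    using basis_expansion[of v] by (simp add: scalar_mult_eq_scaleR)
  show ?thesis
    by (subst v) (simp add: linear_sum[OF lin] linear_scale[OF lin] pd_def)
qed

lemma pd_const: "pd i (\<lambda>_. c) x = 0"
  by (simp add: pd_def)

context
  fixes f g :: "real ^ 'm::finite \<Rightarrow> real" and x
  assumes f: "f differentiable (at x)" and g: "g differentiable (at x)"
begin

private lemmas ders = f[unfolded frechet_derivative_works] g[unfolded frechet_derivative_works]

lemma pd_add: "pd i (\<lambda>x. f x + g x) x = pd i f x + pd i g x"
  by (subst pd_eqI[OF has_derivative_add[OF ders]]) (simp add: pd_def)

lemma pd_diff: "pd i (\<lambda>x. f x - g x) x = pd i f x - pd i g x"
  by (subst pd_eqI[OF has_derivative_diff[OF ders]]) (simp add: pd_def)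

lemma pd_mult: "pd i (\<lambda>x. f x * g x) x = pd i f x * g x + f x * pd i g x"
  by (subst pd_eqI[OF has_derivative_mult[OF ders]]) (simp add: pd_def)

lemma pd_divide:
  assumes "g x \<noteq> 0"
  shows "pd i (\<lambda>x. f x / g x) x = (pd i f x * g x - f x * pd i g x) / (g x * g x)"
  by (subst pd_eqI[OF has_derivative_divide'[OF ders assms]]) (simp add: pd_def)

lemma pd_ln:
  assumes "f x > 0"
  shows "pd i (\<lambda>x. ln (f x)) x = pd i f x / f x"
  by (subst pd_eqI[OF has_derivative_ln[OF assms ders(1)]]) (simp add: pd_def divide_inverse)

end

section \<open>The strong maximum principle in the plane\<close>

lemma second_derivative_at_max:
  fixes w :: "'a::euclidean_space \<Rightarrow> real"
  assumes w: "smooth_on w S" and S: "open S" "x \<in> S" and max: "\<And>y. y \<in> S \<Longrightarrow> w y \<le> w x"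
  shows "frechet_derivative w (at x) v = 0"
    and "frechet_derivative (\<lambda>y. frechet_derivative w (at y) v) (at x) v \<le> 0"
proof -
  show D0: "frechet_derivative w (at x) v = 0"
    using differential_zero_maxmin[OF S(2) S(1) smooth_on_has_derivative[OF w S(2)]] max by metis
  show "frechet_derivative (\<lambda>y. frechet_derivative w (at y) v) (at x) v \<le> 0"
  proof (rule ccontr)
    define D where "D = (\<lambda>y. frechet_derivative w (at y) v)"
    define l where "l = frechet_derivative D (at x) v"
    assume "\<not> ?thesis"
    then have l: "l > 0" by (simp add: l_def D_def)
    have D: "smooth_on D S" unfolding D_def by (rule smooth_on_frechet_derivative[OF w])
    \<comment> \<open>The directional derivative \<open>D\<close> vanishes at \<open>x\<close>, so a
      positive second derivative makes it positive just beyond \<open>x\<close>; the mean value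
      theorem then yields a value of \<open>w\<close> above the maximum.\<close>
    have "((\<lambda>s. D (x + s *\<^sub>R v)) has_real_derivative l) (at 0)"
      unfolding l_def using smooth_on_has_derivative[OF D S(2)]
      by (intro has_real_derivative_along_line) simp
    from DERIV_pos_inc_right[OF this l] obtain d where
      d: "d > 0" "\<And>h. 0 < h \<Longrightarrow> h < d \<Longrightarrow> 0 < D (x + h *\<^sub>R v)"
      using D0 by (auto simp: D_def)
    have "open ((\<lambda>h::real. x + h *\<^sub>R v) -` S)"
      by (intro open_vimage S continuous_intros)
    moreover have "0 \<in> (\<lambda>h::real. x + h *\<^sub>R v) -` S" using S(2) by simp
    ultimately obtain e where e: "e > 0" "ball 0 e \<subseteq> (\<lambda>h::real. x + h *\<^sub>R v) -` S"
      by (meson open_contains_ball)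
    then have e: "e > 0" "\<And>h. \<bar>h\<bar> < e \<Longrightarrow> x + h *\<^sub>R v \<in> S"
      by (auto simp: subset_iff)
    define h where "h = min d e / 2"
    have h: "0 < h" "h < d" "h < e" using d e by (auto simp: h_def)
    have "\<exists>z>0. z < h \<and> w (x + h *\<^sub>R v) - w (x + 0 *\<^sub>R v) = (h - 0) * D (x + z *\<^sub>R v)"
      unfolding D_def using e h
      by (intro MVT2 has_real_derivative_along_line smooth_on_has_derivative[OF w]) auto
    then obtain z where z: "0 < z" "z < h" "w (x + h *\<^sub>R v) - w x = h * D (x + z *\<^sub>R v)" by auto
    have "h * D (x + z *\<^sub>R v) > 0" using z h d(2) by simp
    moreover have "w (x + h *\<^sub>R v) \<le> w x" using max e(2) h by simp
    ultimately show False using z by simp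
  qed
qed

lemma second_derivative_eq_pd:
  fixes w :: "real ^ 2 \<Rightarrow> real"
  assumes w: "smooth_on w S" and S: "open S" "x \<in> S"
  shows "frechet_derivative (\<lambda>y. frechet_derivative w (at y) v) (at x) v =
    (v $ 1)\<^sup>2 * pd 1 (pd 1 w) x + 2 * v $ 1 * v $ 2 * pd 1 (pd 2 w) x + (v $ 2)\<^sup>2 * pd 2 (pd 2 w) x"
proof -
  note sm = smooth_on_pd[OF w] smooth_on_pd[OF smooth_on_pd[OF w]]
  have eq: "frechet_derivative w (at y) v = v $ 1 * pd 1 w y + v $ 2 * pd 2 w y" if "y \<in> S" for y
    using frechet_derivative_eq_sum_pd[OF smooth_on_differentiable[OF w that], of v] by (simp add: sum_2)
  have sm2: "smooth_on (\<lambda>y. v $ 1 * pd 1 w y + v $ 2 * pd 2 w y) S"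
    using sm S by (intro smooth_on_add smooth_on_mult smooth_on_const) auto
  have d: "(\<lambda>y. frechet_derivative w (at y) v) differentiable (at x)"
    using smooth_on_differentiable[OF smooth_on_frechet_derivative[OF w] S(2)] .
  have dd: "pd i w differentiable (at x)" for i
    using smooth_on_differentiable[OF smooth_on_pd[OF w] S(2)] .
  have pde: "pd i (\<lambda>y. frechet_derivative w (at y) v) x = v $ 1 * pd i (pd 1 w) x + v $ 2 * pd i (pd 2 w) x" for i
    using pd_cong[OF d S eq, where i = i] by (simp add: pd_add pd_mult pd_const dd)
  have c: "pd 2 (pd 1 w) x = pd 1 (pd 2 w) x" by (rule pd_commute[OF w S])
  show ?thesis
    unfolding frechet_derivative_eq_sum_pd[OF d, of v] sum_2 pde c
    by (simp add: algebra_simps power2_eq_square)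
qed

text \<open>A positive definite coefficient matrix contracted with a negative semidefinite Hessian
  is nonpositive. With q the quadratic form of the Hessian, \<open>A\<close> times the operator
  equals q(A, B) + (A C - B^2) q(0, 1), so two test vectors suffice.\<close>

lemma elliptic_at_max:
  fixes w :: "real ^ 2 \<Rightarrow> real"
  assumes w: "smooth_on w S" and S: "open S" "x \<in> S" and max: "\<And>y. y \<in> S \<Longrightarrow> w y \<le> w x"
    and ell: "A > 0" "A * C - B\<^sup>2 > 0"
  shows "pd i w x = 0" and "A * pd 1 (pd 1 w) x + 2 * B * pd 1 (pd 2 w) x + C * pd 2 (pd 2 w) x \<le> 0"
proof -
  show "pd i w x = 0"
    unfolding pd_def by (rule second_derivative_at_max(1)[OF w S max])
  have *: "(v $ 1)\<^sup>2 * pd 1 (pd 1 w) x + 2 * v $ 1 * v $ 2 * pd 1 (pd 2 w) x + (v $ 2)\<^sup>2 * pd 2 (pd 2 w) x \<le> 0"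
    for v :: "real ^ 2"
    using second_derivative_at_max(2)[OF w S max, of v] unfolding second_derivative_eq_pd[OF w S] .
  have 1: "A\<^sup>2 * pd 1 (pd 1 w) x + 2 * A * B * pd 1 (pd 2 w) x + B\<^sup>2 * pd 2 (pd 2 w) x \<le> 0"
    using *[of "vector [A, B]"] by simp
  have "pd 2 (pd 2 w) x \<le> 0"
    using *[of "vector [0, 1]"] by simp
  then have "(A * C - B\<^sup>2) * pd 2 (pd 2 w) x \<le> 0"
    using ell by (simp add: mult_nonneg_nonpos)
  with 1 have "A * (A * pd 1 (pd 1 w) x + 2 * B * pd 1 (pd 2 w) x + C * pd 2 (pd 2 w) x) \<le> 0"
    by (simp add: algebra_simps power2_eq_square)
  then show "A * pd 1 (pd 1 w) x + 2 * B * pd 1 (pd 2 w) x + C * pd 2 (pd 2 w) x \<le> 0"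
    using ell by (simp add: mult_le_0_iff)
qed

text \<open>The barrier of Hopf's argument. In its second derivatives the terms quadratic in
  \<alpha> outweigh the linear ones once \<alpha> is large, as long as \<open>x\<close> stays away
  from the centre \<open>z\<close>.\<close>

lemma gaussian_derivatives:
  fixes z :: "real ^ 2" and \<alpha> :: real
  assumes h_def: "h = (\<lambda>x :: real ^ 2. exp (- \<alpha> * (norm (x - z))\<^sup>2))"
  shows "smooth_on h UNIV"
    and "pd i h x = - 2 * \<alpha> * (x - z) $ i * h x"
    and "pd i (pd j h) x = (4 * \<alpha>\<^sup>2 * (x - z) $ i * (x - z) $ j - (if i = j then 2 * \<alpha> else 0)) * h x"
proof -
  have D: "(h has_derivative (\<lambda>v. - 2 * \<alpha> * ((x - z) \<bullet> v) * h x)) (at x)" for x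
  proof -
    have "((\<lambda>x. x - z) has_derivative (\<lambda>v. v)) (at x)"
      using has_derivative_diff[OF has_derivative_ident has_derivative_const, of z "at x"] by simp
    note has_derivative_exp[OF has_derivative_mult_right[OF has_derivative_inner[OF this this], of "- \<alpha>"]]
    then show ?thesis
      unfolding h_def power2_norm_eq_inner by (rule has_derivative_eq_rhs) (simp add: fun_eq_iff inner_commute)
  qed
  have pdh: "pd i h = (\<lambda>x. - 2 * \<alpha> * (x - z) $ i * h x)" for i
    by (rule ext, subst pd_eqI[OF D]) (simp add: inner_axis)
  show "pd i h x = - 2 * \<alpha> * (x - z) $ i * h x"
    by (simp only: pdh)
  have N: "(norm (x - z))\<^sup>2 = (x $ 1 - z $ 1) * (x $ 1 - z $ 1) + (x $ 2 - z $ 2) * (x $ 2 - z $ 2)" for x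
    by (simp add: power2_norm_eq_inner inner_vec_def sum_2)
  show "smooth_on h UNIV"
    unfolding h_def N
    by (intro smooth_on_exp smooth_on_mult smooth_on_add smooth_on_diff smooth_on_const smooth_on_vec_nth
        smooth_on_ident) auto
  have "((\<lambda>x. (x - z) $ j) has_derivative (\<lambda>v. (v - 0) $ j)) (at x)"
    by (intro bounded_linear.has_derivative[OF bounded_linear_vec_nth] has_derivative_diff
        has_derivative_ident has_derivative_const)
  note has_derivative_mult[OF has_derivative_mult_right[OF this, of "- 2 * \<alpha>"] D]
  then have D2: "((\<lambda>x. - 2 * \<alpha> * (x - z) $ j * h x) has_derivative
      (\<lambda>v. - 2 * \<alpha> * (v $ j * h x + (x - z) $ j * (- 2 * \<alpha> * ((x - z) \<bullet> v) * h x)))) (at x)"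
    by (rule has_derivative_eq_rhs) (rule ext, simp only: diff_zero, algebra)
  have ax: "axis i (1::real) $ j = (if i = j then 1 else 0)"
    by (simp add: axis_def)
  have pd2: "pd i (\<lambda>x. - 2 * \<alpha> * (x - z) $ j * h x) x =
      - 2 * \<alpha> * ((if i = j then 1 else 0) * h x + (x - z) $ j * (- 2 * \<alpha> * (x - z) $ i * h x))"
    unfolding pd_eqI[OF D2] ax by (simp only: inner_axis inner_real_def mult_1_right)
  show "pd i (pd j h) x = (4 * \<alpha>\<^sup>2 * (x - z) $ i * (x - z) $ j - (if i = j then 2 * \<alpha> else 0)) * h x"
    unfolding pdh pd2 by (cases "i = j") (simp_all add: ring_distribs power2_eq_square del: vector_minus_component)
qed

text \<open>Hopf's argument: if \<open>f\<close> is not constant near the maximum point \<open>x0\<close>, some disc in \<open>{f < m}\<close>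
  touches \<open>{f = m}\<close> at a point \<open>q\<close>. Adding a small multiple of a Gaussian centred in that disc
  produces a strict subsolution with an interior maximum near \<open>q\<close>.\<close>

lemma strong_maximum_principle:
  fixes f :: "real ^ 2 \<Rightarrow> real"
  assumes S: "open S" and f: "smooth_on f S"
    and cont: "continuous_on S A" "continuous_on S B" "continuous_on S C" "continuous_on S b1" "continuous_on S b2"
    and ell: "\<And>x. x \<in> S \<Longrightarrow> A x > 0" "\<And>x. x \<in> S \<Longrightarrow> A x * C x - (B x)\<^sup>2 > 0"
    and sub: "\<And>x. x \<in> S \<Longrightarrow> A x * pd 1 (pd 1 f) x + 2 * B x * pd 1 (pd 2 f) x + C x * pd 2 (pd 2 f) x
        + b1 x * pd 1 f x + b2 x * pd 2 f x \<ge> 0"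
    and x0: "x0 \<in> S" "f x0 = m" and max: "\<And>x. x \<in> S \<Longrightarrow> f x \<le> m"
  shows "\<exists>e>0. \<forall>x\<in>ball x0 e. f x = m"
proof -
  \<comment> \<open>The point \<open>p\<close> will lie within \<open>e\<close> of \<open>x0\<close>
    and the contact point \<open>q\<close> within \<open>e\<close> of \<open>p\<close>, so
    everything happens in \<open>cball x0 (2 * e)\<close>, inside \<open>S\<close>.\<close>
  obtain e where e: "e > 0" "ball x0 (3 * e) \<subseteq> S"
  proof -
    obtain d where "d > 0" "ball x0 d \<subseteq> S" using S x0 open_contains_ball by blast
    then show ?thesis using that[of "d / 3"] by simp
  qed
  have "f p = m" if p: "p \<in> ball x0 e" for p
  proof (rule ccontr)
    assume "f p \<noteq> m"
    have contf: "continuous_on S f" using smooth_on_imp_continuous_on[OF f] .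
    define Z where "Z = {x \<in> cball x0 (2 * e). f x = m}"
    have sub2: "cball x0 (2 * e) \<subseteq> S" using e by (auto simp: subset_iff)
    have "closed Z"
      unfolding Z_def
      by (rule continuous_closed_preimage_constant[OF continuous_on_subset[OF contf sub2]]) simp
    moreover have "x0 \<in> Z" using x0 e by (simp add: Z_def)
    \<comment> \<open>A point of the contact set nearest to \<open>p\<close>: the open disc about
      \<open>p\<close> with \<open>q\<close> on its boundary misses the contact set.\<close>
    ultimately obtain q where q: "q \<in> Z" "\<And>y. y \<in> Z \<Longrightarrow> dist p q \<le> dist p y"
      using distance_attains_inf[of Z p] by (metis empty_iff)
    define R where "R = dist p q"
    have "R \<le> dist p x0" using q(2)[of x0] x0 e by (simp add: R_def Z_def)
    then have Re: "R < e" using p by (simp add: dist_commute)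
    have R: "R > 0" using q(1) \<open>f p \<noteq> m\<close> by (auto simp: R_def Z_def)
    have qm: "f q = m" using q by (simp add: Z_def)
    have less: "f y < m" if "dist p y < R" for y
    proof -
      have "dist x0 y \<le> dist x0 p + dist p y" by (rule dist_triangle)
      then have "y \<in> cball x0 (2 * e)" using that Re p by simp
      then have "y \<in> S" "y \<notin> Z" using sub2 q(2)[of y] that by (auto simp: R_def)
      then show ?thesis using max[of y] \<open>y \<in> cball x0 (2 * e)\<close> by (auto simp: Z_def)
    qed
    have qS: "q \<in> S" using q sub2 by (auto simp: Z_def)
    \<comment> \<open>The disc about the midpoint \<open>z\<close> through \<open>q\<close> has half
      the radius; its closure meets the circle of radius \<open>R\<close> about \<open>p\<close>
      only in \<open>q\<close>, so \<open>f\<close> is below \<open>m\<close> on it except at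
      \<open>q\<close>.\<close>
    define z where "z = (1/2) *\<^sub>R (p + q)"
    define n where "n = q - z"
    have n: "z - p = n" "n \<noteq> 0" "norm n = R / 2"
    proof -
      have *: "n = (1/2) *\<^sub>R (q - p)" "z - p = (1/2) *\<^sub>R (q - p)"
        by (simp_all add: n_def z_def vec_eq_iff field_simps)
      then show "z - p = n" by simp
      show "norm n = R / 2" unfolding * R_def by (simp add: dist_norm norm_minus_commute)
      then show "n \<noteq> 0" using R by auto
    qed
    have inner_disc: "f y < m" if "norm (y - z) \<le> R / 2" "y \<noteq> q" for y
    proof (rule less)
      have yp: "y - p = (y - z) + n" by (simp flip: n(1))
      \<comment> \<open>Parallelogram law: \<open>y - p\<close> and \<open>y - q\<close> are the sum
        and the difference of \<open>y - z\<close> and \<open>n\<close>.\<close>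
      have "(norm (y - p))\<^sup>2 = 2 * (norm (y - z))\<^sup>2 + 2 * (norm n)\<^sup>2 - (norm (y - z - n))\<^sup>2"
        unfolding yp power2_norm_eq_inner by (simp add: inner_add_left inner_add_right inner_diff_left inner_diff_right inner_commute)
      moreover have "(norm (y - z - n))\<^sup>2 > 0" using that(2) by (simp add: n_def)
      moreover have "(norm (y - z))\<^sup>2 \<le> (R / 2)\<^sup>2" using that(1) by (simp add: power_mono)
      moreover have "(R / 2)\<^sup>2 = R\<^sup>2 / 4" by (simp add: power_divide)
      ultimately have "(norm (y - p))\<^sup>2 < R\<^sup>2" unfolding n(3) by linarith
      then have "norm (y - p) < R" using R power2_less_imp_less[of "norm (y - p)" R] by simp
      then show "dist p y < R" by (simp add: dist_norm norm_minus_commute)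
    qed
    define L where "L = (\<lambda>w x. A x * pd 1 (pd 1 w) x + 2 * B x * pd 1 (pd 2 w) x + C x * pd 2 (pd 2 w) x
        + b1 x * pd 1 w x + b2 x * pd 2 w x)"
    define Q where "Q = A q * (n $ 1)\<^sup>2 + 2 * B q * n $ 1 * n $ 2 + C q * (n $ 2)\<^sup>2"
    have Q: "Q > 0"
    proof -
      have eq: "A q * Q = (A q * n $ 1 + B q * n $ 2)\<^sup>2 + (A q * C q - (B q)\<^sup>2) * (n $ 2)\<^sup>2"
        unfolding Q_def by (simp add: algebra_simps power2_eq_square)
      have "A q * Q > 0"
      proof (cases "n $ 2 = 0")
        case True
        then have "n $ 1 \<noteq> 0" using n(2) by (auto simp: vec_eq_iff forall_2)
        then show ?thesis unfolding eq using True ell[OF qS] by simp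
      next
        case False
        then show ?thesis unfolding eq using ell[OF qS] by (intro add_nonneg_pos) auto
      qed
      then show ?thesis using ell(1)[OF qS] by (simp add: zero_less_mult_iff)
    qed
    \<comment> \<open>At \<open>q\<close> the operator maps the Gaussian to 2 \<alpha> (2 \<alpha> Q
      - c) times its value: \<open>Q\<close> collects what is quadratic in \<alpha>,
      \<open>c\<close> the rest. The choice of \<alpha> gives \<alpha> Q = |c| + 1, hence
      positivity.\<close>
    define c where "c = A q + C q + b1 q * n $ 1 + b2 q * n $ 2"
    define \<alpha> where "\<alpha> = (\<bar>c\<bar> + 1) / Q"
    have \<alpha>: "\<alpha> > 0" using Q by (simp add: \<alpha>_def)
    have "2 * \<alpha> * (2 * \<alpha> * Q - c) > 0"
    proof -
      have "\<alpha> * Q = \<bar>c\<bar> + 1" using Q by (simp add: \<alpha>_def)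
      then show ?thesis using \<alpha> by (intro mult_pos_pos) auto
    qed
    define h where "h = (\<lambda>x. exp (- \<alpha> * (norm (x - z))\<^sup>2))"
    note hd = gaussian_derivatives[OF h_def]
    have hpos: "h x > 0" "h x \<le> 1" for x using \<alpha> by (auto simp: h_def)
    define P where "P = (\<lambda>x. A x * (4 * \<alpha>\<^sup>2 * (x - z) $ 1 * (x - z) $ 1 - 2 * \<alpha>)
        + 2 * B x * (4 * \<alpha>\<^sup>2 * (x - z) $ 1 * (x - z) $ 2)
        + C x * (4 * \<alpha>\<^sup>2 * (x - z) $ 2 * (x - z) $ 2 - 2 * \<alpha>)
        - 2 * \<alpha> * (b1 x * (x - z) $ 1 + b2 x * (x - z) $ 2))"
    have Lh: "L h x = P x * h x" for x
      unfolding L_def P_def hd by (simp add: algebra_simps)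
    have "P q = 2 * \<alpha> * (2 * \<alpha> * Q - c)"
      unfolding P_def Q_def c_def n_def[symmetric] by (simp add: algebra_simps power2_eq_square)
    then have Pq: "P q > 0" using \<open>2 * \<alpha> * (2 * \<alpha> * Q - c) > 0\<close> by simp
    have "continuous_on S P"
      unfolding P_def by (intro continuous_intros cont)
    then have "isCont P q" using continuous_on_eq_continuous_at[OF S] qS by blast
    then have "\<forall>\<^sub>F x in nhds q. 0 < P x \<and> x \<in> S"
      using Pq S qS by (intro eventually_conj eventually_nhds_in_open order_tendstoD(1))
        (auto simp: continuous_at tendsto_at_iff_tendsto_nhds)
    then obtain d' where d': "d' > 0" "\<And>x. dist x q < d' \<Longrightarrow> 0 < P x \<and> x \<in> S"
      unfolding eventually_nhds_metric by blast
    define d where "d = d' / 2"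
    have d: "d > 0" "\<And>x. x \<in> cball q d \<Longrightarrow> 0 < P x \<and> x \<in> S"
      using d' by (auto simp: d_def dist_commute)
    \<comment> \<open>The circle around \<open>q\<close> splits in two. On \<open>K\<close>
      compactness puts \<open>f\<close> below \<open>m\<close> by a uniform gap \<kappa>, which
      \<epsilon> times the Gaussian is too small to fill; off \<open>K\<close> the Gaussian is
      smaller than at \<open>q\<close>.\<close>
    define K where "K = sphere q d \<inter> cball z (R / 2)"
    have "\<exists>\<kappa>>0. \<forall>y\<in>K. f y \<le> m - \<kappa>"
    proof (cases "K = {}")
      case False
      have "compact K" unfolding K_def by (intro compact_Int_closed) auto
      moreover have "continuous_on K f"
        by (rule continuous_on_subset[OF contf]) (use d(2) in \<open>auto simp: K_def\<close>)
      ultimately obtain y where y: "y \<in> K" "\<And>x. x \<in> K \<Longrightarrow> f x \<le> f y"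
        using continuous_attains_sup[OF _ False] by blast
      have "f y < m" using y(1) d(1) by (intro inner_disc) (auto simp: K_def dist_norm norm_minus_commute)
      then show ?thesis using y(2) by (intro exI[of _ "m - f y"]) auto
    qed (auto intro: exI[of _ 1])
    then obtain \<kappa> where \<kappa>: "\<kappa> > 0" "\<And>y. y \<in> K \<Longrightarrow> f y \<le> m - \<kappa>" by blast
    define \<epsilon> where "\<epsilon> = \<kappa> / 2"
    have \<epsilon>: "\<epsilon> > 0" "\<epsilon> < \<kappa>" using \<kappa> by (auto simp: \<epsilon>_def)
    define w where "w = (\<lambda>x. f x + \<epsilon> * h x)"
    have hS: "smooth_on h S" using smooth_on_subset[OF hd(1)] by simp
    have w: "smooth_on w S"
      unfolding w_def by (intro smooth_on_add smooth_on_mult smooth_on_const f hS S)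
    have bdry: "w y < w q" if y: "y \<in> sphere q d" for y
    proof (cases "y \<in> K")
      case True
      have "w y \<le> m - \<kappa> + \<epsilon>"
        unfolding w_def using \<kappa>(2)[OF True] hpos(2)[of y] \<epsilon> by (intro add_mono) auto
      also have "\<dots> < m" using \<epsilon> by simp
      also have "\<dots> < w q" using hpos(1)[of q] \<epsilon> by (simp add: w_def qm)
      finally show ?thesis .
    next
      case False
      then have "norm (y - z) > R / 2" using y by (simp add: K_def dist_norm norm_minus_commute)
      then have "norm (y - z) > norm (q - z)" using n by (simp add: n_def)
      then have "(norm (y - z))\<^sup>2 > (norm (q - z))\<^sup>2" by (simp add: power_strict_mono)
      then have "h y < h q" using \<alpha> by (simp add: h_def)
      moreover have "f y \<le> m" using max d(2) y by simp
      ultimately show ?thesis using \<epsilon> by (simp add: w_def qm add_le_less_mono)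
    qed
    have "continuous_on (cball q d) w"
      by (rule continuous_on_subset[OF smooth_on_imp_continuous_on[OF w]]) (use d in auto)
    then obtain y where y: "y \<in> cball q d" "\<And>x. x \<in> cball q d \<Longrightarrow> w x \<le> w y"
      using continuous_attains_sup[of "cball q d" w] d(1) by (metis cball_eq_empty compact_cball not_less_iff_gr_or_eq)
    have "w q \<le> w y" using y(2) d(1) by simp
    then have "y \<notin> sphere q d" using bdry by fastforce
    \<comment> \<open>The values on the circle are below \<open>w q\<close>, so the maximum over the
      closed disc is interior. There the operator is nonpositive on \<open>w\<close>, yet
      \<open>f\<close> contributes a nonnegative and the Gaussian a positive term.\<close>
    then have yb: "y \<in> ball q d" using y(1) by (auto simp: less_le)
    have yS: "y \<in> S" using d y by blast
    have wb: "smooth_on w (ball q d)"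
      by (rule smooth_on_subset[OF w]) (use d in auto)
    note ymax = elliptic_at_max[OF wb open_ball yb _ ell[OF yS]]
    have "L w y \<le> 0"
      using ymax[OF y(2)] unfolding L_def by simp
    moreover have "L w y = L f y + \<epsilon> * L h y"
    proof -
      have p1: "pd i w x = pd i f x + \<epsilon> * pd i h x" if "x \<in> S" for i x
        unfolding w_def using smooth_on_differentiable[OF f that] smooth_on_differentiable[OF hS that]
        by (simp add: pd_add pd_mult pd_const)
      have p2: "pd j (pd i w) y = pd j (pd i f) y + \<epsilon> * pd j (pd i h) y" for i j
        using pd_cong[OF smooth_on_differentiable[OF smooth_on_pd[OF w] yS] S yS p1, of j i]
          smooth_on_differentiable[OF smooth_on_pd[OF f] yS] smooth_on_differentiable[OF smooth_on_pd[OF hS] yS]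
        by (simp add: pd_add pd_mult pd_const)
      show ?thesis unfolding L_def p1[OF yS] p2 by (simp add: algebra_simps)
    qed
    moreover have "L f y \<ge> 0" unfolding L_def using sub[OF yS] .
    moreover have "\<epsilon> * L h y > 0" unfolding Lh using \<epsilon> hpos(1) d(2)[OF y(1)] by simp
    ultimately show False by linarith
  qed
  then show ?thesis using e by blast
qed

section \<open>Metrics and connections in coordinates\<close>

text \<open>The condition of \<open>riemannian_metric\<close> for a single chart, on any open set in
  place of the full coordinate domain, so that it can be restricted to overlaps.\<close>

definition metric_on :: "(real ^ 'm \<Rightarrow> real ^ 'm ^ 'm::finite) \<Rightarrow> (real ^ 'm) set \<Rightarrow> bool" where
  "metric_on g S \<longleftrightarrow> open S \<and> smooth_on g S \<and>
    (\<forall>x\<in>S. transpose (g x) = g x \<and> (\<forall>u. u \<noteq> 0 \<longrightarrow> metric_ip (g x) u u > 0))"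

lemma metric_ip_eq_sum: "metric_ip G a b = (\<Sum>i\<in>UNIV. \<Sum>j\<in>UNIV. G $ i $ j * (a $ i * b $ j))"
  by (simp add: metric_ip_def inner_vec_def matrix_vector_mult_def sum_distrib_left mult_ac)

lemma metric_ip_add_left: "metric_ip G (a + b) c = metric_ip G a c + metric_ip G b c"
  and metric_ip_add_right: "metric_ip G c (a + b) = metric_ip G c a + metric_ip G c b"
  and metric_ip_diff_left: "metric_ip G (a - b) c = metric_ip G a c - metric_ip G b c"
  and metric_ip_scaleR_left: "metric_ip G (r *\<^sub>R a) c = r * metric_ip G a c"
  and metric_ip_scaleR_right: "metric_ip G c (r *\<^sub>R a) = r * metric_ip G c a"
  by (simp_all add: metric_ip_eq_sum algebra_simps sum.distrib sum_subtractf sum_distrib_left)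

lemma metric_ip_zero [simp]: "metric_ip G 0 c = 0" "metric_ip G c 0 = 0" "metric_ip 0 a c = 0"
  by (simp_all add: metric_ip_eq_sum)

lemma metric_ip_commute:
  assumes "transpose G = G" shows "metric_ip G a b = metric_ip G b a"
  by (metis assms dot_lmul_matrix inner_commute metric_ip_def transpose_matrix_vector)

lemma metric_onD:
  assumes "metric_on g S"
  shows "open S" and "smooth_on g S" and "x \<in> S \<Longrightarrow> transpose (g x) = g x"
    and "x \<in> S \<Longrightarrow> u \<noteq> 0 \<Longrightarrow> metric_ip (g x) u u > 0"
    and "x \<in> S \<Longrightarrow> g differentiable (at x)"
  using assms smooth_on_differentiable unfolding metric_on_def by blast+

lemma metric_ip_nonneg:
  assumes "metric_on g S" "x \<in> S"
  shows "metric_ip (g x) u u \<ge> 0"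
  using metric_onD(4)[OF assms, of u] by (cases "u = 0") (auto simp: metric_ip_def)

lemma metric_invertible:
  assumes "metric_on g S" "x \<in> S"
  shows "invertible (g x)"
proof -
  have "inj ((*v) (g x))"
  proof (rule injI)
    fix a b assume "g x *v a = g x *v b"
    then have "metric_ip (g x) (a - b) (a - b) = 0"
      by (simp add: metric_ip_def matrix_vector_mult_diff_distrib)
    then show "a = b" using metric_onD(4)[OF assms, of "a - b"] by force
  qed
  then have "inj (\<lambda>v. g x *v v)" by simp
  then show ?thesis
    using invertible_left_inverse matrix_left_invertible_injective by blast
qed

lemma metric_ip_eqI:
  assumes "metric_on g S" "x \<in> S" "\<And>w. metric_ip (g x) a w = metric_ip (g x) b w"
  shows "a = b"
proof (rule ccontr)
  assume "a \<noteq> b"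
  then have "metric_ip (g x) (a - b) (a - b) > 0" using metric_onD(4)[OF assms(1,2)] by simp
  then show False using assms(3)[of "a - b"] by (simp add: metric_ip_diff_left)
qed

lemma Gam_add_left: "Gam g x (a + b) c = Gam g x a c + Gam g x b c"
  and Gam_add_right: "Gam g x c (a + b) = Gam g x c a + Gam g x c b"
  and Gam_scaleR_left: "Gam g x (r *\<^sub>R a) c = r *\<^sub>R Gam g x a c"
  and Gam_scaleR_right: "Gam g x c (r *\<^sub>R a) = r *\<^sub>R Gam g x c a"
  by (simp_all add: Gam_def vec_eq_iff algebra_simps sum.distrib sum_distrib_left)

lemma levi_civita_const: "levi_civita g (\<lambda>_. v) x u = Gam g x u v"
  by (simp add: levi_civita_def)

lemma Gam_commute:
  assumes "metric_on g S" "x \<in> S"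
  shows "Gam g x u v = Gam g x v u"
  using levi_civita_torsion_free[OF metric_onD(5)[OF assms] metric_onD(1)[OF assms(1)] assms(2) metric_onD(3)[OF assms(1)]]
  by (simp add: levi_civita_const)

lemma has_derivative_metric_ip:
  assumes "(G has_derivative G') (at x)" "(V has_derivative V') (at x)" "(W has_derivative W') (at x)"
  shows "((\<lambda>y. metric_ip (G y) (V y) (W y)) has_derivative
    (\<lambda>u. metric_ip (G' u) (V x) (W x) + metric_ip (G x) (V' u) (W x) + metric_ip (G x) (V x) (W' u))) (at x)"
proof -
  have G: "((\<lambda>y. G y $ i $ j) has_derivative (\<lambda>u. G' u $ i $ j)) (at x)"
    and V: "((\<lambda>y. V y $ i) has_derivative (\<lambda>u. V' u $ i)) (at x)"
    and W: "((\<lambda>y. W y $ i) has_derivative (\<lambda>u. W' u $ i)) (at x)" for i j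
    by (intro bounded_linear.has_derivative[OF bounded_linear_vec_nth] assms)+
  show ?thesis
    unfolding metric_ip_eq_sum
    by (rule has_derivative_eq_rhs[OF has_derivative_sum[OF has_derivative_sum[OF
            has_derivative_mult[OF G has_derivative_mult[OF V W]]]]])
       (simp add: fun_eq_iff distrib_left sum.distrib)
qed

lemma frechet_derivative_metric_ip_const:
  assumes "metric_on g S" "x \<in> S"
  shows "metric_ip (frechet_derivative g (at x) u) v w =
    metric_ip (g x) (Gam g x u v) w + metric_ip (g x) v (Gam g x u w)"
proof -
  have "((\<lambda>y. metric_ip (g y) v w) has_derivative (\<lambda>u. metric_ip (frechet_derivative g (at x) u) v w)) (at x)"
    using has_derivative_metric_ip[OF metric_onD(5)[OF assms, unfolded frechet_derivative_works]
        has_derivative_const has_derivative_const, of v w] by simp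
  then show ?thesis
    using levi_civita_metric[OF metric_onD(5)[OF assms] metric_onD(1)[OF assms(1)] assms(2)
        metric_onD(3)[OF assms(1)] metric_invertible[OF assms], of v w u]
    by (metis frechet_derivative_at levi_civita_const)
qed

text \<open>The chain rule reduces the derivative of the metric along \<open>F\<close> to
  compatibility for constant fields at the point \<open>F x\<close>. With \<open>F\<close> the
  identity this becomes the product rule for variable vector fields on the domain, the form used for
  curvature and for \<nabla>A_H.\<close>

lemma pullback_connection_metric:
  fixes F :: "real ^ 'm::finite \<Rightarrow> real ^ 'n::finite"
  assumes h: "metric_on h T" "F x \<in> T"
    and F: "F differentiable (at x)" and V: "V differentiable (at x)" and W: "W differentiable (at x)"
  shows "frechet_derivative (\<lambda>y. metric_ip (h (F y)) (V y) (W y)) (at x) u =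
    metric_ip (h (F x)) (nabla_along h F V x u) (W x) + metric_ip (h (F x)) (V x) (nabla_along h F W x u)"
proof -
  have "((\<lambda>y. h (F y)) has_derivative
      (\<lambda>u. frechet_derivative h (at (F x)) (frechet_derivative F (at x) u))) (at x)"
    by (rule has_derivative_compose[OF F[unfolded frechet_derivative_works] metric_onD(5)[OF h, unfolded frechet_derivative_works]])
  from has_derivative_metric_ip[OF this V[unfolded frechet_derivative_works] W[unfolded frechet_derivative_works]]
  have "frechet_derivative (\<lambda>y. metric_ip (h (F y)) (V y) (W y)) (at x) u =
      metric_ip (frechet_derivative h (at (F x)) (frechet_derivative F (at x) u)) (V x) (W x) +
      metric_ip (h (F x)) (frechet_derivative V (at x) u) (W x) + metric_ip (h (F x)) (V x) (frechet_derivative W (at x) u)"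
    by (rule fun_cong[OF frechet_derivative_at, symmetric])
  then show ?thesis
    unfolding frechet_derivative_metric_ip_const[OF h] nabla_along_def metric_ip_add_left metric_ip_add_right
    by linarith
qed

section \<open>Second fundamental forms of maps: normality and composition\<close>

lemma second_ff_eq:
  "second_ff g h F x u v = frechet_derivative (\<lambda>y. frechet_derivative F (at y) v) (at x) u +
    Gam h (F x) (frechet_derivative F (at x) u) (frechet_derivative F (at x) v) -
    frechet_derivative F (at x) (Gam g x u v)"
  by (simp add: second_ff_def nabla_along_def levi_civita_const)

definition isometric_on where
  "isometric_on g h F S \<longleftrightarrow> (\<forall>x\<in>S. \<forall>u v. metric_ip (g x) u v =
     metric_ip (h (F x)) (frechet_derivative F (at x) u) (frechet_derivative F (at x) v))"

text \<open>Koszul's uniqueness argument: the trilinear form below is symmetric in its first two arguments and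
  skew in the last two, hence zero.\<close>

lemma second_ff_normal:
  fixes F :: "real ^ 'm::finite \<Rightarrow> real ^ 'n::finite"
  assumes g: "metric_on g S" and h: "metric_on h T" and F: "smooth_on F S" "F ` S \<subseteq> T"
    and iso: "isometric_on g h F S" and x: "x \<in> S"
  shows "metric_ip (h (F x)) (second_ff g h F x u v) (frechet_derivative F (at x) w) = 0"
proof -
  define D where "D = frechet_derivative F (at x)"
  define N where "N = (\<lambda>u v. nabla_along h F (\<lambda>y. frechet_derivative F (at y) v) x u)"
  define t where "t = (\<lambda>u v w. metric_ip (h (F x)) (second_ff g h F x u v) (D w))"
  have Fx: "F x \<in> T" using F x by auto
  have isox: "metric_ip (g x) u v = metric_ip (h (F x)) (D u) (D v)" for u v
    using iso x by (auto simp: isometric_on_def D_def)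
  have dV: "(\<lambda>y. frechet_derivative F (at y) v) differentiable (at x)" for v
    using smooth_on_differentiable[OF smooth_on_frechet_derivative[OF F(1)] x] .
  have teq: "t u v w = metric_ip (h (F x)) (N u v) (D w) - metric_ip (g x) (Gam g x u v) w" for u v w
    by (simp add: t_def second_ff_def N_def levi_civita_const metric_ip_diff_left isox flip: D_def)
  have Nsym: "N u v = N v u" for u v
    unfolding N_def nabla_along_def
    by (subst second_derivative_symmetric_vec[OF F(1) metric_onD(1)[OF g] x], subst Gam_commute[OF h Fx]) (rule refl)
  have sym: "t u v w = t v u w" for u v w
    unfolding teq using Nsym[of u v] Gam_commute[OF g x, of u v] by simp
  have skew: "t u v w = - t u w v" for u v w
  proof -
    \<comment> \<open>Both sides of the isometry identity are differentiated in direction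
      \<open>u\<close>: one by compatibility of the connection of \<open>g\<close>, the other by
      compatibility of the pullback connection.\<close>
    have "metric_ip (g x) (Gam g x u v) w + metric_ip (g x) v (Gam g x u w) =
        frechet_derivative (\<lambda>y. metric_ip (g y) v w) (at x) u"
      using levi_civita_metric[OF metric_onD(5)[OF g x] metric_onD(1)[OF g] x metric_onD(3)[OF g] metric_invertible[OF g x]]
      by (simp add: levi_civita_const)
    also have "\<dots> = frechet_derivative (\<lambda>y. metric_ip (h (F y)) (frechet_derivative F (at y) v) (frechet_derivative F (at y) w)) (at x) u"
    proof (rule fun_cong[OF frechet_derivative_transform_within_open[OF _ metric_onD(1)[OF g] x]])
      show "(\<lambda>y. metric_ip (g y) v w) differentiable at x"
        using has_derivative_metric_ip[OF metric_onD(5)[OF g x, unfolded frechet_derivative_works]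
            has_derivative_const has_derivative_const, of v w] differentiable_def by blast
    qed (use iso in \<open>simp add: isometric_on_def\<close>)
    also have "\<dots> = metric_ip (h (F x)) (N u v) (D w) + metric_ip (h (F x)) (D v) (N u w)"
      unfolding pullback_connection_metric[OF h Fx smooth_on_differentiable[OF F(1) x] dV dV] N_def D_def ..
    finally show ?thesis
      unfolding teq using metric_ip_commute[OF metric_onD(3)[OF g x], of v "Gam g x u w"]
        metric_ip_commute[OF metric_onD(3)[OF h Fx], of "D v" "N u w"] by linarith
  qed
  have "t u v w = - t u v w"
    using skew[of u v w] sym[of u w v] skew[of w u v] sym[of w v u] skew[of v w u] sym[of v u w] by linarith
  then show ?thesis by (simp add: t_def D_def)
qed

text \<open>When dF is onto, only the zero vector is normal. For changes of coordinates this says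
  that they preserve the Levi-Civita connection.\<close>

lemma second_ff_local_isometry:
  fixes F :: "real ^ 'm::finite \<Rightarrow> real ^ 'n::finite"
  assumes "metric_on g S" and h: "metric_on h T" and F: "smooth_on F S" "F ` S \<subseteq> T"
    and "isometric_on g h F S" and x: "x \<in> S" and surj: "surj (frechet_derivative F (at x))"
  shows "second_ff g h F x u v = 0"
proof -
  have Fx: "F x \<in> T" using F x by auto
  have "metric_ip (h (F x)) (second_ff g h F x u v) w = metric_ip (h (F x)) 0 w" for w
  proof -
    obtain w' where "w = frechet_derivative F (at x) w'" using surj by (rule surjE)
    then show ?thesis using second_ff_normal[OF assms(1-6), of u v w'] by simp
  qed
  then show ?thesis by (rule metric_ip_eqI[OF h Fx])
qed

text \<open>Product and chain rule for d\<psi> applied to a field \<open>V\<close> along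
  \<open>F\<close>. Expanding in partial derivatives keeps the direction fixed while \<psi> is
  differentiated a second time.\<close>

lemma has_derivative_frechet_derivative_apply:
  fixes \<psi> :: "real ^ 'n::finite \<Rightarrow> 'b::real_normed_vector"
  assumes \<psi>: "smooth_on \<psi> T" "open T" and S: "open S" "x \<in> S" "F ` S \<subseteq> T"
    and F: "(F has_derivative F') (at x)" and V: "(V has_derivative V') (at x)"
  shows "((\<lambda>y. frechet_derivative \<psi> (at (F y)) (V y)) has_derivative
    (\<lambda>u. frechet_derivative (\<lambda>z. frechet_derivative \<psi> (at z) (V x)) (at (F x)) (F' u) +
      frechet_derivative \<psi> (at (F x)) (V' u))) (at x)"
proof -
  have T: "\<And>y. y \<in> S \<Longrightarrow> F y \<in> T" using S by auto
  have dpd: "(pd i \<psi> has_derivative frechet_derivative (pd i \<psi>) (at (F x))) (at (F x))" for i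
    using smooth_on_has_derivative[OF smooth_on_pd[OF \<psi>(1)] T[OF S(2)]] .
  have Vi: "((\<lambda>y. V y $ i) has_derivative (\<lambda>u. V' u $ i)) (at x)" for i
    by (intro bounded_linear.has_derivative[OF bounded_linear_vec_nth] V)
  have ex: "frechet_derivative \<psi> (at z) v = (\<Sum>i\<in>UNIV. v $ i *\<^sub>R pd i \<psi> z)" if "z \<in> T" for z v
    by (rule frechet_derivative_eq_sum_pd[OF smooth_on_differentiable[OF \<psi>(1) that]])
  have 1: "((\<lambda>y. \<Sum>i\<in>UNIV. V y $ i *\<^sub>R pd i \<psi> (F y)) has_derivative
      (\<lambda>u. \<Sum>i\<in>UNIV. V x $ i *\<^sub>R frechet_derivative (pd i \<psi>) (at (F x)) (F' u) + V' u $ i *\<^sub>R pd i \<psi> (F x))) (at x)"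
    by (rule has_derivative_sum[OF has_derivative_scaleR[OF Vi has_derivative_compose[OF F dpd]]])
  have 2: "frechet_derivative (\<lambda>z. frechet_derivative \<psi> (at z) v) (at (F x)) u =
      (\<Sum>i\<in>UNIV. v $ i *\<^sub>R frechet_derivative (pd i \<psi>) (at (F x)) u)" for u v
  proof -
    have "((\<lambda>z. \<Sum>i\<in>UNIV. v $ i *\<^sub>R pd i \<psi> z) has_derivative
        (\<lambda>u. \<Sum>i\<in>UNIV. v $ i *\<^sub>R frechet_derivative (pd i \<psi>) (at (F x)) u)) (at (F x))"
      by (rule has_derivative_sum[OF has_derivative_scaleR_right[OF dpd]])
    then have "((\<lambda>z. frechet_derivative \<psi> (at z) v) has_derivative
        (\<lambda>u. \<Sum>i\<in>UNIV. v $ i *\<^sub>R frechet_derivative (pd i \<psi>) (at (F x)) u)) (at (F x))"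
      by (rule has_derivative_transform_within_open[OF _ \<psi>(2) T[OF S(2)]]) (simp add: ex)
    from fun_cong[OF frechet_derivative_at[OF this], of u] show ?thesis by simp
  qed
  show ?thesis
    by (rule has_derivative_transform_within_open[OF has_derivative_eq_rhs[OF 1] S(1,2)])
       (simp_all add: 2 ex ex[OF T[OF S(2)]] T fun_eq_iff sum.distrib)
qed

text \<open>The rule \<nabla>d(\<psi> o F) = d\<psi>(\<nabla>dF) + \<nabla>d\<psi>(dF, dF) for
  smooth maps: the connection terms of the intermediate metric \<open>h\<close> occur in the two
  summands with opposite signs.\<close>

lemma second_ff_compose:
  fixes F :: "real ^ 'm::finite \<Rightarrow> real ^ 'n::finite" and \<psi> :: "real ^ 'n \<Rightarrow> real ^ 'k::finite"
  assumes \<psi>: "smooth_on \<psi> T" "open T" and F: "smooth_on F S" "F ` S \<subseteq> T" and S: "open S" "x \<in> S"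
  shows "second_ff g h' (\<lambda>y. \<psi> (F y)) x u v =
    frechet_derivative \<psi> (at (F x)) (second_ff g h F x u v) +
    second_ff h h' \<psi> (F x) (frechet_derivative F (at x) u) (frechet_derivative F (at x) v)"
proof -
  have T: "\<And>y. y \<in> S \<Longrightarrow> F y \<in> T" using F by auto
  have dF: "(F has_derivative frechet_derivative F (at y)) (at y)" if "y \<in> S" for y
    by (rule smooth_on_has_derivative[OF F(1) that])
  have d\<psi>: "(\<psi> has_derivative frechet_derivative \<psi> (at (F y))) (at (F y))" if "y \<in> S" for y
    by (rule smooth_on_has_derivative[OF \<psi>(1) T[OF that]])
  have chain: "frechet_derivative (\<lambda>y. \<psi> (F y)) (at y) w =
      frechet_derivative \<psi> (at (F y)) (frechet_derivative F (at y) w)" if "y \<in> S" for y w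
    by (rule fun_cong[OF frechet_derivative_at[OF has_derivative_compose[OF dF[OF that] d\<psi>[OF that]]], symmetric])
  have "((\<lambda>y. frechet_derivative \<psi> (at (F y)) (frechet_derivative F (at y) v)) has_derivative
    (\<lambda>u. frechet_derivative (\<lambda>z. frechet_derivative \<psi> (at z) (frechet_derivative F (at x) v)) (at (F x)) (frechet_derivative F (at x) u) +
      frechet_derivative \<psi> (at (F x)) (frechet_derivative (\<lambda>y. frechet_derivative F (at y) v) (at x) u))) (at x)"
    by (intro has_derivative_frechet_derivative_apply[OF \<psi> S F(2)] dF[OF S(2)]
        smooth_on_has_derivative[OF smooth_on_frechet_derivative[OF F(1)] S(2)])
  then have "((\<lambda>y. frechet_derivative (\<lambda>y. \<psi> (F y)) (at y) v) has_derivative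
    (\<lambda>u. frechet_derivative (\<lambda>z. frechet_derivative \<psi> (at z) (frechet_derivative F (at x) v)) (at (F x)) (frechet_derivative F (at x) u) +
      frechet_derivative \<psi> (at (F x)) (frechet_derivative (\<lambda>y. frechet_derivative F (at y) v) (at x) u))) (at x)"
    by (rule has_derivative_transform_within_open[OF _ S]) (simp add: chain)
  note second = frechet_derivative_at[OF this, symmetric]
  have lin: "linear (frechet_derivative \<psi> (at (F x)))"
    by (rule has_derivative_linear[OF d\<psi>[OF S(2)]])
  show ?thesis
    unfolding second_ff_eq second chain[OF S(2)] by (simp add: linear_add[OF lin] linear_diff[OF lin])
qed

lemma second_ff_cong:
  assumes F: "smooth_on F S" and S: "open S" "x \<in> S" and eq: "\<And>y. y \<in> S \<Longrightarrow> F y = F' y"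
  shows "second_ff g h F x u v = second_ff g h F' x u v"
proof -
  have "frechet_derivative F (at y) = frechet_derivative F' (at y)" if "y \<in> S" for y
    by (rule frechet_derivative_transform_within_open[OF smooth_on_differentiable[OF F that] S(1) that eq])
  moreover have "frechet_derivative (\<lambda>y. frechet_derivative F (at y) v) (at x) =
      frechet_derivative (\<lambda>y. frechet_derivative F' (at y) v) (at x)"
    by (rule frechet_derivative_transform_within_open[OF
        smooth_on_differentiable[OF smooth_on_frechet_derivative[OF F] S(2)] S]) (simp add: calculation)
  ultimately show ?thesis unfolding second_ff_eq using eq S by simp
qed

lemma linear_second_ff:
  fixes F :: "real ^ 'm::finite \<Rightarrow> real ^ 'n::finite"
  assumes "smooth_on F S" "x \<in> S" "open S"
  shows "linear (second_ff g h F x u)" and "linear (\<lambda>u. second_ff g h F x u v)"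
proof -
  have 1: "linear (frechet_derivative F (at x))"
    by (rule has_derivative_linear[OF smooth_on_has_derivative[OF assms(1,2)]])
  have 2: "linear (frechet_derivative (\<lambda>y. frechet_derivative F (at y) v) (at x))" for v
    by (rule has_derivative_linear[OF smooth_on_has_derivative[OF smooth_on_frechet_derivative[OF assms(1)] assms(2)]])
  show "linear (\<lambda>u. second_ff g h F x u v)"
    unfolding second_ff_eq
    by (rule linearI) (simp_all add: linear_add[OF 1] linear_add[OF 2] linear_scale[OF 1] linear_scale[OF 2]
        Gam_add_left Gam_scaleR_left algebra_simps)
  \<comment> \<open>Here \<open>v\<close> sits inside the differentiated field; symmetry of second
    derivatives moves it to the slot where linearity is evident.\<close>
  have "linear (\<lambda>v. second_ff g h F x u v)"
    unfolding second_ff_eq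
    by (rule linearI) (simp_all add: second_derivative_symmetric_vec[OF assms(1,3,2), where v = u]
        linear_add[OF 1] linear_add[OF 2] linear_scale[OF 1] linear_scale[OF 2]
        Gam_add_right Gam_scaleR_right algebra_simps)
  then show "linear (second_ff g h F x u)" by simp
qed

section \<open>Smoothness of the geometric quantities\<close>

lemma smooth_on_det:
  fixes A :: "'a::euclidean_space \<Rightarrow> real ^ 'n ^ 'n::finite"
  assumes "open S" "\<And>i j. smooth_on (\<lambda>x. A x $ i $ j) S"
  shows "smooth_on (\<lambda>x. det (A x)) S"
  unfolding det_def by (intro smooth_on_sum smooth_on_mult smooth_on_const smooth_on_prod assms)

text \<open>Cramer's rule: column \<open>l\<close> of the inverse solves a linear system with a
  constant right-hand side, so its entries are quotients of determinants, which are polynomial in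
  the entries of \<open>A\<close>.\<close>

lemma smooth_on_matrix_inv:
  fixes A :: "'a::euclidean_space \<Rightarrow> real ^ 'n ^ 'n::finite"
  assumes S: "open S" and A: "smooth_on A S" and inv: "\<And>x. x \<in> S \<Longrightarrow> invertible (A x)"
  shows "smooth_on (\<lambda>x. matrix_inv (A x) $ k $ l) S"
proof (rule smooth_on_cong[THEN iffD1, OF S])
  let ?C = "\<lambda>x. \<chi> i j. if j = k then axis l 1 $ i else A x $ i $ j"
  have A': "smooth_on (\<lambda>x. A x $ i $ j) S" for i j
    by (intro smooth_on_vec_nth S A)
  have entry: "smooth_on (\<lambda>x. ?C x $ i $ j) S" for i j
    by (cases "j = k") (simp_all add: A' smooth_on_const S)
  show "smooth_on (\<lambda>x. det (?C x) / det (A x)) S"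
    by (rule smooth_on_divide[OF S smooth_on_det[OF S entry] smooth_on_det[OF S A']])
       (use inv invertible_det_nz in auto)
  show "det (?C x) / det (A x) = matrix_inv (A x) $ k $ l" if "x \<in> S" for x
  proof -
    have "A x *v (matrix_inv (A x) *v axis l 1) = axis l 1"
      by (simp add: matrix_vector_mul_assoc matrix_inv_mult(1)[OF inv[OF that]])
    moreover have "det (A x) \<noteq> 0" using inv[OF that] invertible_det_nz by blast
    ultimately have "matrix_inv (A x) *v axis l 1 =
        (\<chi> k. det (\<chi> i j. if j = k then axis l 1 $ i else A x $ i $ j) / det (A x))"
      by (simp add: cramer)
    then have "(matrix_inv (A x) *v axis l 1) $ k = det (?C x) / det (A x)" by simp
    then show ?thesis by (simp add: matrix_vector_mult_basis column_def)
  qed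
qed

lemma smooth_on_christoffel:
  assumes g: "metric_on g S"
  shows "smooth_on (\<lambda>x. christoffel g x k i j) S"
  unfolding christoffel_def
  by (intro smooth_on_mult smooth_on_sum smooth_on_add smooth_on_diff smooth_on_const smooth_on_vec_nth
      smooth_on_frechet_derivative smooth_on_matrix_inv metric_onD(1,2)[OF g] metric_invertible[OF g])

lemma smooth_on_Gam:
  fixes F :: "'a::euclidean_space \<Rightarrow> real ^ 'n::finite"
  assumes h: "metric_on h T" and S: "open S" "F ` S \<subseteq> T"
    and sm: "smooth_on F S" "smooth_on U S" "smooth_on V S"
  shows "smooth_on (\<lambda>x. Gam h (F x) (U x) (V x)) S"
proof (rule smooth_on_vecI[OF S(1)])
  have "smooth_on (\<lambda>x. christoffel h (F x) k i j) S" for k i j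
    by (rule smooth_on_compose[OF S(1) metric_onD(1)[OF h] S(2) smooth_on_christoffel[OF h] sm(1)])
  then show "smooth_on (\<lambda>x. Gam h (F x) (U x) (V x) $ k) S" for k
    unfolding Gam_def by (simp, intro smooth_on_sum smooth_on_mult smooth_on_vec_nth S sm)
qed

lemma smooth_on_metric_ip:
  assumes "open S" "smooth_on A S" "smooth_on U S" "smooth_on V S"
  shows "smooth_on (\<lambda>x. metric_ip (A x) (U x) (V x)) S"
  unfolding metric_ip_eq_sum by (intro smooth_on_sum smooth_on_mult smooth_on_vec_nth assms)

lemma smooth_on_frechet_derivative_apply:
  fixes F :: "real ^ 'm::finite \<Rightarrow> 'b::real_normed_vector"
  assumes "open S" "smooth_on F S" "smooth_on V S"
  shows "smooth_on (\<lambda>x. frechet_derivative F (at x) (V x)) S"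
proof (rule smooth_on_cong[THEN iffD1, OF assms(1)])
  show "smooth_on (\<lambda>x. \<Sum>i\<in>UNIV. V x $ i *\<^sub>R pd i F x) S"
    by (intro smooth_on_sum smooth_on_scaleR smooth_on_vec_nth smooth_on_pd assms)
qed (simp add: frechet_derivative_eq_sum_pd smooth_on_differentiable[OF assms(2)])

lemma smooth_on_second_ff:
  fixes F :: "real ^ 'm::finite \<Rightarrow> real ^ 'n::finite"
  assumes g: "metric_on g S" and h: "metric_on h T" and F: "smooth_on F S" "F ` S \<subseteq> T"
  shows "smooth_on (\<lambda>x. second_ff g h F x u v) S"
proof -
  note S = metric_onD(1)[OF g]
  have "smooth_on (\<lambda>x. Gam g x u v) S"
    by (rule smooth_on_Gam[OF g S]) (auto intro: smooth_on_ident smooth_on_const S)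
  moreover have "smooth_on (\<lambda>x. Gam h (F x) (frechet_derivative F (at x) u) (frechet_derivative F (at x) v)) S"
    by (intro smooth_on_Gam[OF h S F(2)] F smooth_on_frechet_derivative)
  ultimately show ?thesis
    unfolding second_ff_eq
    by (intro smooth_on_diff smooth_on_add smooth_on_frechet_derivative_apply smooth_on_frechet_derivative F S)
qed

lemma smooth_on_mean_curv:
  fixes F :: "real ^ 2 \<Rightarrow> real ^ 'n::finite"
  assumes g: "metric_on g S" and h: "metric_on h T" and F: "smooth_on F S" "F ` S \<subseteq> T"
  shows "smooth_on (mean_curv g h F) S"
  unfolding mean_curv_def[abs_def] metric_trace_def
  by (intro smooth_on_scaleR smooth_on_sum smooth_on_const smooth_on_second_ff[OF assms] smooth_on_matrix_inv
      metric_onD(1,2)[OF g] metric_invertible[OF g])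

section \<open>Metrics in the plane\<close>

lemma Gam_axis: "Gam g x (axis i 1) (axis j 1) $ k = christoffel g x k i j"
proof -
  have "Gam g x (axis i 1) (axis j 1) $ k =
      (\<Sum>a\<in>UNIV. \<Sum>b\<in>UNIV. if a = i then (if b = j then christoffel g x k a b else 0) else 0)"
    unfolding Gam_def by (auto intro!: sum.cong simp: axis_def)
  also have "\<dots> = (\<Sum>a\<in>UNIV. if a = i then christoffel g x k a j else 0)"
    by (intro sum.cong) auto
  finally show ?thesis by simp
qed

lemma pd_vec_nth: "f differentiable (at x) \<Longrightarrow> pd i (\<lambda>y. f y $ k) x = pd i f x $ k"
  unfolding pd_def by (rule frechet_derivative_bounded_linear[OF bounded_linear_vec_nth])

locale plane_metric =
  fixes g :: "real ^ 2 \<Rightarrow> real ^ 2 ^ 2" and S :: "(real ^ 2) set"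
  assumes metric: "metric_on g S"
begin

definition "E x = g x $ 1 $ 1"
definition "F x = g x $ 1 $ 2"
definition "G x = g x $ 2 $ 2"
definition "W x = E x * G x - F x * F x"

abbreviation "\<Gamma> k i j x \<equiv> christoffel g x k i j"

lemma open_S: "open S" by (rule metric_onD(1)[OF metric])

lemma smooth_EFG: "smooth_on E S" "smooth_on F S" "smooth_on G S"
  unfolding E_def[abs_def] F_def[abs_def] G_def[abs_def]
  by (intro smooth_on_vec_nth open_S metric_onD(2)[OF metric])+

lemma smooth_W: "smooth_on W S"
  unfolding W_def[abs_def] by (intro smooth_on_diff smooth_on_mult open_S smooth_EFG)

context
  fixes x assumes x: "x \<in> S"
begin

lemma g21: "g x $ 2 $ 1 = F x"
  using arg_cong[OF metric_onD(3)[OF metric x], of "\<lambda>m. m $ 2 $ 1"] by (simp add: transpose_def F_def)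

lemma ip_eq: "metric_ip (g x) u v =
    E x * u $ 1 * v $ 1 + F x * (u $ 1 * v $ 2 + u $ 2 * v $ 1) + G x * u $ 2 * v $ 2"
  by (simp add: metric_ip_eq_sum sum_2 g21 E_def F_def G_def algebra_simps)

lemma E_pos: "E x > 0"
  using metric_onD(4)[OF metric x, of "axis 1 1"] axis_eq_0_iff[of "1::2" "1::real"] by (simp add: ip_eq axis_nth axis_def)

lemma W_pos: "W x > 0"
proof -
  have "vector [- F x, E x] \<noteq> (0 :: real ^ 2)" using E_pos by (auto simp: vec_eq_iff forall_2)
  from metric_onD(4)[OF metric x this] have "E x * W x > 0"
    by (simp add: ip_eq W_def algebra_simps)
  then show ?thesis using E_pos by (simp add: zero_less_mult_iff)
qed

lemma G_pos: "G x > 0"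
  using metric_onD(4)[OF metric x, of "axis 2 1"] axis_eq_0_iff[of "2::2" "1::real"] by (simp add: ip_eq axis_nth axis_def)

lemma \<Gamma>_commute: "\<Gamma> k i j x = \<Gamma> k j i x"
  using Gam_commute[OF metric x, of "axis i 1" "axis j 1"] by (metis Gam_axis)

lemma pd_g: "pd i (\<lambda>y. g y $ j $ k) x =
    metric_ip (g x) (Gam g x (axis i 1) (axis j 1)) (axis k 1) + metric_ip (g x) (axis j 1) (Gam g x (axis i 1) (axis k 1))"
proof -
  have d: "g differentiable (at x)" "(\<lambda>y. g y $ j) differentiable (at x)"
    using smooth_on_differentiable[OF _ x] metric_onD(2)[OF metric] smooth_on_vec_nth[OF open_S] by blast+
  have *: "M $ j $ k = metric_ip M (axis j 1) (axis k 1)" for M :: "real ^ 2 ^ 2"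
    unfolding metric_ip_def by (simp add: inner_axis' matrix_vector_mult_basis column_def)
  have "pd i (\<lambda>y. g y $ j $ k) x = frechet_derivative g (at x) (axis i 1) $ j $ k"
    unfolding pd_vec_nth[OF d(2)] pd_vec_nth[OF d(1)] by (simp add: pd_def)
  then show ?thesis unfolding * frechet_derivative_metric_ip_const[OF metric x] .
qed

lemma pd_E: "pd i E x = 2 * (E x * \<Gamma> 1 i 1 x + F x * \<Gamma> 2 i 1 x)"
  and pd_F: "pd i F x = F x * \<Gamma> 1 i 1 x + G x * \<Gamma> 2 i 1 x + E x * \<Gamma> 1 i 2 x + F x * \<Gamma> 2 i 2 x"
  and pd_G: "pd i G x = 2 * (F x * \<Gamma> 1 i 2 x + G x * \<Gamma> 2 i 2 x)"
  unfolding E_def[abs_def] F_def[abs_def] G_def[abs_def] pd_g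
  unfolding ip_eq Gam_axis by (simp_all add: axis_def E_def F_def G_def algebra_simps)

text \<open>Multiplication by the determinant \<open>W\<close>, here and in the identities that
  follow, keeps everything polynomial in the metric coefficients.\<close>

lemma W_matrix_inv:
  "W x * matrix_inv (g x) $ 1 $ 1 = G x" "W x * matrix_inv (g x) $ 1 $ 2 = - F x"
  "W x * matrix_inv (g x) $ 2 $ 1 = - F x" "W x * matrix_inv (g x) $ 2 $ 2 = E x"
proof -
  have *: "(g x ** matrix_inv (g x)) $ i $ j = (if i = j then 1 else 0)" for i j
    using matrix_inv_mult(1)[OF metric_invertible[OF metric x]] by (simp add: mat_def)
  have m: "E x * matrix_inv (g x) $ 1 $ j + F x * matrix_inv (g x) $ 2 $ j = (if 1 = j then 1 else 0)"
    "F x * matrix_inv (g x) $ 1 $ j + G x * matrix_inv (g x) $ 2 $ j = (if 2 = j then 1 else 0)" for j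
    using *[of 1 j] *[of 2 j] by (simp_all add: matrix_matrix_mult_def sum_2 g21 E_def F_def G_def)
  have "W x * matrix_inv (g x) $ 1 $ j = G x * (if 1 = j then 1 else 0) - F x * (if 2 = j then 1 else 0)"
    "W x * matrix_inv (g x) $ 2 $ j = E x * (if 2 = j then 1 else 0) - F x * (if 1 = j then 1 else 0)" for j
    unfolding W_def m[symmetric] by (simp_all add: algebra_simps)
  then show "W x * matrix_inv (g x) $ 1 $ 1 = G x" "W x * matrix_inv (g x) $ 1 $ 2 = - F x"
    "W x * matrix_inv (g x) $ 2 $ 1 = - F x" "W x * matrix_inv (g x) $ 2 $ 2 = E x"
    by simp_all
qed

lemma W_metric_trace:
  "W x *\<^sub>R metric_trace (g x) b = G x *\<^sub>R b (axis 1 1) (axis 1 1) - F x *\<^sub>R b (axis 1 1) (axis 2 1)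
    - F x *\<^sub>R b (axis 2 1) (axis 1 1) + E x *\<^sub>R b (axis 2 1) (axis 2 1)"
  unfolding metric_trace_def sum_2 scaleR_add_right scaleR_scaleR W_matrix_inv by simp

text \<open>The inverse metric applied to the covector components of \<open>u\<close> and
  \<open>v\<close>; it evaluates inner products of Christoffel vectors from Christoffel symbols of
  the first kind.\<close>

lemma W_ip: "W x * metric_ip (g x) u v =
    G x * metric_ip (g x) u (axis 1 1) * metric_ip (g x) v (axis 1 1)
    - F x * (metric_ip (g x) u (axis 1 1) * metric_ip (g x) v (axis 2 1) + metric_ip (g x) u (axis 2 1) * metric_ip (g x) v (axis 1 1))
    + E x * metric_ip (g x) u (axis 2 1) * metric_ip (g x) v (axis 2 1)"
  unfolding ip_eq W_def by (simp add: axis_def algebra_simps)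

end

text \<open>Brioschi's formula. Metric compatibility turns <R(e,f)f, e> into derivatives of
  Christoffel symbols of the first kind and inner products of Christoffel vectors, and both are
  expressed by E, F, G and their derivatives. The factor W^2 removes all denominators.\<close>

lemma brioschi:
  assumes x: "x \<in> S"
  shows "gauss_curv g x * (W x)\<^sup>2 =
    W x * (pd 1 (pd 2 F) x - pd 1 (pd 1 G) x / 2 - pd 2 (pd 2 E) x / 2)
    - (G x * (pd 2 F x - pd 1 G x / 2) * (pd 1 E x / 2)
      - F x * ((pd 2 F x - pd 1 G x / 2) * (pd 1 F x - pd 2 E x / 2) + (pd 2 G x / 2) * (pd 1 E x / 2))
      + E x * (pd 2 G x / 2) * (pd 1 F x - pd 2 E x / 2))
    + (G x * (pd 2 E x / 2)\<^sup>2 - 2 * F x * (pd 2 E x / 2) * (pd 1 G x / 2) + E x * (pd 1 G x / 2)\<^sup>2)"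
proof -
  let ?e = "axis 1 1 :: real ^ 2" and ?f = "axis 2 1 :: real ^ 2"
  \<comment> \<open>Christoffel symbols of the first kind, which are linear in the first derivatives
    of the metric.\<close>
  define \<Gamma>\<Gamma> where "\<Gamma>\<Gamma> = (\<lambda>i j k y. metric_ip (g y) (Gam g y (axis i 1) (axis j 1)) (axis k 1))"
  have K: "\<Gamma>\<Gamma> 1 1 1 y = pd 1 E y / 2" "\<Gamma>\<Gamma> 1 1 2 y = pd 1 F y - pd 2 E y / 2"
    "\<Gamma>\<Gamma> 1 2 1 y = pd 2 E y / 2" "\<Gamma>\<Gamma> 1 2 2 y = pd 1 G y / 2"
    "\<Gamma>\<Gamma> 2 2 1 y = pd 2 F y - pd 1 G y / 2" "\<Gamma>\<Gamma> 2 2 2 y = pd 2 G y / 2" if "y \<in> S" for y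
    unfolding \<Gamma>\<Gamma>_def pd_E[OF that] pd_F[OF that] pd_G[OF that] ip_eq[OF that] Gam_axis
    using \<Gamma>_commute[OF that, of 1 1 2] \<Gamma>_commute[OF that, of 2 1 2] by (simp_all add: axis_def algebra_simps)
  have smG: "smooth_on (\<lambda>y. Gam g y u v) S" for u v
    by (rule smooth_on_Gam[OF metric open_S, of "\<lambda>y. y"]) (auto intro: smooth_on_ident smooth_on_const open_S)
  have "metric_ip (g x) (levi_civita g (\<lambda>y. Gam g y u v) x w) z =
      frechet_derivative (\<lambda>y. metric_ip (g y) (Gam g y u v) z) (at x) w -
      metric_ip (g x) (Gam g x u v) (Gam g x w z)" for u v w z
    using pullback_connection_metric[OF metric, of "\<lambda>y. y" x "\<lambda>y. Gam g y u v" "\<lambda>_. z" w]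
      smooth_on_differentiable[OF smG x] x
    by (simp add: nabla_along_def levi_civita_def)
  then have R: "metric_ip (g x) (riemann_curv g x ?e ?f ?f) ?e =
      pd 1 (\<Gamma>\<Gamma> 2 2 1) x - metric_ip (g x) (Gam g x ?f ?f) (Gam g x ?e ?e)
      - (pd 2 (\<Gamma>\<Gamma> 1 2 1) x - metric_ip (g x) (Gam g x ?e ?f) (Gam g x ?f ?e))"
    unfolding riemann_curv_def levi_civita_const metric_ip_diff_left by (simp add: \<Gamma>\<Gamma>_def pd_def)
  have d: "pd i E differentiable (at x)" "pd i F differentiable (at x)" "pd i G differentiable (at x)" for i
    by (rule smooth_on_differentiable[OF smooth_on_pd x], rule smooth_EFG)+
  have sm\<Gamma>: "\<Gamma>\<Gamma> i j k differentiable (at x)" for i j k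
    unfolding \<Gamma>\<Gamma>_def
    by (rule smooth_on_differentiable[OF smooth_on_metric_ip x]) (intro open_S metric_onD(2)[OF metric] smG smooth_on_const)+
  have 1: "pd 1 (\<Gamma>\<Gamma> 2 2 1) x = pd 1 (pd 2 F) x - pd 1 (pd 1 G) x / 2"
    using pd_cong[OF sm\<Gamma> open_S x K(5)] d by (simp add: pd_diff pd_divide pd_const)
  have 2: "pd 2 (\<Gamma>\<Gamma> 1 2 1) x = pd 2 (pd 2 E) x / 2"
    using pd_cong[OF sm\<Gamma> open_S x K(3)] d by (simp add: pd_divide pd_const)
  have ip\<Gamma>: "W x * metric_ip (g x) (Gam g x (axis i 1) (axis j 1)) (Gam g x (axis k 1) (axis l 1)) =
    G x * \<Gamma>\<Gamma> i j 1 x * \<Gamma>\<Gamma> k l 1 x - F x * (\<Gamma>\<Gamma> i j 1 x * \<Gamma>\<Gamma> k l 2 x + \<Gamma>\<Gamma> i j 2 x * \<Gamma>\<Gamma> k l 1 x)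
    + E x * \<Gamma>\<Gamma> i j 2 x * \<Gamma>\<Gamma> k l 2 x" for i j k l
    unfolding \<Gamma>\<Gamma>_def by (rule W_ip[OF x])
  have den: "metric_ip (g x) ?e ?e * metric_ip (g x) ?f ?f - (metric_ip (g x) ?e ?f)\<^sup>2 = W x"
    by (simp add: ip_eq[OF x] W_def axis_def power2_eq_square)
  have "gauss_curv g x * W x = metric_ip (g x) (riemann_curv g x ?e ?f ?f) ?e"
    unfolding gauss_curv_def Let_def den using W_pos[OF x] by simp
  then have "gauss_curv g x * (W x)\<^sup>2 = W x * metric_ip (g x) (riemann_curv g x ?e ?f ?f) ?e"
    by (simp add: power2_eq_square mult_ac)
  also have "\<dots> = W x * (pd 1 (\<Gamma>\<Gamma> 2 2 1) x - pd 2 (\<Gamma>\<Gamma> 1 2 1) x)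
    - W x * metric_ip (g x) (Gam g x ?f ?f) (Gam g x ?e ?e)
    + W x * metric_ip (g x) (Gam g x ?e ?f) (Gam g x ?e ?f)"
    unfolding R by (subst Gam_commute[OF metric x, of ?f ?e]) (simp add: algebra_simps)
  finally show ?thesis
    unfolding ip\<Gamma> K[OF x] 1 2 by (simp add: algebra_simps power2_eq_square)
qed

end

text \<open>In the notation of the header: \<open>\<psi> = p + i q\<close> and \<open>\<tau> = t + i s\<close> satisfy
  \<open>\<psi>\<^sub>y = \<tau> \<psi>\<^sub>x + 2 \<tau>\<^sub>x \<psi>\<close>. The equation for \<open>m = log |\<psi>|\<close> expresses that \<open>d arg \<psi>\<close> is closed.\<close>

lemma log_modulus_equation:
  fixes t s p q :: "real ^ 2 \<Rightarrow> real"
  assumes S: "open S" "x \<in> S" and sm: "smooth_on t S" "smooth_on s S" "smooth_on p S" "smooth_on q S"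
    and pos: "\<And>y. y \<in> S \<Longrightarrow> s y > 0" "\<And>y. y \<in> S \<Longrightarrow> (p y)\<^sup>2 + (q y)\<^sup>2 > 0"
    and cr: "\<And>y. y \<in> S \<Longrightarrow> pd 2 p y = t y * pd 1 p y - s y * pd 1 q y + 2 * (pd 1 t y * p y - pd 1 s y * q y)"
      "\<And>y. y \<in> S \<Longrightarrow> pd 2 q y = t y * pd 1 q y + s y * pd 1 p y + 2 * (pd 1 t y * q y + pd 1 s y * p y)"
    and m_def: "m = (\<lambda>y. ln ((p y)\<^sup>2 + (q y)\<^sup>2) / 2)"
  shows "((t x)\<^sup>2 + (s x)\<^sup>2) * pd 1 (pd 1 m) x - 2 * t x * pd 1 (pd 2 m) x + pd 2 (pd 2 m) x
    + (t x * pd 1 t x + s x * pd 1 s x - pd 2 t x) * pd 1 m x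
    + (s x * pd 1 t x - t x * pd 1 s x + pd 2 s x) * ((t x * pd 1 m x - pd 2 m x + 2 * pd 1 t x) / s x)
    + 2 * t x * pd 1 (pd 1 t) x + 2 * s x * pd 1 (pd 1 s) x - 2 * pd 1 (pd 2 t) x = 0"
    and "smooth_on m S"
proof -
  define \<rho> where "\<rho> = (\<lambda>y. p y * p y + q y * q y)"
  \<comment> \<open>The partial derivatives of arg \<psi>. The argument is only defined locally and
    up to multiples of 2 \<pi>, but these expressions make sense wherever \<psi> \<noteq> 0.\<close>
  define n where "n = (\<lambda>i y. (p y * pd i q y - q y * pd i p y) / \<rho> y)"
  have \<rho>: "\<rho> y > 0" if "y \<in> S" for y using pos(2)[OF that] by (simp add: \<rho>_def power2_eq_square)
  have sm\<rho>: "smooth_on \<rho> S" unfolding \<rho>_def by (intro smooth_on_add smooth_on_mult sm S)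
  have m_eq: "m = (\<lambda>y. ln (\<rho> y) / 2)" by (simp add: m_def \<rho>_def power2_eq_square)
  show smm: "smooth_on m S"
    unfolding m_eq by (intro smooth_on_divide smooth_on_ln smooth_on_const sm\<rho> S \<rho>) auto
  have smn: "smooth_on (n i) S" for i
    unfolding n_def
    by (intro smooth_on_divide smooth_on_diff smooth_on_mult smooth_on_pd sm sm\<rho> S) (use \<rho> in force)
  note diff = smooth_on_differentiable
  have pd\<rho>: "pd i \<rho> y = 2 * (p y * pd i p y + q y * pd i q y)" if y: "y \<in> S" for i y
    unfolding \<rho>_def using diff[OF sm(3) y] diff[OF sm(4) y]
    by (simp add: pd_add pd_mult)
  have mi: "pd i m y = (p y * pd i p y + q y * pd i q y) / \<rho> y" if y: "y \<in> S" for i y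
    unfolding m_eq using \<rho>[OF y] diff[OF sm\<rho> y] diff[OF smooth_on_ln[OF S(1) sm\<rho> \<rho>] y]
    by (simp add: pd_divide pd_const pd_ln pd\<rho>[OF y] field_simps)
  \<comment> \<open>Real and imaginary part of \<psi>_y / \<psi> = \<tau> \<psi>_x / \<psi> + 2
    \<tau>_x, because \<psi>_x / \<psi> has real part \<open>pd 1 m\<close> and imaginary part
    \<open>n 1\<close>, and likewise for y.\<close>
  have 1: "pd 2 m y = t y * pd 1 m y - s y * n 1 y + 2 * pd 1 t y"
    and 2: "n 2 y = t y * n 1 y + s y * pd 1 m y + 2 * pd 1 s y" if y: "y \<in> S" for y
  proof -
    have "\<rho> y \<noteq> 0" using \<rho>[OF y] by simp
    then show "pd 2 m y = t y * pd 1 m y - s y * n 1 y + 2 * pd 1 t y"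
      unfolding mi[OF y] n_def cr[OF y] by (simp add: field_simps) (simp add: \<rho>_def algebra_simps)
    show "n 2 y = t y * n 1 y + s y * pd 1 m y + 2 * pd 1 s y"
      unfolding mi[OF y] n_def cr[OF y] using \<open>\<rho> y \<noteq> 0\<close>
      by (simp add: field_simps) (simp add: \<rho>_def algebra_simps)
  qed
  have closed: "pd 2 (n 1) x = pd 1 (n 2) x"
  proof -
    have d: "p differentiable (at x)" "q differentiable (at x)" "\<rho> differentiable (at x)"
      "pd i p differentiable (at x)" "pd i q differentiable (at x)" for i
      using diff[OF _ S(2)] sm sm\<rho> smooth_on_pd by blast+
    have "\<rho> x \<noteq> 0" using \<rho>[OF S(2)] by simp
    have c: "pd 2 (pd 1 p) x = pd 1 (pd 2 p) x" "pd 2 (pd 1 q) x = pd 1 (pd 2 q) x"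
      by (intro pd_commute[OF _ S] sm)+
    have n': "pd j (n i) x = ((p x * pd j (pd i q) x + pd j p x * pd i q x - (q x * pd j (pd i p) x + pd j q x * pd i p x)) * \<rho> x
        - (p x * pd i q x - q x * pd i p x) * pd j \<rho> x) / (\<rho> x * \<rho> x)" for i j
      unfolding n_def using d \<open>\<rho> x \<noteq> 0\<close> by (simp add: pd_divide pd_diff pd_mult)
    show ?thesis
      unfolding n' c pd\<rho>[OF S(2)] by (rule arg_cong2[where f = divide]) (simp_all add: \<rho>_def algebra_simps)
  qed
  have d: "t differentiable (at x)" "s differentiable (at x)" "n i differentiable (at x)"
    "pd i m differentiable (at x)" "pd i t differentiable (at x)" "pd i s differentiable (at x)" for i
    using diff[OF _ S(2)] sm smm smn smooth_on_pd by blast+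
  have D1: "pd i (pd 2 m) x = pd i t x * pd 1 m x + t x * pd i (pd 1 m) x - pd i s x * n 1 x - s x * pd i (n 1) x
      + 2 * pd i (pd 1 t) x" for i
    using pd_cong[OF d(4) S 1] d by (simp add: pd_add pd_diff pd_mult pd_const)
  have D2: "pd 1 (n 2) x = pd 1 t x * n 1 x + t x * pd 1 (n 1) x + pd 1 s x * pd 1 m x + s x * pd 1 (pd 1 m) x
      + 2 * pd 1 (pd 1 s) x"
    using pd_cong[OF d(3) S 2] d by (simp add: pd_add pd_diff pd_mult pd_const)
  have c: "pd 2 (pd 1 m) x = pd 1 (pd 2 m) x" "pd 2 (pd 1 t) x = pd 1 (pd 2 t) x"
    by (intro pd_commute[OF _ S] sm smm)+
  have "s x > 0" by (rule pos(1)[OF S(2)])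
  then have n1: "(t x * pd 1 m x - pd 2 m x + 2 * pd 1 t x) / s x = n 1 x"
    using 1[OF S(2)] by (simp add: field_simps)
  \<comment> \<open>Both derivatives of \<open>n 1\<close> are expressed through \<open>m\<close> by
    differentiating the first relation, that of \<open>n 2\<close> by differentiating the second.
    Closedness combines them, and \<open>n 1\<close> itself is again given by the first relation, so
    an equation for \<open>m\<close> alone remains.\<close>
  have "s x * pd 2 (n 1) x = pd 2 t x * pd 1 m x + t x * pd 1 (pd 2 m) x - pd 2 s x * n 1 x - pd 2 (pd 2 m) x + 2 * pd 1 (pd 2 t) x"
    using D1[of 2] unfolding c by linarith
  moreover have "s x * pd 1 (n 1) x = pd 1 t x * pd 1 m x + t x * pd 1 (pd 1 m) x - pd 1 s x * n 1 x - pd 1 (pd 2 m) x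
      + 2 * pd 1 (pd 1 t) x"
    using D1[of 1] by linarith
  moreover have "s x * pd 2 (n 1) x = s x * (pd 1 t x * n 1 x + pd 1 s x * pd 1 m x + s x * pd 1 (pd 1 m) x + 2 * pd 1 (pd 1 s) x)
     + t x * (s x * pd 1 (n 1) x)"
    unfolding closed D2 by (simp add: algebra_simps)
  ultimately show "((t x)\<^sup>2 + (s x)\<^sup>2) * pd 1 (pd 1 m) x - 2 * t x * pd 1 (pd 2 m) x + pd 2 (pd 2 m) x
    + (t x * pd 1 t x + s x * pd 1 s x - pd 2 t x) * pd 1 m x
    + (s x * pd 1 t x - t x * pd 1 s x + pd 2 s x) * ((t x * pd 1 m x - pd 2 m x + 2 * pd 1 t x) / s x)
    + 2 * t x * pd 1 (pd 1 t) x + 2 * s x * pd 1 (pd 1 s) x - 2 * pd 1 (pd 2 t) x = 0"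
    unfolding n1 by (simp add: algebra_simps power2_eq_square)
qed

text \<open>Brioschi's formula with F = E t, G = E (t^2 + s^2) and W = E^2 s^2, as an identity
  between numbers: digits in a name are directions of differentiation, and \<open>l\<close> stands
  for log E. The right-hand side consists of the source terms of the equation for log |\<psi>| and
  of its differential operator applied to log E, both with a minus sign; \<open>B\<close> is the
  coefficient (s t_1 - t s_1 + s_2) / s.\<close>

lemma bochner_algebra:
  fixes E t s :: real
  assumes ne: "E \<noteq> 0" "s \<noteq> 0"
    and K: "K * (E\<^sup>2 * s\<^sup>2)\<^sup>2 = E\<^sup>2 * s\<^sup>2 * (F12 - G11 / 2 - E22 / 2)
      - (E * (t\<^sup>2 + s\<^sup>2) * (F2 - G1 / 2) * (E1 / 2)
        - E * t * ((F2 - G1 / 2) * (F1 - E2 / 2) + (G2 / 2) * (E1 / 2))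
        + E * (G2 / 2) * (F1 - E2 / 2))
      + (E * (t\<^sup>2 + s\<^sup>2) * (E2 / 2)\<^sup>2 - 2 * (E * t) * (E2 / 2) * (G1 / 2) + E * (G1 / 2)\<^sup>2)"
    and F: "F1 = E1 * t + E * t1" "F2 = E2 * t + E * t2" "F12 = E12 * t + E2 * t1 + E1 * t2 + E * t12"
    and G: "G1 = E1 * (t\<^sup>2 + s\<^sup>2) + E * (2 * t * t1 + 2 * s * s1)"
      "G2 = E2 * (t\<^sup>2 + s\<^sup>2) + E * (2 * t * t2 + 2 * s * s2)"
      "G11 = E11 * (t\<^sup>2 + s\<^sup>2) + 2 * E1 * (2 * t * t1 + 2 * s * s1)
        + E * (2 * t1\<^sup>2 + 2 * t * t11 + 2 * s1\<^sup>2 + 2 * s * s11)"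
    and E: "E1 = E * l1" "E2 = E * l2" "E11 = E * (l11 + l1 * l1)" "E12 = E * (l12 + l1 * l2)" "E22 = E * (l22 + l2 * l2)"
    and s2: "s2 = s * B - s * t1 + t * s1"
  shows "2 * E * s\<^sup>2 * K = - (2 * B * t1 + 2 * t * t11 + 2 * s * s11 - 2 * t12)
    - ((t\<^sup>2 + s\<^sup>2) * l11 - 2 * t * l12 + l22 + (t * t1 + s * s1 - t2 + B * t) * l1 - B * l2)"
proof -
  \<comment> \<open>The factor E^3 s^2 completes the left-hand side to twice that of Brioschi's
    formula.\<close>
  have "(E ^ 3 * s\<^sup>2) * (2 * E * s\<^sup>2 * K) = 2 * (K * (E\<^sup>2 * s\<^sup>2)\<^sup>2)"
    by algebra
  also have "\<dots> = (E ^ 3 * s\<^sup>2) * (- (2 * B * t1 + 2 * t * t11 + 2 * s * s11 - 2 * t12)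
    - ((t\<^sup>2 + s\<^sup>2) * l11 - 2 * t * l12 + l22 + (t * t1 + s * s1 - t2 + B * t) * l1 - B * l2))"
    unfolding K F G E s2 by (simp add: field_simps) algebra
  finally show ?thesis using ne by (simp del: mult_minus_right)
qed

section \<open>Trace-free Codazzi tensors in the plane\<close>

lemma (in plane_metric) traceless_derivative:
  assumes sm: "smooth_on a S" "smooth_on b S" "smooth_on c S"
    and traceless: "\<And>x. x \<in> S \<Longrightarrow> G x * a x - 2 * F x * b x + E x * c x = 0" and x: "x \<in> S"
  shows "G x * (pd i a x - 2 * (\<Gamma> 1 i 1 x * a x + \<Gamma> 2 i 1 x * b x))
    - 2 * F x * (pd i b x - (\<Gamma> 1 i 1 x * b x + \<Gamma> 2 i 1 x * c x) - (\<Gamma> 1 i 2 x * a x + \<Gamma> 2 i 2 x * b x))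
    + E x * (pd i c x - 2 * (\<Gamma> 1 i 2 x * b x + \<Gamma> 2 i 2 x * c x)) = 0" (is "?L = 0")
proof -
  have d: "E differentiable (at x)" "F differentiable (at x)" "G differentiable (at x)"
    "a differentiable (at x)" "b differentiable (at x)" "c differentiable (at x)"
    by (auto intro: smooth_on_differentiable[OF _ x] smooth_EFG sm)
  have "pd i (\<lambda>y. G y * a y - 2 * F y * b y + E y * c y) x = pd i (\<lambda>_. 0) x"
    using smooth_EFG sm
    by (intro pd_cong[OF smooth_on_differentiable[OF _ x] open_S x traceless])
      (auto intro!: smooth_on_add smooth_on_diff smooth_on_mult smooth_on_const open_S)
  then have "pd i G x * a x + G x * pd i a x - 2 * (pd i F x * b x + F x * pd i b x) + (pd i E x * c x + E x * pd i c x) = 0"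
    using d by (simp add: pd_add pd_diff pd_mult pd_const algebra_simps)
  \<comment> \<open>The hypothesis is about \<open>W\<close> times the trace. Differentiating
    \<open>W\<close> contributes the trace of the Christoffel symbols, since the i-th derivative of
    log W is twice that trace; what remains is the trace of the covariant derivative.\<close>
  moreover have "?L = pd i G x * a x + G x * pd i a x - 2 * (pd i F x * b x + F x * pd i b x) + (pd i E x * c x + E x * pd i c x)
      - 2 * (\<Gamma> 1 i 1 x + \<Gamma> 2 i 2 x) * (G x * a x - 2 * F x * b x + E x * c x)"
    unfolding pd_E[OF x] pd_F[OF x] pd_G[OF x] by (simp add: algebra_simps)
  ultimately show ?thesis using traceless[OF x] by simp
qed

text \<open>\<open>a\<close>, \<open>b\<close>, \<open>c\<close> are the components \<open>(1,1)\<close>, \<open>(1,2)\<close>, \<open>(2,2)\<close> of a symmetric form; below,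
  \<open>\<psi> = a + i q\<close>, \<open>\<tau> = t + i s\<close> and \<open>u = |\<psi>|\<^sub>g\<^sup>2\<close>.\<close>

locale traceless_codazzi = plane_metric +
  fixes a b c :: "real ^ 2 \<Rightarrow> real"
  assumes smooth_abc: "smooth_on a S" "smooth_on b S" "smooth_on c S"
    and traceless: "x \<in> S \<Longrightarrow> G x * a x - 2 * F x * b x + E x * c x = 0"
    and codazzi1: "x \<in> S \<Longrightarrow> pd 2 a x - pd 1 b x = \<Gamma> 1 1 2 x * a x + \<Gamma> 2 1 2 x * b x - \<Gamma> 1 1 1 x * b x - \<Gamma> 2 1 1 x * c x"
    and codazzi2: "x \<in> S \<Longrightarrow> pd 2 b x - pd 1 c x = \<Gamma> 1 2 2 x * a x + \<Gamma> 2 2 2 x * b x - \<Gamma> 1 1 2 x * b x - \<Gamma> 2 1 2 x * c x"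
begin

text \<open>Minus the determinant of the form relative to \<open>g\<close>, hence the square of
  either of its two opposite eigenvalues.\<close>

definition "u x = (b x * b x - a x * c x) / W x"
definition "t x = F x / E x"
definition "s x = sqrt (W x) / E x"
definition "q x = (t x * a x - b x) / s x"

lemma s_pos: "x \<in> S \<Longrightarrow> s x > 0"
  using E_pos W_pos by (simp add: s_def)

lemma F_eq: "x \<in> S \<Longrightarrow> F x = E x * t x"
  using E_pos[of x] by (simp add: t_def)

lemma W_eq: "x \<in> S \<Longrightarrow> W x = (E x)\<^sup>2 * (s x)\<^sup>2"
  using E_pos[of x] W_pos[of x] by (simp add: s_def power_divide)

lemma G_eq: assumes x: "x \<in> S" shows "G x = E x * ((t x)\<^sup>2 + (s x)\<^sup>2)"
proof -
  have "E x * G x = (E x)\<^sup>2 * (s x)\<^sup>2 + (E x * t x)\<^sup>2"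
    using W_eq[OF x] by (simp add: W_def F_eq[OF x] power2_eq_square)
  then have "E x * G x = E x * (E x * ((t x)\<^sup>2 + (s x)\<^sup>2))" by (simp add: algebra_simps power2_eq_square)
  then show ?thesis using E_pos[OF x] by simp
qed

text \<open>Together with \<open>c_eq\<close> this identifies the form as Re(\<psi> \<theta>^2): its
  components are Re \<psi>, Re(\<tau> \<psi>) and Re(\<tau>^2 \<psi>), the last one forced by the
  trace condition.\<close>

lemma b_eq: "x \<in> S \<Longrightarrow> b x = a x * t x - q x * s x"
  using s_pos[of x] by (simp add: q_def)

lemma c_eq: assumes x: "x \<in> S" shows "c x = a x * ((t x)\<^sup>2 - (s x)\<^sup>2) - 2 * q x * t x * s x"
proof -
  have "E x * c x = E x * (a x * ((t x)\<^sup>2 - (s x)\<^sup>2) - 2 * q x * t x * s x)"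
    using traceless[OF x] unfolding F_eq[OF x] G_eq[OF x] b_eq[OF x]
    by (simp add: algebra_simps power2_eq_square)
  then show ?thesis using E_pos[OF x] by simp
qed

lemma u_eq: assumes x: "x \<in> S" shows "u x = ((a x)\<^sup>2 + (q x)\<^sup>2) / (E x)\<^sup>2"
proof -
  have "b x * b x - a x * c x = ((a x)\<^sup>2 + (q x)\<^sup>2) * (s x)\<^sup>2"
    unfolding b_eq[OF x] c_eq[OF x] by (simp add: algebra_simps power2_eq_square)
  then show ?thesis using s_pos[OF x] by (simp add: u_def W_eq[OF x])
qed

lemma smooth_s: "smooth_on s S"
  unfolding s_def[abs_def] by (intro smooth_on_divide smooth_on_sqrt smooth_W smooth_EFG open_S W_pos)
    (auto dest: E_pos)

lemma smooth_t: "smooth_on t S"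
  unfolding t_def[abs_def] by (intro smooth_on_divide smooth_EFG open_S) (use E_pos in force)

lemma smooth_q: "smooth_on q S"
  unfolding q_def[abs_def] by (intro smooth_on_divide smooth_on_diff smooth_on_mult smooth_s smooth_t smooth_abc open_S)
    (use s_pos in force)

lemma smooth_u: "smooth_on u S"
  unfolding u_def[abs_def] by (intro smooth_on_divide smooth_on_diff smooth_on_mult smooth_abc smooth_W open_S)
    (use W_pos in force)

lemmas smooths = smooth_EFG(1) smooth_s smooth_t smooth_q smooth_abc(1)

context
  fixes x assumes x: "x \<in> S"
begin

lemma differentiable_components: "E differentiable (at x)" "s differentiable (at x)" "t differentiable (at x)"
  "q differentiable (at x)" "a differentiable (at x)"
  "pd i E differentiable (at x)" "pd i s differentiable (at x)" "pd i t differentiable (at x)"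
  by (auto intro: smooth_on_differentiable[OF _ x] smooths smooth_on_pd)

lemma differentiable_squares: "(\<lambda>y. t y * t y + s y * s y) differentiable (at x)" "(\<lambda>y. t y * t y - s y * s y) differentiable (at x)"
  by (intro smooth_on_differentiable[OF _ x] smooth_on_add smooth_on_diff smooth_on_mult smooths open_S)+

private lemmas d = differentiable_components and sm_prods = differentiable_squares

lemma pd_F_eq: "pd i F x = pd i E x * t x + E x * pd i t x"
  using pd_cong[OF smooth_on_differentiable[OF smooth_EFG(2) x] open_S x F_eq, of i] d by (simp add: pd_mult)

lemma pd_G_eq: "pd i G x = pd i E x * ((t x)\<^sup>2 + (s x)\<^sup>2) + E x * (2 * t x * pd i t x + 2 * s x * pd i s x)"
  using pd_cong[OF smooth_on_differentiable[OF smooth_EFG(3) x] open_S x G_eq, of i] d sm_prods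
  by (simp add: pd_mult pd_add power2_eq_square)

lemma pd_b_eq: "pd i b x = pd i a x * t x + a x * pd i t x - pd i q x * s x - q x * pd i s x"
  using pd_cong[OF smooth_on_differentiable[OF smooth_abc(2) x] open_S x b_eq, of i] d
  by (simp add: pd_mult pd_diff)

lemma pd_c_eq: "pd i c x = pd i a x * ((t x)\<^sup>2 - (s x)\<^sup>2) + a x * (2 * t x * pd i t x - 2 * s x * pd i s x)
    - 2 * (pd i q x * t x * s x + q x * pd i t x * s x + q x * t x * pd i s x)"
  using pd_cong[OF smooth_on_differentiable[OF smooth_abc(3) x] open_S x c_eq, of i] d sm_prods
  by (simp add: pd_mult pd_diff pd_const power2_eq_square) (simp add: algebra_simps)

text \<open>For each pair of lower indices the derivatives of E, F, G give a 2 x 2 linear system in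
  the Christoffel symbols. These are its solutions, with the factors E s^2 and E kept on the
  left.\<close>

private lemma \<Gamma>2:
  "E x * (s x)\<^sup>2 * \<Gamma> 2 1 1 x = E x * pd 1 t x + pd 1 E x * t x / 2 - pd 2 E x / 2"
  "E x * (s x)\<^sup>2 * \<Gamma> 2 1 2 x = (pd 1 E x * ((t x)\<^sup>2 + (s x)\<^sup>2) - t x * pd 2 E x) / 2 + E x * (t x * pd 1 t x + s x * pd 1 s x)"
  "E x * (s x)\<^sup>2 * \<Gamma> 2 2 2 x = pd 2 G x / 2 - t x * (pd 2 F x - pd 1 G x / 2)"
  and \<Gamma>1:
  "E x * \<Gamma> 1 1 1 x = pd 1 E x / 2 - t x * (E x * \<Gamma> 2 1 1 x)"
  "E x * \<Gamma> 1 1 2 x = pd 2 E x / 2 - t x * (E x * \<Gamma> 2 1 2 x)"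
  "E x * \<Gamma> 1 2 2 x = pd 2 F x - pd 1 G x / 2 - t x * (E x * \<Gamma> 2 2 2 x)"
proof -
  note k = pd_E[OF x, of 1] pd_E[OF x, of 2] pd_F[OF x, of 1] pd_F[OF x, of 2] pd_G[OF x, of 1] pd_G[OF x, of 2]
    \<Gamma>_commute[OF x, of 1 2 1] \<Gamma>_commute[OF x, of 2 2 1]
  show "E x * \<Gamma> 1 1 1 x = pd 1 E x / 2 - t x * (E x * \<Gamma> 2 1 1 x)"
    "E x * \<Gamma> 1 1 2 x = pd 2 E x / 2 - t x * (E x * \<Gamma> 2 1 2 x)"
    "E x * \<Gamma> 1 2 2 x = pd 2 F x - pd 1 G x / 2 - t x * (E x * \<Gamma> 2 2 2 x)"
    using k by (simp_all add: F_eq[OF x] algebra_simps)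
  show "E x * (s x)\<^sup>2 * \<Gamma> 2 1 1 x = E x * pd 1 t x + pd 1 E x * t x / 2 - pd 2 E x / 2"
    using k(1,2,3,7,8) pd_F_eq[of 1] by (simp add: F_eq[OF x] G_eq[OF x]) algebra
  show "E x * (s x)\<^sup>2 * \<Gamma> 2 1 2 x = (pd 1 E x * ((t x)\<^sup>2 + (s x)\<^sup>2) - t x * pd 2 E x) / 2 + E x * (t x * pd 1 t x + s x * pd 1 s x)"
    using k(2,5,7,8) pd_G_eq[of 1] by (simp add: F_eq[OF x] G_eq[OF x]) algebra
  show "E x * (s x)\<^sup>2 * \<Gamma> 2 2 2 x = pd 2 G x / 2 - t x * (pd 2 F x - pd 1 G x / 2)"
    unfolding k F_eq[OF x] G_eq[OF x] by (simp add: field_simps power2_eq_square)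
qed

text \<open>In complex terms the two expressions are Re(\<tau>_x \<psi>) and Re(\<tau>_y \<psi>).
  All derivatives of the factor E cancel, which reflects the conformal invariance of the Codazzi
  condition on trace-free forms.\<close>

private lemma connection_terms:
  "\<Gamma> 1 1 2 x * a x + \<Gamma> 2 1 2 x * b x - \<Gamma> 1 1 1 x * b x - \<Gamma> 2 1 1 x * c x = pd 1 t x * a x - pd 1 s x * q x"
  "\<Gamma> 1 2 2 x * a x + \<Gamma> 2 2 2 x * b x - \<Gamma> 1 1 2 x * b x - \<Gamma> 2 1 2 x * c x = pd 2 t x * a x - pd 2 s x * q x"
proof -
  have ne: "E x * (s x)\<^sup>2 \<noteq> 0" using E_pos[OF x] s_pos[OF x] by simp
  have 1: "E x * (s x)\<^sup>2 * \<Gamma> 1 i j x = (s x)\<^sup>2 * (E x * \<Gamma> 1 i j x)" "(s x)\<^sup>2 * (r - t x * (E x * \<Gamma> 2 i j x)) =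
    (s x)\<^sup>2 * r - t x * (E x * (s x)\<^sup>2 * \<Gamma> 2 i j x)" for i j r by (simp_all add: algebra_simps)
  have "E x * (s x)\<^sup>2 * (\<Gamma> 1 1 2 x * a x + \<Gamma> 2 1 2 x * b x - \<Gamma> 1 1 1 x * b x - \<Gamma> 2 1 1 x * c x) =
    (E x * (s x)\<^sup>2 * \<Gamma> 1 1 2 x) * a x + (E x * (s x)\<^sup>2 * \<Gamma> 2 1 2 x) * b x
    - (E x * (s x)\<^sup>2 * \<Gamma> 1 1 1 x) * b x - (E x * (s x)\<^sup>2 * \<Gamma> 2 1 1 x) * c x"
    by (simp add: algebra_simps)
  also have "\<dots> = E x * (s x)\<^sup>2 * (pd 1 t x * a x - pd 1 s x * q x)"
    unfolding 1 \<Gamma>1 \<Gamma>2 b_eq[OF x] c_eq[OF x] by (simp add: field_simps) algebra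
  finally show "\<Gamma> 1 1 2 x * a x + \<Gamma> 2 1 2 x * b x - \<Gamma> 1 1 1 x * b x - \<Gamma> 2 1 1 x * c x = pd 1 t x * a x - pd 1 s x * q x"
    using ne by (metis mult_left_cancel)
  have "E x * (s x)\<^sup>2 * (\<Gamma> 1 2 2 x * a x + \<Gamma> 2 2 2 x * b x - \<Gamma> 1 1 2 x * b x - \<Gamma> 2 1 2 x * c x) =
    (E x * (s x)\<^sup>2 * \<Gamma> 1 2 2 x) * a x + (E x * (s x)\<^sup>2 * \<Gamma> 2 2 2 x) * b x
    - (E x * (s x)\<^sup>2 * \<Gamma> 1 1 2 x) * b x - (E x * (s x)\<^sup>2 * \<Gamma> 2 1 2 x) * c x"
    by (simp add: algebra_simps)
  also have "\<dots> = E x * (s x)\<^sup>2 * (pd 2 t x * a x - pd 2 s x * q x)"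
    unfolding 1 \<Gamma>1 \<Gamma>2 b_eq[OF x] c_eq[OF x] pd_F_eq pd_G_eq by (simp add: field_simps) algebra
  finally show "\<Gamma> 1 2 2 x * a x + \<Gamma> 2 2 2 x * b x - \<Gamma> 1 1 2 x * b x - \<Gamma> 2 1 2 x * c x = pd 2 t x * a x - pd 2 s x * q x"
    using ne by (metis mult_left_cancel)
qed

text \<open>Put D = \<psi>_y - \<tau> \<psi>_x - 2 \<tau>_x \<psi>. The first Codazzi equation is Re
  D = 0, the second is Re(\<tau> D) = 0; as Im \<tau> = s > 0, it follows that D = 0.\<close>

lemma cauchy_riemann:
  "pd 2 a x = t x * pd 1 a x - s x * pd 1 q x + 2 * (pd 1 t x * a x - pd 1 s x * q x)"
  "pd 2 q x = t x * pd 1 q x + s x * pd 1 a x + 2 * (pd 1 t x * q x + pd 1 s x * a x)"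
proof -
  show 1: "pd 2 a x = t x * pd 1 a x - s x * pd 1 q x + 2 * (pd 1 t x * a x - pd 1 s x * q x)"
    using codazzi1[OF x] unfolding connection_terms pd_b_eq by (simp add: algebra_simps)
  have "s x * pd 2 q x = s x * (t x * pd 1 q x + s x * pd 1 a x + 2 * (pd 1 t x * q x + pd 1 s x * a x))"
    using codazzi2[OF x] unfolding connection_terms pd_b_eq pd_c_eq 1 by (simp add: algebra_simps power2_eq_square)
  then show "pd 2 q x = t x * pd 1 q x + s x * pd 1 a x + 2 * (pd 1 t x * q x + pd 1 s x * a x)"
    using s_pos[OF x] by simp
qed

end

definition "v x = ln (u x) / 2"

text \<open>Up to first-order terms, and after multiplication by \<open>E s\<^sup>2\<close>, this is the Bochner formula
  \<open>\<Delta> log |\<psi>|\<^sub>g = 2 K\<close>.\<close>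

lemma bochner:
  assumes pos: "\<And>y. y \<in> S \<Longrightarrow> u y > 0" and x: "x \<in> S"
  defines "A \<equiv> s x * pd 1 t x - t x * pd 1 s x + pd 2 s x"
  shows "((t x)\<^sup>2 + (s x)\<^sup>2) * pd 1 (pd 1 v) x + 2 * (- t x) * pd 1 (pd 2 v) x + 1 * pd 2 (pd 2 v) x
    + (t x * pd 1 t x + s x * pd 1 s x - pd 2 t x + A * t x / s x) * pd 1 v x + (- A / s x) * pd 2 v x
    = 2 * E x * (s x)\<^sup>2 * gauss_curv g x"
proof -
  define m where "m = (\<lambda>y. ln ((a y)\<^sup>2 + (q y)\<^sup>2) / 2)"
  have apos: "(a y)\<^sup>2 + (q y)\<^sup>2 > 0" if "y \<in> S" for y
    using pos[OF that] E_pos[OF that] unfolding u_eq[OF that] by (simp add: zero_less_divide_iff)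
  note log = log_modulus_equation[OF open_S x smooth_t smooth_s smooth_abc(1) smooth_q s_pos apos cauchy_riemann m_def]
  note E0 = E_pos[OF x] and s0 = s_pos[OF x]
  have smv: "smooth_on v S"
    unfolding v_def[abs_def] by (intro smooth_on_divide smooth_on_ln smooth_u smooth_on_const open_S pos) auto
  have "ln (X / e\<^sup>2) / 2 = ln X / 2 - ln e" if "X > 0" "e > 0" for X e :: real
    using that by (simp add: ln_div ln_realpow diff_divide_distrib)
  \<comment> \<open>Since u = |\<psi>|^2 / E^2, the function \<open>v\<close> differs from log
    |\<psi>| by log E.\<close>
  then have v_eq: "v y = m y - ln (E y)" if "y \<in> S" for y
    using apos[OF that] E_pos[OF that] by (simp add: v_def m_def u_eq[OF that])
  have smlnE: "smooth_on (\<lambda>y. ln (E y)) S"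
    by (intro smooth_on_ln smooth_EFG open_S E_pos)
  note diff = smooth_on_differentiable
  have v1: "pd i v y = pd i m y - pd i E y / E y" if y: "y \<in> S" for i y
    using pd_cong[OF diff[OF smv y] open_S y v_eq, of i] diff[OF log(2) y] diff[OF smlnE y] diff[OF smooth_EFG(1) y] E_pos[OF y]
    by (simp add: pd_diff pd_ln)
  have v2: "pd j (pd i v) x = pd j (pd i m) x - (pd j (pd i E) x / E x - pd i E x * pd j E x / (E x * E x))" for i j
  proof -
    have "(\<lambda>y. pd i E y / E y) differentiable (at x)"
      by (rule smooth_on_differentiable[OF smooth_on_divide x])
        (auto intro: open_S smooth_on_pd smooth_EFG dest: E_pos)
    then show ?thesis
      using pd_cong[OF diff[OF smooth_on_pd[OF smv] x] open_S x v1, of j i] diff[OF smooth_on_pd[OF log(2)] x]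
        diff[OF smooth_EFG(1) x] diff[OF smooth_on_pd[OF smooth_EFG(1)] x] E0
      by (simp add: pd_diff pd_divide diff_divide_distrib)
  qed
  note d = differentiable_components[OF x] differentiable_squares[OF x]
  have F12: "pd 1 (pd 2 F) x = pd 1 (pd 2 E) x * t x + pd 2 E x * pd 1 t x + pd 1 E x * pd 2 t x + E x * pd 1 (pd 2 t) x"
    using pd_cong[OF diff[OF smooth_on_pd[OF smooth_EFG(2)] x] open_S x pd_F_eq, of 1 2] d
    by (simp add: pd_add pd_mult)
  have G11: "pd 1 (pd 1 G) x = pd 1 (pd 1 E) x * ((t x)\<^sup>2 + (s x)\<^sup>2)
    + 2 * pd 1 E x * (2 * t x * pd 1 t x + 2 * s x * pd 1 s x)
    + E x * (2 * (pd 1 t x)\<^sup>2 + 2 * t x * pd 1 (pd 1 t) x + 2 * (pd 1 s x)\<^sup>2 + 2 * s x * pd 1 (pd 1 s) x)"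
    using pd_cong[OF diff[OF smooth_on_pd[OF smooth_EFG(3)] x] open_S x pd_G_eq, of 1 1] d
    by (simp add: pd_add pd_mult pd_const power2_eq_square) (simp add: algebra_simps)
  define B where "B = A / s x"
  \<comment> \<open>\<open>l\<close> and \<open>ll\<close> are the first and second derivatives of
    log E.\<close>
  define l where "l = (\<lambda>i. pd i E x / E x)"
  define ll where "ll = (\<lambda>i j. pd i (pd j E) x / E x - pd j E x * pd i E x / (E x * E x))"
  have E: "pd i E x = E x * l i" for i using E0 by (simp add: l_def)
  have EE: "pd i (pd j E) x = E x * (ll i j + l i * l j)" for i j
    using E0 by (simp add: l_def ll_def mult.commute)
  have s2: "pd 2 s x = s x * B - s x * pd 1 t x + t x * pd 1 s x"
    using s0 by (simp add: B_def A_def)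
  have K: "2 * E x * (s x)\<^sup>2 * gauss_curv g x =
      - (2 * B * pd 1 t x + 2 * t x * pd 1 (pd 1 t) x + 2 * s x * pd 1 (pd 1 s) x - 2 * pd 1 (pd 2 t) x)
      - (((t x)\<^sup>2 + (s x)\<^sup>2) * ll 1 1 - 2 * t x * ll 1 2 + ll 2 2
        + (t x * pd 1 t x + s x * pd 1 s x - pd 2 t x + B * t x) * l 1 - B * l 2)"
    by (rule bochner_algebra[OF _ _ brioschi[OF x, unfolded W_eq[OF x] F_eq[OF x] G_eq[OF x]] pd_F_eq[OF x] pd_F_eq[OF x] F12 pd_G_eq[OF x] pd_G_eq[OF x] G11 E E EE EE EE s2])
      (use E0 s0 in auto)
  have "A * ((t x * pd 1 m x - pd 2 m x + 2 * pd 1 t x) / s x) = B * (t x * pd 1 m x - pd 2 m x + 2 * pd 1 t x)"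
    by (simp add: B_def)
  note log1 = log(1)[folded A_def, unfolded this]
  have A: "A * t x / s x = B * t x" "- A / s x = - B" by (simp_all add: B_def)
  have V: "pd i v x = pd i m x - l i" "pd j (pd i v) x = pd j (pd i m) x - ll j i" for i j
    unfolding v1[OF x] v2 l_def ll_def by simp_all
  show ?thesis
    unfolding K A V using log1 by (simp add: algebra_simps)
qed

lemma smooth_v: "(\<And>y. y \<in> S \<Longrightarrow> u y > 0) \<Longrightarrow> smooth_on v S"
  unfolding v_def[abs_def] by (intro smooth_on_divide smooth_on_ln smooth_u smooth_on_const open_S) auto

text \<open>A constant norm makes the differential side of the Bochner formula vanish, and the
  curvature carries the positive factor 2 E s^2.\<close>

lemma flat_of_constant:
  assumes "M > 0" and u: "\<And>y. y \<in> S \<Longrightarrow> u y = M" and x: "x \<in> S"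
  shows "gauss_curv g x = 0"
proof -
  have pos: "u y > 0" if "y \<in> S" for y using u[OF that] assms(1) by simp
  note sm = smooth_v[OF pos]
  have 1: "pd i v y = 0" if y: "y \<in> S" for i y
    using pd_cong[OF smooth_on_differentiable[OF sm y] open_S y, of "\<lambda>_. ln M / 2" i] u
    by (simp add: v_def pd_const)
  have "pd j (pd i v) x = 0" for i j
    using pd_cong[OF smooth_on_differentiable[OF smooth_on_pd[OF sm] x] open_S x 1, of j i]
    by (simp add: pd_const)
  with bochner[OF pos x] 1[OF x] have "2 * E x * (s x)\<^sup>2 * gauss_curv g x = 0" by simp
  then show ?thesis using E_pos[OF x] s_pos[OF x] by simp
qed

text \<open>By the Bochner formula and K \<ge> 0, \<open>v\<close> is a subsolution; the operator is
  elliptic, its determinant being (t^2 + s^2) - t^2 = s^2. As \<open>v\<close> is an increasing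
  function of \<open>u\<close>, both have the same maxima.\<close>

lemma constant_near_max:
  assumes pos: "\<And>y. y \<in> S \<Longrightarrow> u y > 0" and K: "\<And>y. y \<in> S \<Longrightarrow> gauss_curv g y \<ge> 0"
    and x: "x \<in> S" and max: "\<And>y. y \<in> S \<Longrightarrow> u y \<le> u x"
  shows "\<exists>e>0. \<forall>y\<in>ball x e. u y = u x"
proof -
  define A where "A = (\<lambda>x. s x * pd 1 t x - t x * pd 1 s x + pd 2 s x)"
  note cont = smooth_on_imp_continuous_on[OF smooth_t] smooth_on_imp_continuous_on[OF smooth_s]
    smooth_on_imp_continuous_on[OF smooth_on_pd[OF smooth_t]] smooth_on_imp_continuous_on[OF smooth_on_pd[OF smooth_s]]
  have s0: "\<forall>x\<in>S. s x \<noteq> 0" using s_pos by force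
  have contA: "continuous_on S A" unfolding A_def by (intro continuous_intros cont)
  have contb: "continuous_on S (\<lambda>x. (t x)\<^sup>2 + (s x)\<^sup>2)" "continuous_on S (\<lambda>x. - t x)" "continuous_on S (\<lambda>x. - A x / s x)"
    "continuous_on S (\<lambda>x. t x * pd 1 t x + s x * pd 1 s x - pd 2 t x + A x * t x / s x)"
    by (intro continuous_intros cont contA s0)+
  have "\<exists>e>0. \<forall>y\<in>ball x e. v y = v x"
  proof (rule strong_maximum_principle[OF open_S smooth_v[OF pos], where
        A = "\<lambda>x. (t x)\<^sup>2 + (s x)\<^sup>2" and B = "\<lambda>x. - t x" and C = "\<lambda>x. 1" and
        ?b1.0 = "\<lambda>x. t x * pd 1 t x + s x * pd 1 s x - pd 2 t x + A x * t x / s x" and ?b2.0 = "\<lambda>x. - A x / s x"])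
    fix y assume y: "y \<in> S"
    have "((t y)\<^sup>2 + (s y)\<^sup>2) * pd 1 (pd 1 v) y + 2 * (- t y) * pd 1 (pd 2 v) y + 1 * pd 2 (pd 2 v) y
      + (t y * pd 1 t y + s y * pd 1 s y - pd 2 t y + A y * t y / s y) * pd 1 v y + (- A y / s y) * pd 2 v y
      = 2 * E y * (s y)\<^sup>2 * gauss_curv g y"
      unfolding A_def by (rule bochner[OF _ y]) (rule pos)
    moreover have "2 * E y * (s y)\<^sup>2 * gauss_curv g y \<ge> 0"
      using K[OF y] E_pos[OF y] by (intro mult_nonneg_nonneg) auto
    ultimately show "((t y)\<^sup>2 + (s y)\<^sup>2) * pd 1 (pd 1 v) y + 2 * (- t y) * pd 1 (pd 2 v) y + 1 * pd 2 (pd 2 v) y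
      + (t y * pd 1 t y + s y * pd 1 s y - pd 2 t y + A y * t y / s y) * pd 1 v y + (- A y / s y) * pd 2 v y \<ge> 0"
      by (simp only:)
    show "v y \<le> v x" using max[OF y] pos[OF y] by (simp add: v_def)
    show "(t y)\<^sup>2 + (s y)\<^sup>2 > 0" using s_pos[OF y] by (intro add_nonneg_pos) auto
    show "((t y)\<^sup>2 + (s y)\<^sup>2) * 1 - (- t y)\<^sup>2 > 0" using s_pos[OF y] by simp
  qed (rule contb x refl continuous_on_const | assumption)+
  then obtain e where e: "e > 0" "\<And>y. y \<in> ball x e \<Longrightarrow> v y = v x" by blast
  obtain d where d: "d > 0" "ball x d \<subseteq> S" by (rule openE[OF open_S x])
  have "u y = u x" if "y \<in> ball x (min d e)" for y
  proof -
    have "y \<in> S" "v y = v x" using d(2) e(2)[of y] that by auto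
    then have "ln (u y) = ln (u x)" by (simp add: v_def)
    then show ?thesis using pos[OF \<open>y \<in> S\<close>] pos[OF x] by simp
  qed
  moreover have "min d e > 0" using d(1) e(1) by simp
  ultimately show ?thesis by blast
qed

text \<open>The components \<alpha>, \<beta>, \<gamma> of the covariant derivative satisfy linear
  relations of three kinds: the trace condition and the constancy of the norm, both differentiated,
  and the Codazzi symmetry linking the two directions. Where the form is nonzero they admit only the
  zero solution.\<close>

lemma parallel_of_constant:
  assumes "M > 0" and u: "\<And>y. y \<in> S \<Longrightarrow> u y = M" and x: "x \<in> S"
  shows "pd i a x = 2 * (\<Gamma> 1 i 1 x * a x + \<Gamma> 2 i 1 x * b x)"
    "pd i b x = \<Gamma> 1 i 1 x * b x + \<Gamma> 2 i 1 x * c x + (\<Gamma> 1 i 2 x * a x + \<Gamma> 2 i 2 x * b x)"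
    "pd i c x = 2 * (\<Gamma> 1 i 2 x * b x + \<Gamma> 2 i 2 x * c x)"
proof -
  define \<alpha> where "\<alpha> = (\<lambda>i. pd i a x - 2 * (\<Gamma> 1 i 1 x * a x + \<Gamma> 2 i 1 x * b x))"
  define \<beta> where "\<beta> = (\<lambda>i. pd i b x - (\<Gamma> 1 i 1 x * b x + \<Gamma> 2 i 1 x * c x) - (\<Gamma> 1 i 2 x * a x + \<Gamma> 2 i 2 x * b x))"
  define \<gamma> where "\<gamma> = (\<lambda>i. pd i c x - 2 * (\<Gamma> 1 i 2 x * b x + \<Gamma> 2 i 2 x * c x))"
  have eqs: "pd i a x = \<alpha> i + 2 * (\<Gamma> 1 i 1 x * a x + \<Gamma> 2 i 1 x * b x)"
    "pd i b x = \<beta> i + (\<Gamma> 1 i 1 x * b x + \<Gamma> 2 i 1 x * c x) + (\<Gamma> 1 i 2 x * a x + \<Gamma> 2 i 2 x * b x)"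
    "pd i c x = \<gamma> i + 2 * (\<Gamma> 1 i 2 x * b x + \<Gamma> 2 i 2 x * c x)" for i
    by (simp_all add: \<alpha>_def \<beta>_def \<gamma>_def)
  have d: "E differentiable (at x)" "F differentiable (at x)" "G differentiable (at x)"
    "a differentiable (at x)" "b differentiable (at x)" "c differentiable (at x)"
    by (auto intro: smooth_on_differentiable[OF _ x] smooth_EFG smooth_abc)
  have det: "b y * b y - a y * c y = M * (E y * G y - F y * F y)" if "y \<in> S" for y
    using u[OF that] W_pos[OF that] by (simp add: u_def W_def field_simps)
  have 1: "G x * \<alpha> i - 2 * F x * \<beta> i + E x * \<gamma> i = 0" for i
    unfolding \<alpha>_def \<beta>_def \<gamma>_def by (rule traceless_derivative[OF smooth_abc traceless x])
  have 2: "2 * b x * \<beta> i - c x * \<alpha> i - a x * \<gamma> i = 0" for i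
  proof -
    have "pd i (\<lambda>y. b y * b y - a y * c y) x = pd i (\<lambda>y. M * (E y * G y - F y * F y)) x"
      using smooth_EFG smooth_abc
      by (intro pd_cong[OF smooth_on_differentiable[OF _ x] open_S x det])
        (auto intro!: smooth_on_add smooth_on_diff smooth_on_mult smooth_on_const open_S)
    then have "2 * b x * pd i b x - pd i a x * c x - a x * pd i c x =
        M * (pd i E x * G x + E x * pd i G x - 2 * F x * pd i F x)"
      using d by (simp add: pd_add pd_diff pd_mult pd_const algebra_simps)
    \<comment> \<open>Replacing partial by covariant derivatives in b^2 - a c = M W changes its
      derivative only by a multiple of the relation itself, again through the trace of the
      Christoffel symbols.\<close>
    moreover have "2 * b x * \<beta> i - c x * \<alpha> i - a x * \<gamma> i =
        2 * b x * pd i b x - pd i a x * c x - a x * pd i c x - M * (pd i E x * G x + E x * pd i G x - 2 * F x * pd i F x)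
        - 2 * (\<Gamma> 1 i 1 x + \<Gamma> 2 i 2 x) * (b x * b x - a x * c x - M * (E x * G x - F x * F x))"
      unfolding pd_E[OF x] pd_F[OF x] pd_G[OF x] eqs by (simp add: algebra_simps)
    ultimately show ?thesis using det[OF x] by simp
  qed
  note \<Gamma>21 = \<Gamma>_commute[OF x, of 1 2 1] \<Gamma>_commute[OF x, of 2 2 1]
  have "\<alpha> 2 = \<beta> 1"
    using codazzi1[OF x] unfolding \<alpha>_def \<beta>_def \<Gamma>21 by (simp add: algebra_simps)
  moreover have "\<beta> 2 = \<gamma> 1"
    using codazzi2[OF x] unfolding \<beta>_def \<gamma>_def \<Gamma>21 by (simp add: algebra_simps)
  ultimately have 3: "\<alpha> 2 = \<beta> 1" "\<beta> 2 = \<gamma> 1" .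
  \<comment> \<open>Eliminating \<gamma> between the two differentiated relations, and
    \<open>c\<close> by the trace condition, leaves
    \<open>X * \<beta> i + Y * \<alpha> i = 0\<close>.\<close>
  define X where "X = b x * E x - a x * F x"
  define Y where "Y = G x * a x - F x * b x"
  have XY: "X * \<beta> i + Y * \<alpha> i = 0" for i
  proof -
    have "2 * (X * \<beta> i + Y * \<alpha> i) = E x * (2 * b x * \<beta> i - c x * \<alpha> i - a x * \<gamma> i)
        + a x * (G x * \<alpha> i - 2 * F x * \<beta> i + E x * \<gamma> i) + \<alpha> i * (G x * a x - 2 * F x * b x + E x * c x)"
      unfolding X_def Y_def by (simp add: algebra_simps)
    then show ?thesis unfolding 1 2 traceless[OF x] by simp
  qed
  \<comment> \<open>The coefficient is the squared length of the vector (Y, X) in the metric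
    \<open>g\<close>. It vanishes only for X = Y = 0, which would force a = b = 0 and hence u =
    0.\<close>
  have "(E x * Y\<^sup>2 + 2 * F x * X * Y + G x * X\<^sup>2) * \<beta> 1 = 0"
  proof -
    have "(E x * Y\<^sup>2 + 2 * F x * X * Y + G x * X\<^sup>2) * \<beta> 1 = E x * Y * (X * \<gamma> 1 + Y * \<beta> 1)
        + G x * X * (X * \<beta> 1 + Y * \<alpha> 1) - X * Y * (G x * \<alpha> 1 - 2 * F x * \<beta> 1 + E x * \<gamma> 1)"
      by (simp add: algebra_simps power2_eq_square)
    then show ?thesis using XY[of 1] XY[of 2] 1[of 1] unfolding 3 by simp
  qed
  moreover have "X \<noteq> 0 \<or> Y \<noteq> 0"
  proof (rule ccontr)
    assume "\<not> ?thesis"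
    moreover have "W x * a x = E x * Y + F x * X" "W x * b x = G x * X + F x * Y"
      unfolding X_def Y_def W_def by (simp_all add: algebra_simps)
    ultimately have "W x * a x = 0" "W x * b x = 0" by simp_all
    then have "b x * b x - a x * c x = 0" using W_pos[OF x] by simp
    then show False using u[OF x] \<open>M > 0\<close> by (simp add: u_def)
  qed
  moreover have "E x * Y\<^sup>2 + 2 * F x * X * Y + G x * X\<^sup>2 \<noteq> 0" if "X \<noteq> 0 \<or> Y \<noteq> 0"
  proof -
    have "vector [Y, X] \<noteq> (0 :: real ^ 2)" using that by (auto simp: vec_eq_iff forall_2)
    from metric_onD(4)[OF metric x this] show ?thesis
      by (simp add: ip_eq[OF x] algebra_simps power2_eq_square)
  qed
  ultimately have "\<beta> 1 = 0" by simp
  have "X * \<gamma> 1 = 0" "E x * \<gamma> 1 = - G x * \<alpha> 1" "Y * \<alpha> 1 = 0"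
    using XY[of 1] XY[of 2] 1[of 1] unfolding 3 \<open>\<beta> 1 = 0\<close> by simp_all
  then have "\<alpha> 1 = 0" "\<gamma> 1 = 0"
    using \<open>X \<noteq> 0 \<or> Y \<noteq> 0\<close> E_pos[OF x] G_pos[OF x] by auto
  moreover have "\<gamma> 2 = 0"
    using 1[of 2] E_pos[OF x] unfolding 3 \<open>\<beta> 1 = 0\<close> \<open>\<gamma> 1 = 0\<close> by simp
  ultimately have "\<alpha> i = 0" "\<beta> i = 0" "\<gamma> i = 0"
    using 3 \<open>\<beta> 1 = 0\<close> exhaust_2[of i] by auto
  then show "pd i a x = 2 * (\<Gamma> 1 i 1 x * a x + \<Gamma> 2 i 1 x * b x)"
    "pd i b x = \<Gamma> 1 i 1 x * b x + \<Gamma> 2 i 1 x * c x + (\<Gamma> 1 i 2 x * a x + \<Gamma> 2 i 2 x * b x)"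
    "pd i c x = 2 * (\<Gamma> 1 i 2 x * b x + \<Gamma> 2 i 2 x * c x)"
    unfolding eqs by simp_all
qed

end

section \<open>The shape operator of a CMC biconservative surface in a chart\<close>

text \<open>One chart of M and one of N: \<open>S\<close> and \<open>T\<close> are open sets of
  coordinates, \<open>f\<close> is the coordinate expression of the immersion and \<open>r\<close>
  the constant |H|.\<close>

locale surface_patch = plane_metric g S for g :: "real ^ 2 \<Rightarrow> real ^ 2 ^ 2" and S +
  fixes h :: "real ^ 'n \<Rightarrow> real ^ 'n ^ 'n::finite" and f :: "real ^ 2 \<Rightarrow> real ^ 'n" and T and r :: real
  assumes target: "metric_on h T" and smooth_f: "smooth_on f S" and f_image: "f ` S \<subseteq> T"
    and cmc: "x \<in> S \<Longrightarrow> mean_curv_norm g h f x = r"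
    and divfree: "x \<in> S \<Longrightarrow> divergence g (stress_bienergy g h f) x = 0"
begin

definition "Q x v w = metric_ip (h (f x)) (second_ff g h f x v w) (mean_curv g h f x)"

text \<open>Components of \<open>Q\<close> minus r^2 g. Since trace B = 2 H, the trace of A_H is 2
  |H|^2 = 2 r^2, so this is the trace-free part of the form \<open>Q\<close> dual to A_H.\<close>

definition "a x = Q x (axis 1 1) (axis 1 1) - r\<^sup>2 * E x"
definition "b x = Q x (axis 1 1) (axis 2 1) - r\<^sup>2 * F x"
definition "c x = Q x (axis 2 1) (axis 2 1) - r\<^sup>2 * G x"

abbreviation "A \<equiv> shape_H g h f"

lemma smooth_h_f: "smooth_on (\<lambda>x. h (f x)) S"
  by (rule smooth_on_compose[OF open_S metric_onD(1)[OF target] f_image metric_onD(2)[OF target] smooth_f])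

lemma smooth_Q: "smooth_on (\<lambda>x. Q x v w) S"
  unfolding Q_def
  by (intro smooth_on_metric_ip open_S smooth_h_f smooth_on_second_ff[OF metric target smooth_f f_image]
      smooth_on_mean_curv[OF metric target smooth_f f_image])

context
  fixes x assumes x: "x \<in> S"
begin

lemma fx: "f x \<in> T"
  using f_image x by auto

lemma Q_add: "Q x (v + v') w = Q x v w + Q x v' w" "Q x v (w + w') = Q x v w + Q x v w'"
  and Q_scaleR: "Q x (k *\<^sub>R v) w = k * Q x v w" "Q x v (k *\<^sub>R w) = k * Q x v w"
  using linear_second_ff[OF smooth_f x open_S, of g h]
  by (simp_all add: Q_def linear_add[of "\<lambda>u. second_ff g h f x u _"] linear_scale[of "\<lambda>u. second_ff g h f x u _"]
      linear_add[of "second_ff g h f x _"] linear_scale[of "second_ff g h f x _"] metric_ip_add_left metric_ip_scaleR_left)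

lemma Q_commute: "Q x v w = Q x w v"
proof -
  have "second_ff g h f x v w = second_ff g h f x w v"
    unfolding second_ff_eq
    by (simp only: second_derivative_symmetric_vec[OF smooth_f open_S x, of w v] Gam_commute[OF metric x, of v w]
        Gam_commute[OF target fx, of "frechet_derivative f (at x) v"])
  then show ?thesis by (simp add: Q_def)
qed

lemma Q_eq: "Q x v w = v $ 1 * w $ 1 * Q x (axis 1 1) (axis 1 1) + (v $ 1 * w $ 2 + v $ 2 * w $ 1) * Q x (axis 1 1) (axis 2 1)
    + v $ 2 * w $ 2 * Q x (axis 2 1) (axis 2 1)"
proof -
  have ex: "z = z $ 1 *\<^sub>R axis 1 1 + z $ 2 *\<^sub>R axis 2 1" for z :: "real ^ 2"
    using basis_expansion[of z] by (simp add: scalar_mult_eq_scaleR sum_2)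
  show ?thesis
    by (subst (1) ex[of v], subst (1) ex[of w])
      (simp add: Q_add Q_scaleR Q_commute[of "axis 2 1" "axis 1 1"] algebra_simps)
qed

lemma r2: "metric_ip (h (f x)) (mean_curv g h f x) (mean_curv g h f x) = r\<^sup>2"
proof -
  have "metric_ip (h (f x)) (mean_curv g h f x) (mean_curv g h f x) \<ge> 0"
    by (rule metric_ip_nonneg[OF target fx])
  then show ?thesis unfolding cmc[OF x, symmetric] mean_curv_norm_def by simp
qed

lemma traceless_abc: "G x * a x - 2 * F x * b x + E x * c x = 0"
proof -
  have "W x *\<^sub>R metric_trace (g x) (second_ff g h f x) = (2 * W x) *\<^sub>R mean_curv g h f x"
    by (simp add: mean_curv_def)
  then have "metric_ip (h (f x)) (W x *\<^sub>R metric_trace (g x) (second_ff g h f x)) (mean_curv g h f x) = 2 * W x * r\<^sup>2"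
    by (simp add: metric_ip_scaleR_left r2)
  then have "G x * Q x (axis 1 1) (axis 1 1) - 2 * F x * Q x (axis 1 1) (axis 2 1) + E x * Q x (axis 2 1) (axis 2 1) = 2 * W x * r\<^sup>2"
    unfolding W_metric_trace[OF x] metric_ip_add_left metric_ip_diff_left metric_ip_scaleR_left Q_def[symmetric]
    by (simp add: Q_commute[of "axis 2 1" "axis 1 1"])
  then show ?thesis by (simp add: a_def b_def c_def W_def algebra_simps)
qed

lemma ip_A: "metric_ip (g x) (A x v) w = Q x v w"
  unfolding Q_def
  by (rule metric_ip_shape_H)
    (rule metric_invertible[OF metric x] metric_onD(3)[OF metric x] linear_second_ff(1)[OF smooth_f x open_S])+

text \<open>An explicit formula in place of the definite description; smoothness of A_H is read off
  from it.\<close>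

lemma A_eq: "A x v = matrix_inv (g x) *v (\<chi> k. Q x v (axis k 1))"
proof (rule metric_ip_eqI[OF metric x])
  fix w
  have "metric_ip (g x) (matrix_inv (g x) *v (\<chi> k. Q x v (axis k 1))) w = (\<chi> k. Q x v (axis k 1)) \<bullet> w"
    by (subst metric_ip_commute[OF metric_onD(3)[OF metric x]])
      (simp add: metric_ip_def matrix_vector_mul_assoc matrix_inv_mult(1)[OF metric_invertible[OF metric x]] inner_commute)
  also have "\<dots> = Q x v w"
  proof -
    have "axis 1 (1::real) $ (2::2) = 0" "axis 2 (1::real) $ (1::2) = 0" by (simp_all add: axis_def)
    then show ?thesis
      unfolding Q_eq[of v w]
      by (simp add: inner_vec_def sum_2 Q_eq[of v "axis 1 1"] Q_eq[of v "axis 2 1"] axis_nth algebra_simps)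
  qed
  finally show "metric_ip (g x) (A x v) w = metric_ip (g x) (matrix_inv (g x) *v (\<chi> k. Q x v (axis k 1))) w"
    by (simp add: ip_A)
qed

end

lemma smooth_A: "smooth_on (\<lambda>x. A x v) S"
proof (rule smooth_on_cong[THEN iffD1, OF open_S])
  show "smooth_on (\<lambda>x. matrix_inv (g x) *v (\<chi> k. Q x v (axis k 1))) S"
    unfolding matrix_vector_mult_def
    by (intro smooth_on_vecI[OF open_S])
      (simp, intro smooth_on_sum smooth_on_mult smooth_Q smooth_on_matrix_inv open_S metric_onD(2)[OF metric] metric_invertible[OF metric])
qed (simp add: A_eq)

lemma smooth_components: "smooth_on a S" "smooth_on b S" "smooth_on c S"
  unfolding a_def[abs_def] b_def[abs_def] c_def[abs_def]
  by (intro smooth_on_diff smooth_on_mult smooth_on_const smooth_Q smooth_EFG open_S)+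

definition "N x v w z = metric_ip (g x) (nabla_endo g A x v w) z"

text \<open>Lowering an index commutes with covariant differentiation because the connection is
  metric.\<close>

lemma N_eq:
  assumes x: "x \<in> S"
  shows "N x v w z = frechet_derivative (\<lambda>y. Q y w z) (at x) v - Q x (Gam g x v w) z - Q x w (Gam g x v z)"
proof -
  have dA: "(\<lambda>y. A y w) differentiable (at x)" by (rule smooth_on_differentiable[OF smooth_A x])
  have "frechet_derivative (\<lambda>y. Q y w z) (at x) = frechet_derivative (\<lambda>y. metric_ip (g y) (A y w) z) (at x)"
    by (rule frechet_derivative_transform_within_open[OF smooth_on_differentiable[OF smooth_Q x] open_S x])
      (simp add: ip_A)
  then have "frechet_derivative (\<lambda>y. Q y w z) (at x) v =
      metric_ip (g x) (levi_civita g (\<lambda>y. A y w) x v) z + metric_ip (g x) (A x w) (Gam g x v z)"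
    using pullback_connection_metric[OF metric, of "\<lambda>y. y" x "\<lambda>y. A y w" "\<lambda>_. z" v] dA x
    by (simp add: nabla_along_def levi_civita_def)
  then show ?thesis
    unfolding N_def nabla_endo_def by (simp add: metric_ip_diff_left ip_A[OF x] levi_civita_const)
qed

text \<open>The form r^2 g is parallel, so subtracting it from \<open>Q\<close> does not change the
  covariant derivative: the components of \<nabla>A_H are computed from the trace-free part.\<close>

lemma N_axis:
  assumes x: "x \<in> S"
  shows "N x (axis i 1) (axis 1 1) (axis 1 1) = pd i a x - 2 * (\<Gamma> 1 i 1 x * a x + \<Gamma> 2 i 1 x * b x)" (is ?t1)
    and "N x (axis i 1) (axis 1 1) (axis 2 1) =
      pd i b x - (\<Gamma> 1 i 1 x * b x + \<Gamma> 2 i 1 x * c x) - (\<Gamma> 1 i 2 x * a x + \<Gamma> 2 i 2 x * b x)" (is ?t2)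
    and "N x (axis i 1) (axis 2 1) (axis 1 1) = N x (axis i 1) (axis 1 1) (axis 2 1)" (is ?t3)
    and "N x (axis i 1) (axis 2 1) (axis 2 1) = pd i c x - 2 * (\<Gamma> 1 i 2 x * b x + \<Gamma> 2 i 2 x * c x)" (is ?t4)
proof -
  have d: "E differentiable (at x)" "F differentiable (at x)" "G differentiable (at x)" "(\<lambda>y. Q y v w) differentiable (at x)" for v w
    by (auto intro: smooth_on_differentiable[OF _ x] smooth_EFG smooth_Q)
  have pdabc: "pd i a x = pd i (\<lambda>y. Q y (axis 1 1) (axis 1 1)) x - r\<^sup>2 * pd i E x"
    "pd i b x = pd i (\<lambda>y. Q y (axis 1 1) (axis 2 1)) x - r\<^sup>2 * pd i F x"
    "pd i c x = pd i (\<lambda>y. Q y (axis 2 1) (axis 2 1)) x - r\<^sup>2 * pd i G x"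
    unfolding a_def[abs_def] b_def[abs_def] c_def[abs_def] using d by (simp_all add: pd_diff pd_mult pd_const)
  have \<Gamma>Q: "Q x (Gam g x (axis i 1) (axis j 1)) z = \<Gamma> 1 i j x * Q x (axis 1 1) z + \<Gamma> 2 i j x * Q x (axis 2 1) z" for j z
    unfolding Q_eq[OF x, of "Gam g x (axis i 1) (axis j 1)" z] Gam_axis Q_eq[OF x, of "axis _ 1" z]
    by (simp add: axis_def algebra_simps)
  have com: "Q x z (Gam g x (axis i 1) (axis j 1)) = Q x (Gam g x (axis i 1) (axis j 1)) z" for z j
    by (rule Q_commute[OF x])
  have Q21: "Q x (axis 2 1) (axis 1 1) = Q x (axis 1 1) (axis 2 1)"
    by (rule Q_commute[OF x])
  show ?t1 ?t2 ?t4
    unfolding N_eq[OF x] com \<Gamma>Q pdabc pd_E[OF x] pd_F[OF x] pd_G[OF x] pd_def[symmetric]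
    unfolding a_def b_def c_def Q21 by (simp_all add: algebra_simps)
  have "frechet_derivative (\<lambda>y. Q y (axis 2 1) (axis 1 1)) (at x) = frechet_derivative (\<lambda>y. Q y (axis 1 1) (axis 2 1)) (at x)"
    by (rule frechet_derivative_transform_within_open[OF d(4) open_S x]) (rule Q_commute)
  then show ?t3
    unfolding N_eq[OF x] com \<Gamma>Q Q21 by (simp add: com \<Gamma>Q Q21)
qed

text \<open>As |H| = r is constant, the summand - 2 |H|^2 I of the stress-bienergy tensor is
  parallel.\<close>

lemma nabla_stress:
  assumes x: "x \<in> S"
  shows "nabla_endo g (stress_bienergy g h f) x v w = 4 *\<^sub>R nabla_endo g A x v w"
proof -
  have dA: "((\<lambda>y. A y w) has_derivative frechet_derivative (\<lambda>y. A y w) (at x)) (at x)"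
    by (rule smooth_on_has_derivative[OF smooth_A x])
  have st: "stress_bienergy g h f y w = (- 2 * r\<^sup>2) *\<^sub>R w + 4 *\<^sub>R A y w" if "y \<in> S" for y w
    by (simp add: stress_bienergy_def cmc[OF that])
  have "((\<lambda>y. (- 2 * r\<^sup>2) *\<^sub>R w + 4 *\<^sub>R A y w) has_derivative (\<lambda>v. 0 + 4 *\<^sub>R frechet_derivative (\<lambda>y. A y w) (at x) v)) (at x)"
    by (intro has_derivative_add has_derivative_const has_derivative_scaleR_right dA)
  then have "((\<lambda>y. stress_bienergy g h f y w) has_derivative (\<lambda>v. 0 + 4 *\<^sub>R frechet_derivative (\<lambda>y. A y w) (at x) v)) (at x)"
    by (rule has_derivative_transform_within_open[OF _ open_S x]) (simp add: st)
  from frechet_derivative_at[OF this, symmetric] show ?thesis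
    unfolding nabla_endo_def levi_civita_def st[OF x] Gam_add_right Gam_scaleR_right
    by (simp add: scaleR_add_right scaleR_diff_right)
qed

text \<open>The divergence contracts the direction of differentiation with an argument, the trace
  condition contracts the two arguments; their difference involves only the skew part of
  \<nabla>A_H. In dimension two this part has two components \<open>d1\<close>, \<open>d2\<close>,
  subject to two linear equations of determinant W > 0.\<close>

lemma codazzi:
  assumes x: "x \<in> S"
  shows "pd 2 a x - 2 * (\<Gamma> 1 2 1 x * a x + \<Gamma> 2 2 1 x * b x) =
      pd 1 b x - (\<Gamma> 1 1 1 x * b x + \<Gamma> 2 1 1 x * c x) - (\<Gamma> 1 1 2 x * a x + \<Gamma> 2 1 2 x * b x)"
    "pd 2 b x - (\<Gamma> 1 2 1 x * b x + \<Gamma> 2 2 1 x * c x) - (\<Gamma> 1 2 2 x * a x + \<Gamma> 2 2 2 x * b x) =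
      pd 1 c x - 2 * (\<Gamma> 1 1 2 x * b x + \<Gamma> 2 1 2 x * c x)"
proof -
  define n where "n = (\<lambda>i j k :: 2. N x (axis i 1) (axis j 1) (axis k 1))"
  have n_axis: "n i 1 1 = pd i a x - 2 * (\<Gamma> 1 i 1 x * a x + \<Gamma> 2 i 1 x * b x)"
    "n i 1 2 = pd i b x - (\<Gamma> 1 i 1 x * b x + \<Gamma> 2 i 1 x * c x) - (\<Gamma> 1 i 2 x * a x + \<Gamma> 2 i 2 x * b x)"
    "n i 2 1 = n i 1 2"
    "n i 2 2 = pd i c x - 2 * (\<Gamma> 1 i 2 x * b x + \<Gamma> 2 i 2 x * c x)" for i
    unfolding n_def by (rule N_axis[OF x])+
  have "metric_trace (g x) (nabla_endo g (stress_bienergy g h f) x) = 0"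
    using divfree[OF x] by (simp add: divergence_def)
  then have "W x *\<^sub>R metric_trace (g x) (nabla_endo g (stress_bienergy g h f) x) = 0" by simp
  then have "4 *\<^sub>R (G x *\<^sub>R nabla_endo g A x (axis 1 1) (axis 1 1) - F x *\<^sub>R nabla_endo g A x (axis 1 1) (axis 2 1)
    - F x *\<^sub>R nabla_endo g A x (axis 2 1) (axis 1 1) + E x *\<^sub>R nabla_endo g A x (axis 2 1) (axis 2 1)) = 0"
    unfolding W_metric_trace[OF x] nabla_stress[OF x] by (simp add: algebra_simps)
  then have "metric_ip (g x) (G x *\<^sub>R nabla_endo g A x (axis 1 1) (axis 1 1) - F x *\<^sub>R nabla_endo g A x (axis 1 1) (axis 2 1)
    - F x *\<^sub>R nabla_endo g A x (axis 2 1) (axis 1 1) + E x *\<^sub>R nabla_endo g A x (axis 2 1) (axis 2 1)) (axis k 1) = 0" for k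
    by simp
  then have div: "G x * n 1 1 k - F x * n 1 2 k - F x * n 2 1 k + E x * n 2 2 k = 0" for k
    unfolding metric_ip_add_left metric_ip_diff_left metric_ip_scaleR_left n_def N_def .
  have tr: "G x * n i 1 1 - 2 * F x * n i 1 2 + E x * n i 2 2 = 0" for i
    unfolding n_axis by (rule traceless_derivative[OF smooth_components traceless_abc x])
  define d1 where "d1 = n 1 1 2 - n 2 1 1"
  define d2 where "d2 = n 1 2 2 - n 2 1 2"
  have "E x * d2 = F x * d1"
    using div[of 1] tr[of 1] n_axis(3)[of 1] n_axis(3)[of 2] unfolding d1_def d2_def by (simp add: algebra_simps)
  moreover have "G x * d1 = F x * d2"
    using div[of 2] tr[of 2] n_axis(3)[of 1] n_axis(3)[of 2] unfolding d1_def d2_def by (simp add: algebra_simps)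
  ultimately have "W x * d1 = 0" "W x * d2 = 0" unfolding W_def by algebra+
  then have "n 2 1 1 = n 1 1 2" "n 2 1 2 = n 1 2 2"
    using W_pos[OF x] by (simp_all add: d1_def d2_def)
  then show "pd 2 a x - 2 * (\<Gamma> 1 2 1 x * a x + \<Gamma> 2 2 1 x * b x) =
      pd 1 b x - (\<Gamma> 1 1 1 x * b x + \<Gamma> 2 1 1 x * c x) - (\<Gamma> 1 1 2 x * a x + \<Gamma> 2 1 2 x * b x)"
    "pd 2 b x - (\<Gamma> 1 2 1 x * b x + \<Gamma> 2 2 1 x * c x) - (\<Gamma> 1 2 2 x * a x + \<Gamma> 2 2 2 x * b x) =
      pd 1 c x - 2 * (\<Gamma> 1 1 2 x * b x + \<Gamma> 2 1 2 x * c x)"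
    unfolding n_axis by simp_all
qed

sublocale traceless_codazzi g S a b c
proof
  fix x assume x: "x \<in> S"
  note \<Gamma>21 = \<Gamma>_commute[OF x, of 1 2 1] \<Gamma>_commute[OF x, of 2 2 1]
  show "G x * a x - 2 * F x * b x + E x * c x = 0" by (rule traceless_abc[OF x])
  show "pd 2 a x - pd 1 b x = \<Gamma> 1 1 2 x * a x + \<Gamma> 2 1 2 x * b x - \<Gamma> 1 1 1 x * b x - \<Gamma> 2 1 1 x * c x"
    using codazzi(1)[OF x] unfolding \<Gamma>21 by (simp add: algebra_simps)
  show "pd 2 b x - pd 1 c x = \<Gamma> 1 2 2 x * a x + \<Gamma> 2 2 2 x * b x - \<Gamma> 1 1 2 x * b x - \<Gamma> 2 1 2 x * c x"
    using codazzi(2)[OF x] unfolding \<Gamma>21 by (simp add: algebra_simps)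
qed (rule smooth_components)+

lemma abc_zero:
  assumes x: "x \<in> S" and "u x = 0"
  shows "a x = 0" "b x = 0" "c x = 0"
proof -
  have "(a x)\<^sup>2 + (q x)\<^sup>2 = 0" using assms E_pos[OF x] unfolding u_eq[OF x] by simp
  then have "a x = 0" "q x = 0" by (simp_all add: sum_power2_eq_zero_iff)
  then show "a x = 0" "b x = 0" "c x = 0" by (simp_all add: b_eq[OF x] c_eq[OF x])
qed

context
  fixes x assumes x: "x \<in> S"
begin

lemma N_commute: "N x X Y Z = N x X Z Y"
proof -
  have "frechet_derivative (\<lambda>y. Q y Y Z) (at x) = frechet_derivative (\<lambda>y. Q y Z Y) (at x)"
    by (rule frechet_derivative_transform_within_open[OF smooth_on_differentiable[OF smooth_Q x] open_S x]) (rule Q_commute)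
  then show ?thesis
    unfolding N_eq[OF x] using Q_commute[OF x, of "Gam g x X Y" Z] Q_commute[OF x, of "Gam g x X Z" Y] by simp
qed

text \<open>Trilinearity, which reduces the vanishing of \<nabla>A_H to basis vectors. Linearity in
  the middle argument is inherited from the last one through \<open>N_commute\<close>.\<close>

lemma N_expand: "N x X Y Z = (\<Sum>i\<in>UNIV. \<Sum>j\<in>UNIV. \<Sum>k\<in>UNIV. X $ i * Y $ j * Z $ k * N x (axis i 1) (axis j 1) (axis k 1))"
proof -
  have ex: "y = y $ 1 *\<^sub>R axis 1 1 + y $ 2 *\<^sub>R axis 2 1" for y :: "real ^ 2"
    using basis_expansion[of y] by (simp add: scalar_mult_eq_scaleR sum_2)
  have Z: "N x X Y Z = Z $ 1 * N x X Y (axis 1 1) + Z $ 2 * N x X Y (axis 2 1)" for X Y Z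
    unfolding N_def by (subst (1) ex[of Z]) (simp add: metric_ip_add_right metric_ip_scaleR_right)
  have Y: "N x X Y Z = Y $ 1 * N x X (axis 1 1) Z + Y $ 2 * N x X (axis 2 1) Z" for X Y Z
    using Z[of X Z Y] by (simp only: N_commute[of X Z])
  have lin: "linear (frechet_derivative (\<lambda>y. Q y Y Z) (at x))" for Y Z
    by (rule has_derivative_linear[OF smooth_on_has_derivative[OF smooth_Q x]])
  have X: "N x X Y Z = X $ 1 * N x (axis 1 1) Y Z + X $ 2 * N x (axis 2 1) Y Z" for X Y Z
    unfolding N_eq[OF x] by (subst (1 2 3) ex[of X])
      (simp add: linear_add[OF lin] linear_scale[OF lin] Gam_add_left Gam_scaleR_left Q_add[OF x] Q_scaleR[OF x] algebra_simps)
  show ?thesis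
    unfolding sum_2 by (subst X, subst (1 2) Y, subst (1 2 3 4) Z) (simp add: algebra_simps)
qed

lemma nabla_A_zeroI:
  assumes "\<And>i. pd i a x = 2 * (\<Gamma> 1 i 1 x * a x + \<Gamma> 2 i 1 x * b x)"
    and "\<And>i. pd i b x = \<Gamma> 1 i 1 x * b x + \<Gamma> 2 i 1 x * c x + (\<Gamma> 1 i 2 x * a x + \<Gamma> 2 i 2 x * b x)"
    and "\<And>i. pd i c x = 2 * (\<Gamma> 1 i 2 x * b x + \<Gamma> 2 i 2 x * c x)"
  shows "nabla_endo g A x X Y = 0"
proof (rule metric_ip_eqI[OF metric x])
  have "N x (axis i 1) (axis j 1) (axis k 1) = 0" for i j k :: 2
    using exhaust_2[of j] exhaust_2[of k] N_axis[OF x, of i] assms[of i] by auto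
  then show "metric_ip (g x) (nabla_endo g A x X Y) Z = metric_ip (g x) 0 Z" for Z
    by (simp add: N_def[symmetric] N_expand[of X Y Z])
qed

lemma A_of_u_zero:
  assumes "u x = 0"
  shows "A x X = r\<^sup>2 *\<^sub>R X"
proof (rule metric_ip_eqI[OF metric x])
  show "metric_ip (g x) (A x X) Y = metric_ip (g x) (r\<^sup>2 *\<^sub>R X) Y" for Y
    using abc_zero[OF x assms]
    unfolding ip_A[OF x]
    unfolding Q_eq[OF x, of X Y] metric_ip_scaleR_left ip_eq[OF x] a_def b_def c_def
    by (simp add: algebra_simps)
qed

lemma parallel_A:
  assumes "M \<ge> 0" and u: "\<And>y. y \<in> S \<Longrightarrow> u y = M"
  shows "nabla_endo g A x X Y = 0"
proof (cases "M = 0")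
  case True
  have Z: "a y = 0" "b y = 0" "c y = 0" if "y \<in> S" for y
    using abc_zero[OF that] u[OF that] True by simp_all
  have "pd i a x = 0" "pd i b x = 0" "pd i c x = 0" for i
    using pd_cong[OF smooth_on_differentiable[OF smooth_components(1) x] open_S x Z(1), of i]
      pd_cong[OF smooth_on_differentiable[OF smooth_components(2) x] open_S x Z(2), of i]
      pd_cong[OF smooth_on_differentiable[OF smooth_components(3) x] open_S x Z(3), of i]
    by (simp_all add: pd_const)
  then show ?thesis using Z[OF x] by (intro nabla_A_zeroI) simp_all
next
  case False
  with assms have "M > 0" by simp
  show ?thesis by (rule nabla_A_zeroI; rule parallel_of_constant[OF \<open>M > 0\<close> u x])
qed

end

end

section \<open>Invariance under changes of charts\<close>

lemma metric_on_subset: "metric_on g S \<Longrightarrow> open S' \<Longrightarrow> S' \<subseteq> S \<Longrightarrow> metric_on g S'"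
  unfolding metric_on_def using smooth_on_subset by blast

lemma surface_patch_subset:
  assumes "surface_patch g S h f T r" "open S'" "S' \<subseteq> S"
  shows "surface_patch g S' h f T r"
proof -
  interpret surface_patch g S h f T r by fact
  show ?thesis
    using metric_on_subset[OF metric assms(2,3)] target smooth_on_subset[OF smooth_f assms(3)] f_image cmc divfree assms(3)
    by unfold_locales (auto simp: subset_iff image_subset_iff)
qed

text \<open>Definiteness of \<open>g\<close> makes the differential injective, and equal dimensions
  make it onto.\<close>

lemma isometric_on_surj:
  fixes F :: "real ^ 'm::finite \<Rightarrow> real ^ 'm"
  assumes "metric_on g S" "smooth_on F S" "isometric_on g h F S" "x \<in> S"
  shows "surj (frechet_derivative F (at x))"
proof -
  have lin: "linear (frechet_derivative F (at x))"
    by (rule has_derivative_linear[OF smooth_on_has_derivative[OF assms(2,4)]])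
  have "v = 0" if "frechet_derivative F (at x) v = 0" for v
  proof (rule ccontr)
    assume "v \<noteq> 0"
    then have "metric_ip (g x) v v > 0" using metric_onD(4)[OF assms(1,4)] by blast
    then show False using assms(3,4) that by (simp add: isometric_on_def)
  qed
  then have "inj (frechet_derivative F (at x))"
    using linear_injective_0[OF lin] by blast
  then show ?thesis by (rule linear_injective_imp_surjective[OF lin]) simp
qed

lemma (in plane_metric) orthonormal_basis_exists:
  assumes x: "x \<in> S"
  shows "\<exists>e :: 2 \<Rightarrow> real ^ 2. \<forall>i j. metric_ip (g x) (e i) (e j) = (if i = j then 1 else 0)"
proof (intro exI allI)
  \<comment> \<open>Gram-Schmidt applied to the coordinate frame: (- F, E) is orthogonal to (1, 0)
    and has squared length E W.\<close>
  define e where "e = (\<lambda>i :: 2. if i = 1 then (1 / sqrt (E x)) *\<^sub>R vector [1, 0]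
    else (1 / sqrt (E x * W x)) *\<^sub>R (vector [- F x, E x] :: real ^ 2))"
  note E = E_pos[OF x]
  have e11: "metric_ip (g x) (e 1) (e 1) = 1"
    using E unfolding e_def by (simp add: metric_ip_scaleR_left metric_ip_scaleR_right ip_eq[OF x])
  have e12: "metric_ip (g x) (e 1) (e 2) = 0"
    unfolding e_def by (simp add: metric_ip_scaleR_left metric_ip_scaleR_right ip_eq[OF x])
  have "metric_ip (g x) (vector [- F x, E x]) (vector [- F x, E x]) = E x * W x"
    unfolding ip_eq[OF x] W_def by (simp add: algebra_simps)
  then have e22: "metric_ip (g x) (e 2) (e 2) = 1"
    using E W_pos[OF x] unfolding e_def by (simp add: metric_ip_scaleR_left metric_ip_scaleR_right)
  fix i j
  show "metric_ip (g x) (e i) (e j) = (if i = j then 1 else 0)"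
    using e11 e12 e22 metric_ip_commute[OF metric_onD(3)[OF metric x], of "e 2" "e 1"] exhaust_2[of i] exhaust_2[of j]
    by auto
qed

text \<open>An orthonormal basis and its image under the isometry \<open>L\<close> compute both
  traces with the same summands.\<close>

lemma metric_trace_isometry:
  fixes b :: "real ^ 2 \<Rightarrow> real ^ 2 \<Rightarrow> 'b::real_vector" and g' :: "real ^ 2 \<Rightarrow> real ^ 2 ^ 2"
  assumes g': "metric_on g' S'" "x \<in> S'" and L: "linear L"
    and iso: "\<And>v w. metric_ip (g' x) v w = metric_ip G (L v) (L w)"
    and b: "\<And>w. linear (\<lambda>v. b v w)" "\<And>v. linear (b v)"
  shows "metric_trace (g' x) (\<lambda>v w. b (L v) (L w)) = metric_trace G b"
proof -
  interpret plane_metric g' S' by unfold_locales (rule g')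
  obtain e :: "2 \<Rightarrow> real ^ 2" where e: "\<And>i j. metric_ip (g' x) (e i) (e j) = (if i = j then 1 else 0)"
    using orthonormal_basis_exists[OF g'(2)] by blast
  have "linear (\<lambda>v. b (L v) (L w))" "linear (\<lambda>w. b (L v) (L w))" for v w
    using linear_compose[OF L b(1)] linear_compose[OF L b(2)] by (simp_all add: o_def)
  then have "metric_trace (g' x) (\<lambda>v w. b (L v) (L w)) = (\<Sum>i\<in>UNIV. b (L (e i)) (L (e i)))"
    by (rule metric_trace_orthonormal[OF _ _ e])
  moreover have "metric_trace G b = (\<Sum>i\<in>UNIV. b (L (e i)) (L (e i)))"
    by (rule metric_trace_orthonormal[OF b]) (simp add: e iso[symmetric])
  ultimately show ?thesis by simp
qed

lemma metric_trace_linear: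
  assumes "linear L"
  shows "metric_trace G (\<lambda>v w. L (b v w)) = L (metric_trace G b)"
  unfolding metric_trace_def by (simp add: linear_sum[OF assms] linear_scale[OF assms])

text \<open>A simultaneous change of charts in M and N. Primed objects belong to the new charts;
  \<sigma> leads from the new coordinates of M to the old ones, \<psi> from the old coordinates of N
  to the new ones, so that f' = \<psi> o f o \<sigma>.\<close>

locale patch_change =
  fixes g g' :: "real ^ 2 \<Rightarrow> real ^ 2 ^ 2" and h h' :: "real ^ 'n \<Rightarrow> real ^ 'n ^ 'n::finite" and S S' T T'
    and f f' :: "real ^ 2 \<Rightarrow> real ^ 'n" and \<sigma> :: "real ^ 2 \<Rightarrow> real ^ 2" and \<psi> :: "real ^ 'n \<Rightarrow> real ^ 'n" and x
  assumes g: "metric_on g S" and h: "metric_on h T" and g': "metric_on g' S'" and h': "metric_on h' T'"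
    and f: "smooth_on f S" "f ` S \<subseteq> T"
    and \<sigma>: "smooth_on \<sigma> S'" "\<sigma> ` S' \<subseteq> S" "isometric_on g' g \<sigma> S'"
    and \<psi>: "smooth_on \<psi> T" "\<psi> ` T \<subseteq> T'" "isometric_on h h' \<psi> T"
    and f': "\<And>y. y \<in> S' \<Longrightarrow> f' y = \<psi> (f (\<sigma> y))"
    and x: "x \<in> S'"
begin

abbreviation "L \<equiv> frechet_derivative \<sigma> (at x)"
abbreviation "P \<equiv> frechet_derivative \<psi> (at (f (\<sigma> x)))"

lemma memb: "\<sigma> x \<in> S" "f (\<sigma> x) \<in> T"
  using \<sigma>(2) f(2) x by auto

lemma linear_L: "linear L" and linear_P: "linear P"
  by (rule has_derivative_linear[OF smooth_on_has_derivative[OF \<sigma>(1) x]],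
      rule has_derivative_linear[OF smooth_on_has_derivative[OF \<psi>(1) memb(2)]])

text \<open>Tensoriality of B: the composition rule, used twice, adds only terms with the second
  fundamental forms of \<psi> and \<sigma>, and these vanish because both maps are local
  isometries.\<close>

lemma second_ff_change: "second_ff g' h' f' x v w = P (second_ff g h f (\<sigma> x) (L v) (L w))"
proof -
  note S' = metric_onD(1)[OF g'] and S = metric_onD(1)[OF g] and T = metric_onD(1)[OF h]
  have sm: "smooth_on (\<lambda>y. f (\<sigma> y)) S'"
    by (rule smooth_on_compose[OF S' S \<sigma>(2) f(1) \<sigma>(1)])
  have im: "(\<lambda>y. f (\<sigma> y)) ` S' \<subseteq> T" using \<sigma>(2) f(2) by auto
  have "second_ff g' h' f' x v w = second_ff g' h' (\<lambda>y. \<psi> (f (\<sigma> y))) x v w"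
    by (rule second_ff_cong[OF smooth_on_compose[OF S' T im \<psi>(1) sm] S' x, symmetric]) (simp add: f')
  also have "\<dots> = P (second_ff g' h (\<lambda>y. f (\<sigma> y)) x v w)"
    using second_ff_compose[OF \<psi>(1) T sm im S' x, of g' h' v w h]
      second_ff_local_isometry[OF h h' \<psi> memb(2) isometric_on_surj[OF h \<psi>(1,3) memb(2)]]
    by simp
  also have "second_ff g' h (\<lambda>y. f (\<sigma> y)) x v w = second_ff g h f (\<sigma> x) (L v) (L w)"
    using second_ff_compose[OF f(1) S \<sigma>(1,2) S' x, of g' h v w g]
      second_ff_local_isometry[OF g' g \<sigma> x isometric_on_surj[OF g' \<sigma>(1,3) x]]
      linear_0[OF has_derivative_linear[OF smooth_on_has_derivative[OF f(1) memb(1)]]]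
    by simp
  finally show ?thesis .
qed

lemma mean_curv_change: "mean_curv g' h' f' x = P (mean_curv g h f (\<sigma> x))"
proof -
  have iso: "metric_ip (g' x) v w = metric_ip (g (\<sigma> x)) (L v) (L w)" for v w
    using \<sigma>(3) x by (simp add: isometric_on_def)
  have "metric_trace (g' x) (second_ff g' h' f' x) = metric_trace (g' x) (\<lambda>v w. P (second_ff g h f (\<sigma> x) (L v) (L w)))"
    by (simp add: metric_trace_def second_ff_change)
  also have "\<dots> = P (metric_trace (g' x) (\<lambda>v w. second_ff g h f (\<sigma> x) (L v) (L w)))"
    by (rule metric_trace_linear[OF linear_P])
  also have "metric_trace (g' x) (\<lambda>v w. second_ff g h f (\<sigma> x) (L v) (L w)) = metric_trace (g (\<sigma> x)) (second_ff g h f (\<sigma> x))"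
    by (rule metric_trace_isometry[OF g' x linear_L iso linear_second_ff(2,1)[OF f(1) memb(1) metric_onD(1)[OF g]]])
  finally show ?thesis
    by (simp add: mean_curv_def linear_scale[OF linear_P])
qed

end

text \<open>\<open>r\<^sup>4 - det A\<^sub>H\<close>, half the squared norm of the traceless part of \<open>A\<^sub>H\<close>.\<close>

abbreviation umbilicity where
  "umbilicity g h f r \<equiv> traceless_codazzi.u g (surface_patch.a g h f r) (surface_patch.b g h f r) (surface_patch.c g h f r)"

text \<open>Up to sign, \<open>u\<close> is the quotient of the determinants of two quadratic forms
  in the same basis; the change of basis multiplies both by the square of the Jacobian
  determinant.\<close>

lemma (in patch_change) umbilicity_change:
  assumes "surface_patch g S h f T r" and "surface_patch g' S' h' f' T' r"
  shows "umbilicity g' h' f' r x = umbilicity g h f r (\<sigma> x)"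
proof -
  interpret sp: surface_patch g S h f T r by fact
  interpret sp': surface_patch g' S' h' f' T' r by fact
  have iso: "metric_ip (g' x) v w = metric_ip (g (\<sigma> x)) (L v) (L w)" for v w
    using \<sigma>(3) x by (simp add: isometric_on_def)
  have Q: "sp'.Q x v w = sp.Q (\<sigma> x) (L v) (L w)" for v w
    using \<psi>(3) memb(2) by (simp add: sp'.Q_def sp.Q_def second_ff_change mean_curv_change f'[OF x] isometric_on_def)
  define l where "l = (\<lambda>i j. L (axis j 1) $ i)"
  define det where "det = l 1 1 * l 2 2 - l 1 2 * l 2 1"
  have ip': "sp'.E x = metric_ip (g' x) (axis 1 1) (axis 1 1)" "sp'.F x = metric_ip (g' x) (axis 1 1) (axis 2 1)"
    "sp'.G x = metric_ip (g' x) (axis 2 1) (axis 2 1)"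
    by (simp_all add: sp'.ip_eq[OF x] axis_def)
  have EFG: "sp'.E x = (l 1 1)\<^sup>2 * sp.E (\<sigma> x) + 2 * l 1 1 * l 2 1 * sp.F (\<sigma> x) + (l 2 1)\<^sup>2 * sp.G (\<sigma> x)"
    "sp'.F x = l 1 1 * l 1 2 * sp.E (\<sigma> x) + (l 1 1 * l 2 2 + l 2 1 * l 1 2) * sp.F (\<sigma> x) + l 2 1 * l 2 2 * sp.G (\<sigma> x)"
    "sp'.G x = (l 1 2)\<^sup>2 * sp.E (\<sigma> x) + 2 * l 1 2 * l 2 2 * sp.F (\<sigma> x) + (l 2 2)\<^sup>2 * sp.G (\<sigma> x)"
    unfolding ip' iso sp.ip_eq[OF memb(1)] l_def by (simp_all add: algebra_simps power2_eq_square)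
  have abc: "sp'.a x = (l 1 1)\<^sup>2 * sp.a (\<sigma> x) + 2 * l 1 1 * l 2 1 * sp.b (\<sigma> x) + (l 2 1)\<^sup>2 * sp.c (\<sigma> x)"
    "sp'.b x = l 1 1 * l 1 2 * sp.a (\<sigma> x) + (l 1 1 * l 2 2 + l 2 1 * l 1 2) * sp.b (\<sigma> x) + l 2 1 * l 2 2 * sp.c (\<sigma> x)"
    "sp'.c x = (l 1 2)\<^sup>2 * sp.a (\<sigma> x) + 2 * l 1 2 * l 2 2 * sp.b (\<sigma> x) + (l 2 2)\<^sup>2 * sp.c (\<sigma> x)"
    unfolding sp'.a_def sp'.b_def sp'.c_def EFG Q sp.a_def sp.b_def sp.c_def
    using sp.Q_eq[OF memb(1), of "L (axis 1 1)" "L (axis 1 1)"] sp.Q_eq[OF memb(1), of "L (axis 1 1)" "L (axis 2 1)"]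
      sp.Q_eq[OF memb(1), of "L (axis 2 1)" "L (axis 2 1)"]
    by (simp_all add: l_def algebra_simps power2_eq_square)
  have W: "sp'.W x = det\<^sup>2 * sp.W (\<sigma> x)"
    unfolding sp'.W_def sp.W_def EFG det_def by (simp add: algebra_simps power2_eq_square)
  moreover have "sp'.b x * sp'.b x - sp'.a x * sp'.c x = det\<^sup>2 * (sp.b (\<sigma> x) * sp.b (\<sigma> x) - sp.a (\<sigma> x) * sp.c (\<sigma> x))"
    unfolding abc det_def by (simp add: algebra_simps power2_eq_square)
  moreover have "det\<^sup>2 \<noteq> 0" using W sp'.W_pos[OF x] by auto
  ultimately show ?thesis by (simp add: sp'.u_def sp.u_def)
qed

section \<open>The global argument\<close>

lemma chart_facts:
  assumes "is_chart X c"
  shows "inj_on (snd c) (fst c)" and "fst c \<subseteq> topspace X"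
    and "\<And>p. p \<in> fst c \<Longrightarrow> chart_inv c (snd c p) = p"
    and "\<And>V. openin X V \<Longrightarrow> V \<subseteq> fst c \<Longrightarrow> open (snd c ` V)"
    and "\<And>Z. open Z \<Longrightarrow> openin X {p \<in> fst c. snd c p \<in> Z}"
proof -
  have op: "openin X (fst c)" and oc: "open (coord_dom c)"
    and hom: "homeomorphic_map (subtopology X (fst c)) (top_of_set (coord_dom c)) (snd c)"
    using assms by (simp_all add: is_chart_def)
  show sub: "fst c \<subseteq> topspace X" using op by (rule openin_subset)
  show inj: "inj_on (snd c) (fst c)"
    using homeomorphic_imp_injective_map[OF hom] sub by (simp add: Int_absorb1)
  then show "chart_inv c (snd c p) = p" if "p \<in> fst c" for p
    using that by (simp add: chart_inv_def)
  show "open (snd c ` V)" if V: "openin X V" "V \<subseteq> fst c" for V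
  proof -
    have "openin (subtopology X (fst c)) V" using V unfolding openin_subtopology by blast
    then have "openin (top_of_set (coord_dom c)) (snd c ` V)"
      using homeomorphic_imp_open_map[OF hom] by (simp add: open_map_def)
    then show ?thesis using oc openin_open_eq by blast
  qed
  show "openin X {p \<in> fst c. snd c p \<in> Z}" if Z: "open Z" for Z
  proof -
    have "openin (top_of_set (coord_dom c)) (coord_dom c \<inter> Z)" using Z by (simp add: openin_open_Int)
    from openin_continuous_map_preimage[OF homeomorphic_imp_continuous_map[OF hom] this]
    moreover have "{p \<in> topspace (subtopology X (fst c)). snd c p \<in> coord_dom c \<inter> Z} = {p \<in> fst c. snd c p \<in> Z}"
      using sub by (auto simp: coord_dom_def)
    ultimately have "openin (subtopology X (fst c)) {p \<in> fst c. snd c p \<in> Z}" by simp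
    then show ?thesis using op openin_trans_full by blast
  qed
qed

text \<open>Fixes the constant \<open>r\<close>, so that the local results for all pairs of charts
  refer to the same number.\<close>

locale cmc_surface =
  fixes M :: "('a, 2) riemannian" and N :: "('b, 'n::finite) riemannian" and \<phi> :: "'a \<Rightarrow> 'b" and r :: real
  assumes surf: "surface M N \<phi>"
    and cmc: "c \<in> atlas M \<Longrightarrow> d \<in> atlas N \<Longrightarrow> x \<in> local_dom \<phi> c d \<Longrightarrow>
      mean_curv_norm (gram M c) (gram N d) (local_rep \<phi> c d) x = r"
    and bicons: "biconservative M N \<phi>"
begin

abbreviation "X \<equiv> points M"

text \<open>The points of M seen by both charts; \<open>local_dom\<close> is the image of this set
  in coordinates. Openness and connectedness are argued on M itself.\<close>

definition "patch_dom c d = {p \<in> fst c. \<phi> p \<in> fst d}"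

lemma riemM: "riemannian_manifold M" and riemN: "riemannian_manifold N" and iso: "isometric_immersion M N \<phi>"
  using surf by (simp_all add: surface_def)

lemma chart_M: "c \<in> atlas M \<Longrightarrow> is_chart X c" and chart_N: "d \<in> atlas N \<Longrightarrow> is_chart (points N) d"
  using riemM riemN by (simp_all add: riemannian_manifold_def oriented_smooth_atlas_def)

lemma local_dom_eq: "local_dom \<phi> c d = snd c ` patch_dom c d"
  by (simp add: local_dom_def patch_dom_def)

lemma continuous_\<phi>: "continuous_map X (points N) \<phi>"
  using iso by (simp add: isometric_immersion_def smooth_map_def)

lemma chart_openin: "c \<in> atlas M \<Longrightarrow> openin X (fst c)" "d \<in> atlas N \<Longrightarrow> openin (points N) (fst d)"
  using chart_M[of c] chart_N[of d] by (simp_all add: is_chart_def)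

lemma openin_patch_dom:
  assumes "c \<in> atlas M" "d \<in> atlas N"
  shows "openin X (patch_dom c d)"
proof -
  have "openin X {p \<in> topspace X. \<phi> p \<in> fst d}"
    by (rule openin_continuous_map_preimage[OF continuous_\<phi> chart_openin(2)[OF assms(2)]])
  then have "openin X (fst c \<inter> {p \<in> topspace X. \<phi> p \<in> fst d})"
    using chart_openin(1)[OF assms(1)] by blast
  moreover have "fst c \<inter> {p \<in> topspace X. \<phi> p \<in> fst d} = patch_dom c d"
    using chart_facts(2)[OF chart_M[OF assms(1)]] by (auto simp: patch_dom_def)
  ultimately show ?thesis by simp
qed

lemma charts_exist:
  assumes "p \<in> topspace X"
  obtains c d where "c \<in> atlas M" "d \<in> atlas N" "p \<in> patch_dom c d"
proof -
  have "(\<Union>c\<in>atlas M. fst c) = topspace X" "(\<Union>d\<in>atlas N. fst d) = topspace (points N)"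
    using riemM riemN by (simp_all add: riemannian_manifold_def oriented_smooth_atlas_def)
  moreover have "\<phi> p \<in> topspace (points N)"
    using continuous_map_image_subset_topspace[OF continuous_\<phi>] assms by auto
  ultimately obtain c d where "c \<in> atlas M" "p \<in> fst c" "d \<in> atlas N" "\<phi> p \<in> fst d"
    using assms by blast
  then show ?thesis using that by (auto simp: patch_dom_def)
qed

lemma metric_on_coord_dom:
  assumes "riemannian_manifold R" "c \<in> atlas R"
  shows "metric_on (gram R c) (coord_dom c)"
  using assms unfolding riemannian_manifold_def riemannian_metric_def metric_on_def oriented_smooth_atlas_def is_chart_def
  by blast

lemma patch:
  assumes c: "c \<in> atlas M" and d: "d \<in> atlas N"
  shows "surface_patch (gram M c) (local_dom \<phi> c d) (gram N d) (local_rep \<phi> c d) (coord_dom d) r"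
proof
  have sub: "patch_dom c d \<subseteq> fst c" by (auto simp: patch_dom_def)
  have "open (local_dom \<phi> c d)"
    unfolding local_dom_eq by (rule chart_facts(4)[OF chart_M[OF c] openin_patch_dom[OF c d] sub])
  moreover have "local_dom \<phi> c d \<subseteq> coord_dom c"
    using sub by (auto simp: local_dom_eq coord_dom_def)
  ultimately show "metric_on (gram M c) (local_dom \<phi> c d)"
    using metric_on_subset[OF metric_on_coord_dom[OF riemM c]] by blast
  show "metric_on (gram N d) (coord_dom d)" by (rule metric_on_coord_dom[OF riemN d])
  show "smooth_on (local_rep \<phi> c d) (local_dom \<phi> c d)"
    using iso c d by (simp add: isometric_immersion_def smooth_map_def)
  show "local_rep \<phi> c d ` local_dom \<phi> c d \<subseteq> coord_dom d"
    by (auto simp: local_rep_def local_dom_eq patch_dom_def coord_dom_def chart_facts(3)[OF chart_M[OF c]])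
  show "mean_curv_norm (gram M c) (gram N d) (local_rep \<phi> c d) x = r" if "x \<in> local_dom \<phi> c d" for x
    by (rule cmc[OF c d that])
  show "divergence (gram M c) (stress_bienergy (gram M c) (gram N d) (local_rep \<phi> c d)) x = 0"
    if "x \<in> local_dom \<phi> c d" for x
    using bicons c d that by (simp add: biconservative_def)
qed

abbreviation "U c d \<equiv> umbilicity (gram M c) (gram N d) (local_rep \<phi> c d) r"

lemma transition_facts:
  assumes "riemannian_manifold R" "c \<in> atlas R" "d \<in> atlas R"
  shows "smooth_on (transition c d) (overlap_dom c d)"
    and "isometric_on (gram R c) (gram R d) (transition c d) (overlap_dom c d)"
  using assms unfolding riemannian_manifold_def riemannian_metric_def oriented_smooth_atlas_def isometric_on_def
  by blast+

lemma U_eq: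
  assumes c: "c \<in> atlas M" "c' \<in> atlas M" and d: "d \<in> atlas N" "d' \<in> atlas N"
    and p: "p \<in> patch_dom c d" "p \<in> patch_dom c' d'"
  shows "U c' d' (snd c' p) = U c d (snd c p)"
proof -
  define V where "V = patch_dom c d \<inter> patch_dom c' d'"
  define S where "S = snd c ` V"
  define S' where "S' = snd c' ` V"
  \<comment> \<open>The target is shrunk to the overlap of the two charts of N, where their
    transition map is defined.\<close>
  define T where "T = overlap_dom d d'"
  have V: "openin X V" unfolding V_def using openin_patch_dom c d by blast
  have Vsub: "V \<subseteq> fst c" "V \<subseteq> fst c'" "\<And>p. p \<in> V \<Longrightarrow> \<phi> p \<in> fst d \<inter> fst d'" by (auto simp: V_def patch_dom_def)
  note inv = chart_facts(3)[OF chart_M[OF c(1)]] chart_facts(3)[OF chart_M[OF c(2)]] chart_facts(3)[OF chart_N[OF d(1)]]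
  have S: "open S" "S \<subseteq> local_dom \<phi> c d" and S': "open S'" "S' \<subseteq> local_dom \<phi> c' d'" "S' \<subseteq> overlap_dom c' c"
    using chart_facts(4)[OF chart_M[OF c(1)] V Vsub(1)] chart_facts(4)[OF chart_M[OF c(2)] V Vsub(2)] Vsub
    by (auto simp: S_def S'_def local_dom_eq V_def overlap_dom_def)
  have "openin (points N) (fst d \<inter> fst d')" using chart_openin(2) d by blast
  then have T: "open T" "T \<subseteq> coord_dom d"
    using chart_facts(4)[OF chart_N[OF d(1)]] by (auto simp: T_def overlap_dom_def coord_dom_def)
  interpret patch_change "gram M c" "gram M c'" "gram N d" "gram N d'" S S' T "coord_dom d'"
    "local_rep \<phi> c d" "local_rep \<phi> c' d'" "transition c' c" "transition d d'" "snd c' p"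
  proof
    show "metric_on (gram M c) S" "metric_on (gram M c') S'" "metric_on (gram N d) T" "metric_on (gram N d') (coord_dom d')"
      using metric_on_subset[OF metric_on_coord_dom[OF riemM c(1)] S(1)] metric_on_subset[OF metric_on_coord_dom[OF riemM c(2)] S'(1)]
        metric_on_subset[OF metric_on_coord_dom[OF riemN d(1)] T] metric_on_coord_dom[OF riemN d(2)] Vsub
      by (auto simp: S_def S'_def coord_dom_def)
    show "smooth_on (local_rep \<phi> c d) S"
      using surface_patch.smooth_f[OF patch[OF c(1) d(1)]] S(2) by (rule smooth_on_subset)
    show "local_rep \<phi> c d ` S \<subseteq> T"
    proof -
      have "local_rep \<phi> c d (snd c p) \<in> T" if "p \<in> V" for p
        using that Vsub inv by (auto simp: local_rep_def T_def overlap_dom_def)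
      then show ?thesis by (auto simp: S_def)
    qed
    show "smooth_on (transition c' c) S'" "isometric_on (gram M c') (gram M c) (transition c' c) S'"
      using transition_facts[OF riemM c(2,1)] S'(3) smooth_on_subset by (auto simp: isometric_on_def)
    show "transition c' c ` S' \<subseteq> S"
    proof -
      have "transition c' c (snd c' p) \<in> S" if "p \<in> V" for p
        using that Vsub inv by (auto simp: transition_def S_def)
      then show ?thesis by (auto simp: S'_def)
    qed
    show "smooth_on (transition d d') T" "isometric_on (gram N d) (gram N d') (transition d d') T"
      unfolding T_def by (rule transition_facts[OF riemN d])+
    show "transition d d' ` T \<subseteq> coord_dom d'"
      using inv by (auto simp: T_def overlap_dom_def transition_def coord_dom_def)
    show "local_rep \<phi> c' d' y = transition d d' (local_rep \<phi> c d (transition c' c y))" if "y \<in> S'" for y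
    proof -
      obtain p where "p \<in> V" "y = snd c' p" using \<open>y \<in> S'\<close> by (auto simp: S'_def)
      then show ?thesis using Vsub inv by (auto simp: local_rep_def transition_def subset_iff)
    qed
    show "snd c' p \<in> S'" using p by (auto simp: S'_def V_def)
  qed
  \<comment> \<open>The patch in the charts \<open>c\<close>, \<open>d\<close> is set up again with
    the smaller target \<open>T\<close>, as the comparison lemma asks for a patch with the domain
    and target of the chart change.\<close>
  have "surface_patch (gram M c) S (gram N d) (local_rep \<phi> c d) T r"
  proof -
    interpret sp: surface_patch "gram M c" S "gram N d" "local_rep \<phi> c d" "coord_dom d" r
      by (rule surface_patch_subset[OF patch[OF c(1) d(1)] S])
    show ?thesis using g h f sp.cmc sp.divfree by unfold_locales
  qed
  from umbilicity_change[OF this surface_patch_subset[OF patch[OF c(2) d(2)] S'(1,2)]]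
  show ?thesis using p inv by (simp add: transition_def patch_dom_def)
qed

text \<open>By \<open>U_eq\<close> the charts chosen here are irrelevant.\<close>

definition "V p = (SOME y. \<exists>c\<in>atlas M. \<exists>d\<in>atlas N. p \<in> patch_dom c d \<and> y = U c d (snd c p))"

lemma V_eq:
  assumes "c \<in> atlas M" "d \<in> atlas N" "p \<in> patch_dom c d"
  shows "V p = U c d (snd c p)"
  unfolding V_def using assms by (intro some_equality) (auto intro: U_eq)

lemma local_domE:
  assumes "c \<in> atlas M" "d \<in> atlas N" "x \<in> local_dom \<phi> c d"
  obtains p where "p \<in> patch_dom c d" "x = snd c p" "V p = U c d x" "p \<in> topspace X"
  using assms V_eq chart_facts(2)[OF chart_M[OF assms(1)]] unfolding local_dom_eq patch_dom_def by blast

lemma openin_pullback: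
  assumes c: "c \<in> atlas M" and d: "d \<in> atlas N" and Z: "open Z"
  shows "openin X {p \<in> patch_dom c d. snd c p \<in> Z}"
proof -
  have "{p \<in> patch_dom c d. snd c p \<in> Z} = patch_dom c d \<inter> {p \<in> fst c. snd c p \<in> Z}"
    by (auto simp: patch_dom_def)
  then show ?thesis
    using openin_patch_dom[OF c d] chart_facts(5)[OF chart_M[OF c] Z] by (simp add: openin_Int)
qed

text \<open>Continuity of \<open>V\<close>: around each point it is the smooth function
  \<open>u\<close> of a single pair of charts.\<close>

lemma openin_V:
  assumes Z: "open Z"
  shows "openin X {p \<in> topspace X. V p \<in> Z}"
proof (subst openin_subopen, intro ballI)
  fix p assume "p \<in> {p \<in> topspace X. V p \<in> Z}"
  then have p: "p \<in> topspace X" "V p \<in> Z" by auto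
  obtain c d where cd: "c \<in> atlas M" "d \<in> atlas N" "p \<in> patch_dom c d" by (rule charts_exist[OF p(1)])
  interpret sp: surface_patch "gram M c" "local_dom \<phi> c d" "gram N d" "local_rep \<phi> c d" "coord_dom d" r
    by (rule patch[OF cd(1,2)])
  define O' where "O' = local_dom \<phi> c d \<inter> U c d -` Z"
  have "open O'"
    unfolding O'_def
    by (rule continuous_open_preimage[OF smooth_on_imp_continuous_on[OF sp.smooth_u] sp.open_S Z])
  then have "openin X {p \<in> patch_dom c d. snd c p \<in> O'}" by (rule openin_pullback[OF cd(1,2)])
  moreover have "p \<in> {p \<in> patch_dom c d. snd c p \<in> O'}"
    using cd p V_eq[OF cd] by (auto simp: O'_def local_dom_eq)
  moreover have "{p \<in> patch_dom c d. snd c p \<in> O'} \<subseteq> {p \<in> topspace X. V p \<in> Z}"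
    using V_eq[OF cd(1,2)] chart_facts(2)[OF chart_M[OF cd(1)]] by (auto simp: O'_def patch_dom_def)
  ultimately show "\<exists>T. openin X T \<and> p \<in> T \<and> T \<subseteq> {p \<in> topspace X. V p \<in> Z}" by blast
qed

lemma V_nonneg:
  assumes p: "p \<in> topspace X" shows "V p \<ge> 0"
proof -
  obtain c d where cd: "c \<in> atlas M" "d \<in> atlas N" "p \<in> patch_dom c d" by (rule charts_exist[OF p])
  interpret sp: surface_patch "gram M c" "local_dom \<phi> c d" "gram N d" "local_rep \<phi> c d" "coord_dom d" r
    by (rule patch[OF cd(1,2)])
  have "snd c p \<in> local_dom \<phi> c d" using cd by (simp add: local_dom_eq)
  from sp.u_eq[OF this] show ?thesis unfolding V_eq[OF cd] by simp
qed

lemma V_locally_constant: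
  assumes K: "nonneg_gauss_curv M" and p: "p \<in> topspace X" "V p > 0"
    and max: "\<And>p'. p' \<in> topspace X \<Longrightarrow> V p' \<le> V p"
  shows "\<exists>Y. openin X Y \<and> p \<in> Y \<and> (\<forall>p'\<in>Y. V p' = V p)"
proof -
  obtain c d where cd: "c \<in> atlas M" "d \<in> atlas N" "p \<in> patch_dom c d" by (rule charts_exist[OF p(1)])
  interpret sp: surface_patch "gram M c" "local_dom \<phi> c d" "gram N d" "local_rep \<phi> c d" "coord_dom d" r
    by (rule patch[OF cd(1,2)])
  \<comment> \<open>The open set on which log u is defined; it contains the point in question
    because \<open>V p\<close> is positive.\<close>
  define S where "S = local_dom \<phi> c d \<inter> U c d -` {0<..}"
  have "open S"
    unfolding S_def
    by (rule continuous_open_preimage[OF smooth_on_imp_continuous_on[OF sp.smooth_u] sp.open_S]) simp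
  then interpret sp': surface_patch "gram M c" S "gram N d" "local_rep \<phi> c d" "coord_dom d" r
    by (rule surface_patch_subset[OF patch[OF cd(1,2)]]) (simp add: S_def)
  have pS: "snd c p \<in> S" using cd p V_eq[OF cd] by (simp add: S_def local_dom_eq)
  have "local_dom \<phi> c d \<subseteq> coord_dom c" by (auto simp: local_dom_def coord_dom_def)
  have "\<exists>e>0. \<forall>y\<in>ball (snd c p) e. U c d y = U c d (snd c p)"
  proof (rule sp'.constant_near_max[OF _ _ pS])
    fix y assume y: "y \<in> S"
    then show "U c d y > 0" by (simp add: S_def)
    show "gauss_curv (gram M c) y \<ge> 0"
      using K cd(1) y \<open>local_dom \<phi> c d \<subseteq> coord_dom c\<close> by (auto simp: nonneg_gauss_curv_def S_def)
    have "y \<in> local_dom \<phi> c d" using y by (simp add: S_def)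
    then obtain p' where "V p' = U c d y" "p' \<in> topspace X" by (rule local_domE[OF cd(1,2)])
    then show "U c d y \<le> U c d (snd c p)" using max[of p'] V_eq[OF cd] by simp
  qed
  then obtain e where e: "e > 0" "\<forall>y\<in>ball (snd c p) e. U c d y = U c d (snd c p)" by blast
  show ?thesis
  proof (intro exI conjI)
    show "openin X {p' \<in> patch_dom c d. snd c p' \<in> ball (snd c p) e}"
      by (rule openin_pullback[OF cd(1,2)]) simp
    show "p \<in> {p' \<in> patch_dom c d. snd c p' \<in> ball (snd c p) e}" using cd e by simp
    show "\<forall>p'\<in>{p' \<in> patch_dom c d. snd c p' \<in> ball (snd c p) e}. V p' = V p"
    proof
      fix p' assume p': "p' \<in> {p' \<in> patch_dom c d. snd c p' \<in> ball (snd c p) e}"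
      then have "V p' = U c d (snd c p')" using V_eq[OF cd(1,2)] by blast
      also have "\<dots> = U c d (snd c p)" using e(2) p' by blast
      finally show "V p' = V p" using V_eq[OF cd] by simp
    qed
  qed
qed

lemma V_constant:
  assumes compact: "compact_space X" and K: "nonneg_gauss_curv M" and ne: "topspace X \<noteq> {}"
  shows "\<exists>m\<ge>0. \<forall>p\<in>topspace X. V p = m"
proof -
  have cont: "continuous_map X euclidean V"
    by (simp add: continuous_map_def openin_V)
  have "compact (V ` topspace X)"
    using image_compactin[OF _ cont, of "topspace X"] compact by (simp add: compact_space_def)
  then obtain m where "m \<in> V ` topspace X" "\<And>y. y \<in> V ` topspace X \<Longrightarrow> y \<le> m"
    using compact_attains_sup[of "V ` topspace X"] ne by blast
  then obtain p0 where p0: "p0 \<in> topspace X" and max: "\<And>p. p \<in> topspace X \<Longrightarrow> V p \<le> V p0" by blast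
  have "V p = V p0" if p: "p \<in> topspace X" for p
  proof (cases "V p0 > 0")
    \<comment> \<open>If the maximum is 0, nonnegativity makes \<open>V\<close> vanish
      identically.\<close>
    case False
    then show ?thesis using V_nonneg[OF p] V_nonneg[OF p0] max[OF p] by simp
  next
    case True
    \<comment> \<open>The set where the maximum is attained is open by the local result and closed
      by continuity, hence all of M by connectedness.\<close>
    define Z where "Z = {p \<in> topspace X. V p = V p0}"
    have "openin X Z"
    proof (subst openin_subopen, intro ballI)
      fix p assume "p \<in> Z"
      then have p: "p \<in> topspace X" "V p = V p0" by (auto simp: Z_def)
      obtain Y where Y: "openin X Y" "p \<in> Y" "\<forall>p'\<in>Y. V p' = V p"
        using V_locally_constant[OF K p(1)] True max p(2) by auto
      moreover have "Y \<subseteq> Z" using openin_subset[OF Y(1)] Y(3) p(2) by (auto simp: Z_def)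
      ultimately show "\<exists>T. openin X T \<and> p \<in> T \<and> T \<subseteq> Z" by blast
    qed
    moreover have "closedin X Z"
    proof -
      have "topspace X - Z = {p \<in> topspace X. V p \<in> - {V p0}}" by (auto simp: Z_def)
      moreover have "openin X {p \<in> topspace X. V p \<in> - {V p0}}" by (rule openin_V) auto
      ultimately show ?thesis unfolding closedin_def by (auto simp: Z_def)
    qed
    moreover have "connected_space X" using riemM by (simp add: riemannian_manifold_def)
    ultimately have "Z = {} \<or> Z = topspace X" by (simp add: connected_space_clopen_in)
    then show ?thesis using p p0 by (auto simp: Z_def)
  qed
  then show ?thesis using V_nonneg[OF p0] by blast
qed

lemma parallel_and_flat_or_pseudoumbilical:
  assumes "compact_space X" "nonneg_gauss_curv M"
  shows "parallel_shape_H M N \<phi> \<and> (flat M \<or> pseudoumbilical M N \<phi>)"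
proof -
  \<comment> \<open>The empty space also counts as connected; there any \<open>m\<close> \<ge> 0
    serves.\<close>
  obtain m where m: "m \<ge> 0" "\<And>p. p \<in> topspace X \<Longrightarrow> V p = m"
    using V_constant[OF assms] by (cases "topspace X = {}") auto
  have U: "U c d x = m" if "c \<in> atlas M" "d \<in> atlas N" "x \<in> local_dom \<phi> c d" for c d x
    using local_domE[OF that] m(2) by metis
  have "parallel_shape_H M N \<phi>"
    unfolding parallel_shape_H_def
  proof (intro ballI allI)
    fix c d x v w assume cd: "c \<in> atlas M" "d \<in> atlas N" and x: "x \<in> local_dom \<phi> c d"
    show "nabla_endo (gram M c) (shape_H (gram M c) (gram N d) (local_rep \<phi> c d)) x v w = 0"
      by (rule surface_patch.parallel_A[OF patch[OF cd] x m(1) U[OF cd]])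
  qed
  moreover have "flat M" if "m > 0"
    unfolding flat_def
  proof (intro ballI)
    fix c x assume c: "c \<in> atlas M" and "x \<in> coord_dom c"
    then obtain p where p: "p \<in> fst c" "x = snd c p" by (auto simp: coord_dom_def)
    then have "p \<in> topspace X" using chart_facts(2)[OF chart_M[OF c]] by blast
    \<comment> \<open>Flatness concerns the charts of M alone; a chart of N around the image point
      brings \<open>x\<close> into the scope of the local lemma.\<close>
    then obtain d where d: "d \<in> atlas N" "\<phi> p \<in> fst d"
      using charts_exist[of p] unfolding patch_dom_def by blast
    then have x: "x \<in> local_dom \<phi> c d" using p by (auto simp: local_dom_def)
    interpret sp: surface_patch "gram M c" "local_dom \<phi> c d" "gram N d" "local_rep \<phi> c d" "coord_dom d" r
      by (rule patch[OF c d(1)])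
    show "gauss_curv (gram M c) x = 0"
      by (rule sp.flat_of_constant[OF that U[OF c d(1)] x])
  qed
  moreover have "pseudoumbilical M N \<phi>" if "m = 0"
    unfolding pseudoumbilical_def
  proof (intro ballI allI)
    fix c d x v assume cd: "c \<in> atlas M" "d \<in> atlas N" and x: "x \<in> local_dom \<phi> c d"
    show "shape_H (gram M c) (gram N d) (local_rep \<phi> c d) x v =
        (mean_curv_norm (gram M c) (gram N d) (local_rep \<phi> c d) x)\<^sup>2 *\<^sub>R v"
      unfolding cmc[OF cd x]
      by (rule surface_patch.A_of_u_zero[OF patch[OF cd] x]) (simp add: U[OF cd x] that)
  qed
  ultimately show ?thesis using m(1) by fastforce
qed

end

theorem theorem5p7:
  fixes M :: "('a, 2) riemannian" and N :: "('b, 'n::finite) riemannian" and \<phi> :: "'a \<Rightarrow> 'b"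
  assumes "surface M N \<phi>"
    and "CMC M N \<phi>"
    and "biconservative M N \<phi>"
    and "compact_space (points M)"
    and "nonneg_gauss_curv M"
  shows "parallel_shape_H M N \<phi> \<and> (flat M \<or> pseudoumbilical M N \<phi>)"
proof -
  obtain r where "\<And>c d x. c \<in> atlas M \<Longrightarrow> d \<in> atlas N \<Longrightarrow> x \<in> local_dom \<phi> c d \<Longrightarrow>
      mean_curv_norm (gram M c) (gram N d) (local_rep \<phi> c d) x = r"
    using assms(2) unfolding CMC_def by blast
  then interpret cmc_surface M N \<phi> r
    using assms(1,3) by unfold_locales
  show ?thesis by (rule parallel_and_flat_or_pseudoumbilical[OF assms(4,5)])
qed

end
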